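(* Let $\Omega\subset\mathbb R^3$ be a quasi-cylindrical open set and let $\mathcal M$ be the Maxwell operator in $\Omega$. Then $\sigma_e(\mathcal M)\neq\emptyset$, and there exists a constant $C>0$ such that $$\min\sigma_e(\mathcal M)\le\frac{C}{R^2},$$ where $R$ is the supremum of all radii $R'>0$ for which $\Omega$ contains a sequence of pairwise disjoint balls $B(x_j,R')$ of fixed radius $R'$.
   Context: An open set $\Omega\subset\mathbb R^3$ is quasi-conical if there exists a sequence of pairwise disjoint cubes $Q_n(d_n)\subset\Omega$ of edge length $d_n$ with $d_n\to+\infty$. It is quasi-cylindrical if it is not quasi-conical and there exists a sequence of pairwise disjoint cubes $Q_n(d)\subset\Omega$ of fixed edge length $d>0$ (equivalently, a sequence of disjoint balls of some fixed radius contained in $\Omega$). Notation for an open set $\Omega\subseteq\mathbb R^3$: $\|\cdot\|$ is the $L^2$-norm. $\dot H^1_0(\Omega)=\{\varphi\in L^6(\Omega):\nabla\varphi\in L^2(\Omega)^3,\ \varphi=0\text{ locally on }\partial\Omega\}$. $H(\operatorname{div}0,\Omega)=\{u\in L^2(\Omega)^3:(u,\nabla\xi)=0\ \forall \xi\in\dot H^1_0(\Omega)\}$ (divergence-free fields). $H(\operatorname{curl},\Omega)=\{u\in L^2(\Omega)^3:\operatorname{curl}u\in L^2(\Omega)^3\}$ with graph norm; $H_0(\operatorname{curl},\Omega)$ is the closure of $C_c^\infty(\Omega)^3$ in it. $X_{N0}(\Omega)=H_0(\operatorname{curl},\Omega)\cap H(\operatorname{div}0,\Omega)$. The Maxwell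 operator $\mathcal M$ (formally $\operatorname{curl}\operatorname{curl}$) is the unique nonnegative self-adjoint operator in the Hilbert space $(H(\operatorname{div}0,\Omega),\|\cdot\|)$ associated with the closed densely defined quadratic form $u\mapsto\int_\Omega|\operatorname{curl}u|^2dx$, with form domain $X_{N0}(\Omega)$. Its essential spectrum is $$\sigma_e(\mathcal M)=\{\lambda\in\mathbb C:\exists (x_n)_n\subset\operatorname{dom}(\mathcal M),\ \|x_n\|=1,\ x_n\rightharpoonup0,\ \|(\mathcal M-\lambda)x_n\|\to0\}.$$ *)

theory Defs
  imports "HOL-Analysis.Analysis"
begin

section \<open>Quasi-conical and quasi-cylindrical sets\<close>

definition cube :: "real^3 \<Rightarrow> real \<Rightarrow> (real^3) set" where
  "cube a d = box a (\<chi> i. a $ i + d)"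

definition quasi_conical :: "(real^3) set \<Rightarrow> bool" where
  "quasi_conical \<Omega> \<longleftrightarrow>
     (\<exists>(a :: nat \<Rightarrow> real^3) d. (\<forall>n. 0 < d n) \<and> filterlim d at_top sequentially \<and>
        disjoint_family (\<lambda>n. cube (a n) (d n)) \<and> (\<forall>n. cube (a n) (d n) \<subseteq> \<Omega>))"

definition quasi_cylindrical :: "(real^3) set \<Rightarrow> bool" where
  "quasi_cylindrical \<Omega> \<longleftrightarrow> \<not> quasi_conical \<Omega> \<and>
     (\<exists>(a :: nat \<Rightarrow> real^3) d. 0 < d \<and>
        disjoint_family (\<lambda>n. cube (a n) d) \<and> (\<forall>n. cube (a n) d \<subseteq> \<Omega>))"

text \<open>The supremum is taken in the reals. For quasi-cylindrical sets the set of admissible radii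
  is nonempty (inscribed balls of the cubes), and it is bounded above: otherwise, for every
  \<open>n\<close> there are infinitely many disjoint balls of radius \<open>n\<close>, of which only finitely many
  meet a given bounded set, so one inductively selects disjoint cubes of edges tending
  to infinity.\<close>

definition ball_radius :: "(real^3) set \<Rightarrow> real" where
  "ball_radius \<Omega> =
     Sup {r. 0 < r \<and> (\<exists>x :: nat \<Rightarrow> real^3.
       disjoint_family (\<lambda>j. ball (x j) r) \<and> (\<forall>j. ball (x j) r \<subseteq> \<Omega>))}"

section \<open>Test functions\<close>

definition partial_deriv ::
    "3 \<Rightarrow> (real^3 \<Rightarrow> 'b::real_normed_vector) \<Rightarrow> real^3 \<Rightarrow> 'b" where
  "partial_deriv i f x = frechet_derivative f (at x) (axis i 1)"

text \<open>All iterated partial derivatives are everywhere differentiable; in particular they are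
  continuous, so this is \<open>C\<^sup>\<infinity>\<close>.\<close>

definition smooth :: "(real^3 \<Rightarrow> 'b::real_normed_vector) \<Rightarrow> bool" where
  "smooth f \<longleftrightarrow> (\<forall>is. foldr partial_deriv is f differentiable_on UNIV)"

definition test_functions :: "(real^3) set \<Rightarrow> (real^3 \<Rightarrow> 'b::real_normed_vector) set" where
  "test_functions \<Omega> = {\<phi>. smooth \<phi> \<and> compact (closure {x. \<phi> x \<noteq> 0}) \<and> closure {x. \<phi> x \<noteq> 0} \<subseteq> \<Omega>}"

definition curl :: "(real^3 \<Rightarrow> complex^3) \<Rightarrow> real^3 \<Rightarrow> complex^3" where
  "curl \<psi> x = vector
     [partial_deriv 2 (\<lambda>y. \<psi> y $ 3) x - partial_deriv 3 (\<lambda>y. \<psi> y $ 2) x,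
      partial_deriv 3 (\<lambda>y. \<psi> y $ 1) x - partial_deriv 1 (\<lambda>y. \<psi> y $ 3) x,
      partial_deriv 1 (\<lambda>y. \<psi> y $ 2) x - partial_deriv 2 (\<lambda>y. \<psi> y $ 1) x]"

section \<open>Lebesgue spaces\<close>

text \<open>Elements of \<open>L\<^sup>p(\<Omega>)\<close> are represented by functions on the whole space whose values outside
  \<open>\<Omega>\<close> play no role; functions that agree almost everywhere on \<open>\<Omega>\<close> represent the same element.
  The library inner product on \<open>complex^3\<close> is the real part of the Hermitian product, so the
  latter is introduced separately.\<close>

definition Lp :: "nat \<Rightarrow> (real^3) set \<Rightarrow> (real^3 \<Rightarrow> 'b::euclidean_space) set" where
  "Lp p \<Omega> = {u \<in> borel_measurable (lebesgue_on \<Omega>). integrable (lebesgue_on \<Omega>) (\<lambda>x. norm (u x) ^ p)}"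

definition L2_norm :: "(real^3) set \<Rightarrow> (real^3 \<Rightarrow> 'b::euclidean_space) \<Rightarrow> real" where
  "L2_norm \<Omega> u = sqrt (LINT x|lebesgue_on \<Omega>. norm (u x) ^ 2)"

definition hermitian :: "complex^3 \<Rightarrow> complex^3 \<Rightarrow> complex" where
  "hermitian a b = (\<Sum>i\<in>UNIV. a $ i * cnj (b $ i))"

definition L2_inner ::
    "(real^3) set \<Rightarrow> (real^3 \<Rightarrow> complex^3) \<Rightarrow> (real^3 \<Rightarrow> complex^3) \<Rightarrow> complex" where
  "L2_inner \<Omega> u v = (LINT x|lebesgue_on \<Omega>. hermitian (u x) (v x))"

section \<open>Weak gradient and weak curl\<close>

definition is_weak_grad ::
    "(real^3) set \<Rightarrow> (real^3 \<Rightarrow> complex) \<Rightarrow> (real^3 \<Rightarrow> complex^3) \<Rightarrow> bool" where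
  "is_weak_grad \<Omega> \<phi> g \<longleftrightarrow>
     (\<forall>\<psi> \<in> test_functions \<Omega>. \<forall>i.
        (LINT x|lebesgue_on \<Omega>. \<phi> x * partial_deriv i \<psi> x) = - (LINT x|lebesgue_on \<Omega>. g x $ i * \<psi> x))"

definition is_weak_curl ::
    "(real^3) set \<Rightarrow> (real^3 \<Rightarrow> complex^3) \<Rightarrow> (real^3 \<Rightarrow> complex^3) \<Rightarrow> bool" where
  "is_weak_curl \<Omega> u w \<longleftrightarrow> (\<forall>\<psi> \<in> test_functions \<Omega>. L2_inner \<Omega> u (curl \<psi>) = L2_inner \<Omega> w \<psi>)"

text \<open>Square-integrable weak derivatives are unique up to null sets; a representative is chosen.\<close>

definition weak_grad :: "(real^3) set \<Rightarrow> (real^3 \<Rightarrow> complex) \<Rightarrow> real^3 \<Rightarrow> complex^3" where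
  "weak_grad \<Omega> \<phi> = (SOME g. g \<in> Lp 2 \<Omega> \<and> is_weak_grad \<Omega> \<phi> g)"

definition weak_curl :: "(real^3) set \<Rightarrow> (real^3 \<Rightarrow> complex^3) \<Rightarrow> real^3 \<Rightarrow> complex^3" where
  "weak_curl \<Omega> u = (SOME w. w \<in> Lp 2 \<Omega> \<and> is_weak_curl \<Omega> u w)"

section \<open>Function spaces\<close>

definition H1 :: "(real^3) set \<Rightarrow> (real^3 \<Rightarrow> complex) set" where
  "H1 \<Omega> = {\<phi> \<in> Lp 2 \<Omega>. \<exists>g \<in> Lp 2 \<Omega>. is_weak_grad \<Omega> \<phi> g}"

definition H1_norm :: "(real^3) set \<Rightarrow> (real^3 \<Rightarrow> complex) \<Rightarrow> real" where
  "H1_norm \<Omega> \<phi> = sqrt (L2_norm \<Omega> \<phi> ^ 2 + L2_norm \<Omega> (weak_grad \<Omega> \<phi>) ^ 2)"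

definition H1_0 :: "(real^3) set \<Rightarrow> (real^3 \<Rightarrow> complex) set" where
  "H1_0 \<Omega> = {\<phi> \<in> H1 \<Omega>. \<forall>\<epsilon>>0. \<exists>\<psi> \<in> test_functions \<Omega>. H1_norm \<Omega> (\<lambda>x. \<phi> x - \<psi> x) < \<epsilon>}"

text \<open>The condition \<open>\<phi> = 0\<close> locally on the boundary means that every localization of \<open>\<phi>\<close> by a
  cut-off from \<open>C\<^sub>c\<^sup>\<infinity>\<close> of the whole space lies in \<open>H\<^sup>1\<^sub>0(\<Omega>)\<close>.\<close>

definition vanishes_locally_on_boundary :: "(real^3) set \<Rightarrow> (real^3 \<Rightarrow> complex) \<Rightarrow> bool" where
  "vanishes_locally_on_boundary \<Omega> \<phi> \<longleftrightarrow> (\<forall>\<eta> \<in> test_functions UNIV. (\<lambda>x. \<eta> x * \<phi> x) \<in> H1_0 \<Omega>)"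

definition dot_H1_0 :: "(real^3) set \<Rightarrow> (real^3 \<Rightarrow> complex) set" where
  "dot_H1_0 \<Omega> = {\<phi> \<in> Lp 6 \<Omega>. (\<exists>g \<in> Lp 2 \<Omega>. is_weak_grad \<Omega> \<phi> g) \<and> vanishes_locally_on_boundary \<Omega> \<phi>}"

definition H_div0 :: "(real^3) set \<Rightarrow> (real^3 \<Rightarrow> complex^3) set" where
  "H_div0 \<Omega> = {u \<in> Lp 2 \<Omega>. \<forall>\<xi> \<in> dot_H1_0 \<Omega>. L2_inner \<Omega> u (weak_grad \<Omega> \<xi>) = 0}"

definition H_curl :: "(real^3) set \<Rightarrow> (real^3 \<Rightarrow> complex^3) set" where
  "H_curl \<Omega> = {u \<in> Lp 2 \<Omega>. \<exists>w \<in> Lp 2 \<Omega>. is_weak_curl \<Omega> u w}"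

definition H_curl_norm :: "(real^3) set \<Rightarrow> (real^3 \<Rightarrow> complex^3) \<Rightarrow> real" where
  "H_curl_norm \<Omega> u = sqrt (L2_norm \<Omega> u ^ 2 + L2_norm \<Omega> (weak_curl \<Omega> u) ^ 2)"

definition H0_curl :: "(real^3) set \<Rightarrow> (real^3 \<Rightarrow> complex^3) set" where
  "H0_curl \<Omega> = {u \<in> H_curl \<Omega>. \<forall>\<epsilon>>0. \<exists>\<psi> \<in> test_functions \<Omega>. H_curl_norm \<Omega> (\<lambda>x. u x - \<psi> x) < \<epsilon>}"

definition X_N0 :: "(real^3) set \<Rightarrow> (real^3 \<Rightarrow> complex^3) set" where
  "X_N0 \<Omega> = H0_curl \<Omega> \<inter> H_div0 \<Omega>"

section \<open>The Maxwell operator and its essential spectrum\<close>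

definition maxwell_form ::
    "(real^3) set \<Rightarrow> (real^3 \<Rightarrow> complex^3) \<Rightarrow> (real^3 \<Rightarrow> complex^3) \<Rightarrow> complex" where
  "maxwell_form \<Omega> u v = L2_inner \<Omega> (weak_curl \<Omega> u) (weak_curl \<Omega> v)"

text \<open>The graph of the self-adjoint operator in \<open>H_div0 \<Omega>\<close> associated with the form by the first
  representation theorem: the pairs \<open>(u, f)\<close> with \<open>u\<close> in the domain and \<open>f\<close> the image of \<open>u\<close>.
  Since the form domain is dense in \<open>H_div0 \<Omega>\<close>, the image is unique up to null sets.\<close>

definition maxwell :: "(real^3) set \<Rightarrow> ((real^3 \<Rightarrow> complex^3) \<times> (real^3 \<Rightarrow> complex^3)) set" where
  "maxwell \<Omega> = {(u, f). u \<in> X_N0 \<Omega> \<and> f \<in> H_div0 \<Omega> \<and>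
     (\<forall>v \<in> X_N0 \<Omega>. maxwell_form \<Omega> u v = L2_inner \<Omega> f v)}"

definition weakly_null :: "(real^3) set \<Rightarrow> (nat \<Rightarrow> real^3 \<Rightarrow> complex^3) \<Rightarrow> bool" where
  "weakly_null \<Omega> u \<longleftrightarrow> (\<forall>v \<in> H_div0 \<Omega>. (\<lambda>n. L2_inner \<Omega> (u n) v) \<longlonglongrightarrow> 0)"

definition maxwell_essential_spectrum :: "(real^3) set \<Rightarrow> complex set" where
  "maxwell_essential_spectrum \<Omega> =
     {z. \<exists>u f. (\<forall>n. (u n, f n) \<in> maxwell \<Omega> \<and> L2_norm \<Omega> (u n) = 1) \<and> weakly_null \<Omega> u \<and>
        (\<lambda>n. L2_norm \<Omega> (\<lambda>x. f n x - (\<chi> i. z * u n x $ i))) \<longlonglongrightarrow> 0}"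

end

theory Submission imports Defs
begin

text \<open>
  Why the theorem holds. The bottom of the essential spectrum of the operator of a closed
  nonnegative form is the number \<open>\<mu>\<close> obtained as the supremum, over all finite orthonormal sets
  \<open>F\<close> in the form domain, of the infimum of the form on unit vectors orthogonal to \<open>F\<close>. Hence
  \<open>\<mu>\<close> is at most the form bound of any infinite orthonormal sequence, and disjoint balls of radius
  \<open>r\<close> provide such a sequence: put into each ball a translated and dilated copy of one
  fixed smooth divergence-free field with compact support. The copies are orthogonal because their
  supports are disjoint, and their Rayleigh quotients all equal \<open>model_ratio / r\<^sup>2\<close> by scaling.
  Since this holds for every admissible \<open>r\<close>, it passes to the supremum of the radii.

  That \<open>\<mu>\<close> is attained in the essential spectrum is the abstract theorem
  \<open>singular_sequence_at_infimum\<close>. It avoids the spectral theorem. Choose orthonormal \<open>u\<^sub>n\<close>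
  whose form values exceed \<open>\<mu>\<close> by at most \<open>1 / (n + 1)\<close>; they tend to zero weakly by
  Bessel's inequality. Correct them with the resolvent, \<open>v\<^sub>n = (\<mu> + 1) (M + 1)\<^sup>-\<^sup>1 u\<^sub>n\<close>, which
  lies in the operator domain and satisfies \<open>(M - \<mu>) v\<^sub>n = (\<mu> + 1) (u\<^sub>n - v\<^sub>n)\<close>. The form minus \<open>\<mu>\<close> is
  asymptotically nonnegative along weakly null sequences; applied to \<open>v\<^sub>n\<close>, this forces
  \<open>u\<^sub>n - v\<^sub>n \<rightarrow> 0\<close> in the form norm. The resolvent is the first component of an orthogonal projection
  onto the graph of the curl. Conversely, a singular sequence for any \<open>z\<close> in
  the essential spectrum has form values tending to \<open>z\<close>, so that \<open>z\<close> is real and at least \<open>\<mu>\<close>.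

  To apply this, square-integrable fields modulo null sets are made into a real Hilbert space, the type
  \<open>l2\<close>; the complex structure survives as a linear isometry \<open>mult_i_l2\<close>. The pairs of a field in
  \<open>X_N0\<close> and its weak curl become a closed subspace (\<open>X_N0_form_graph\<close>,
  \<open>form_graph_X_N0\<close>). This rests on the uniqueness of weak curls, that is, on the density
  of test functions (\<open>fundamental_lemma\<close>), and on the symmetry of the curl on test functions
  (\<open>curl_symmetric\<close>).
\<close>

section \<open>The bottom of the essential spectrum of a closed form\<close>

text \<open>
  A minimizing sequence of the distance to \<open>y\<close> is Cauchy by the parallelogram identity; its limit is
  the projection.
\<close>

lemma closed_subspace_projection:
  fixes S :: "'k::{real_inner, complete_space} set"
  assumes "subspace S" "closed S"
  obtains p where "p \<in> S" "\<And>x. x \<in> S \<Longrightarrow> inner (y - p) x = 0"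
proof -
  define d where "d = (INF x\<in>S. (norm (y - x))\<^sup>2)"
  have bdd: "bdd_below ((\<lambda>x. (norm (y - x))\<^sup>2) ` S)"
    by (rule bdd_belowI[of _ 0]) auto
  have S0: "0 \<in> S" using assms(1) by (rule subspace_0)
  have d_le: "d \<le> (norm (y - x))\<^sup>2" if "x \<in> S" for x
    unfolding d_def using bdd that by (rule cINF_lower)
  have "\<exists>x\<in>S. (norm (y - x))\<^sup>2 < d + 1 / real (Suc n)" for n
    using cINF_less_iff[OF _ bdd, of "d + 1 / real (Suc n)"] S0 unfolding d_def[symmetric] by auto
  then obtain X where X: "\<And>n. X n \<in> S" "\<And>n. (norm (y - X n))\<^sup>2 < d + 1 / real (Suc n)"
    by metis
  have par: "(norm (X m - X n))\<^sup>2 \<le> 2 / real (Suc m) + 2 / real (Suc n)" for m n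
  proof -
    have "(1/2) *\<^sub>R (X m + X n) \<in> S"
      using X assms(1) by (auto intro!: subspace_scale subspace_add)
    from d_le[OF this] have "4 * d \<le> 4 * (norm (y - (1/2) *\<^sub>R (X m + X n)))\<^sup>2" by simp
    also have "\<dots> = 2 * (norm (y - X m))\<^sup>2 + 2 * (norm (y - X n))\<^sup>2 - (norm (X m - X n))\<^sup>2"
      unfolding power2_norm_eq_inner
      by (simp add: inner_simps algebra_simps inner_commute)
    finally show ?thesis using X(2)[of m] X(2)[of n] by (simp add: algebra_simps)
  qed
  have "Cauchy X"
  proof (rule metric_CauchyI)
    fix e :: real assume e: "0 < e"
    obtain N where N: "4 / e\<^sup>2 < real N" using reals_Archimedean2 by blast
    have "dist (X m) (X n) < e" if "m \<ge> N" "n \<ge> N" for m n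
    proof -
      have N0: "real N > 0" using N e by (smt (verit) divide_pos_pos zero_less_power)
      have "2 / real (Suc m) \<le> 2 / real N" "2 / real (Suc n) \<le> 2 / real N"
        using that N0 by (auto intro!: divide_left_mono mult_pos_pos)
      then have "(norm (X m - X n))\<^sup>2 \<le> 4 / real N" using par[of m n] by linarith
      also have "\<dots> < e\<^sup>2" using N N0 e by (simp add: field_simps)
      finally show ?thesis using e by (simp add: dist_norm power_less_imp_less_base)
    qed
    then show "\<exists>M. \<forall>m\<ge>M. \<forall>n\<ge>M. dist (X m) (X n) < e" by blast
  qed
  then obtain p where p: "X \<longlonglongrightarrow> p" using Cauchy_convergent convergent_def by blast
  have pS: "p \<in> S" using closed_sequentially[OF assms(2)] X(1) p by blast
  have "(\<lambda>n. (norm (y - X n))\<^sup>2) \<longlonglongrightarrow> (norm (y - p))\<^sup>2" by (intro tendsto_intros p)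
  moreover have "(\<lambda>n. d + 1 / real (Suc n)) \<longlonglongrightarrow> d + 0"
    by (intro tendsto_intros LIMSEQ_Suc[OF lim_1_over_n])
  ultimately have pd: "(norm (y - p))\<^sup>2 \<le> d"
    using LIMSEQ_le X(2) by (metis (no_types, lifting) add.right_neutral less_imp_le)
  have "inner (y - p) x = 0" if x: "x \<in> S" for x
  proof (cases "x = 0")
    case False
    define t where "t = inner (y - p) x / (norm x)\<^sup>2"
    have "p + t *\<^sub>R x \<in> S" using pS x assms(1) by (auto intro: subspace_add subspace_scale)
    from d_le[OF this] pd have "(norm (y - p))\<^sup>2 \<le> (norm ((y - p) - t *\<^sub>R x))\<^sup>2"
      by (simp add: diff_diff_eq del: power_mono_iff power2_le_iff_abs_le)
    also have "\<dots> = (norm (y - p))\<^sup>2 - 2 * t * inner (y - p) x + t\<^sup>2 * (norm x)\<^sup>2"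
      unfolding power2_norm_eq_inner
      by (simp add: inner_diff_left inner_diff_right inner_commute power2_eq_square algebra_simps)
    also have "t\<^sup>2 * (norm x)\<^sup>2 = t * inner (y - p) x" using False by (simp add: t_def power2_eq_square)
    finally have "t * inner (y - p) x \<le> 0" by simp
    then have "(inner (y - p) x)\<^sup>2 \<le> 0" using False
      by (simp add: t_def power2_eq_square divide_le_0_iff mult_le_0_iff not_le flip: power2_eq_square)
    then show ?thesis by simp
  qed simp
  with pS show ?thesis using that by blast
qed

definition orthonormal_set :: "'h::real_inner set \<Rightarrow> bool" where
  "orthonormal_set F \<longleftrightarrow> (\<forall>e\<in>F. \<forall>e'\<in>F. inner e e' = (if e = e' then 1 else 0))"

text \<open>Bessel: the squares of the coefficients of \<open>y\<close> are summable, so the coefficients tend to zero.\<close>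
lemma orthonormal_seq_weakly_null:
  fixes u :: "nat \<Rightarrow> 'h::real_inner"
  assumes "\<And>i j. inner (u i) (u j) = (if i = j then 1 else 0)"
  shows "(\<lambda>n. inner (u n) y) \<longlonglongrightarrow> 0"
proof -
  have "(\<Sum>k<n. (inner (u k) y)\<^sup>2) \<le> (norm y)\<^sup>2" for n
  proof -
    define p where "p = (\<Sum>k<n. inner (u k) y *\<^sub>R u k)"
    have py: "inner p y = (\<Sum>k<n. (inner (u k) y)\<^sup>2)"
      by (simp add: p_def inner_sum_left power2_eq_square)
    have "inner (u k) p = inner (u k) y" if "k < n" for k
      using that by (simp add: p_def inner_sum_right assms if_distrib cong: if_cong)
    then have "inner p p = (\<Sum>k<n. inner (u k) y * inner (u k) y)"
      by (subst p_def, subst inner_sum_left) simp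
    then have pp: "inner p p = (\<Sum>k<n. (inner (u k) y)\<^sup>2)" by (simp add: power2_eq_square)
    have "0 \<le> inner (y - p) (y - p)" by simp
    also have "\<dots> = (norm y)\<^sup>2 - inner p y"
      using pp py by (simp add: inner_simps inner_commute power2_norm_eq_inner)
    finally show ?thesis using py by simp
  qed
  then have "summable (\<lambda>k. (inner (u k) y)\<^sup>2)"
    by (intro bounded_imp_summable[where B="(norm y)\<^sup>2"])
      (auto simp: lessThan_Suc_atMost[symmetric] simp del: sum.lessThan_Suc)
  then have "(\<lambda>k. (inner (u k) y)\<^sup>2) \<longlonglongrightarrow> 0" by (rule summable_LIMSEQ_zero)
  from tendsto_real_sqrt[OF this] show ?thesis by (simp add: tendsto_rabs_zero_iff)
qed

text \<open>A closed form is encoded by a closed subspace \<open>G\<close> of pairs \<open>(u, w)\<close>, with value \<open>\<parallel>w\<parallel>\<^sup>2\<close> at \<open>u\<close>; in the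
application, \<open>w\<close> is the curl of \<open>u\<close>. The numbers \<open>t\<close> with \<open>form_bound G t\<close> are those
below the form on the orthogonal complement of some finite set, so their supremum is the limit
of the min-max values. Orthonormality of \<open>F\<close> makes the projection onto its span explicit.\<close>
definition form_bound :: "('h::real_inner \<times> 'h) set \<Rightarrow> real \<Rightarrow> bool" where
  "form_bound G t \<longleftrightarrow> (\<exists>F. finite F \<and> F \<subseteq> fst ` G \<and> orthonormal_set F \<and>
     (\<forall>(u, w)\<in>G. (\<forall>e\<in>F. inner u e = 0) \<longrightarrow> t * (norm u)\<^sup>2 \<le> (norm w)\<^sup>2))"

lemma form_bound_mono: "form_bound G t \<Longrightarrow> s \<le> t \<Longrightarrow> form_bound G s"
  unfolding form_bound_def by (smt (verit) case_prodD case_prodI2 mult_right_mono zero_le_power2)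

lemma form_bound_0: "form_bound G 0"
  unfolding form_bound_def by (rule exI[of _ "{}"]) (auto simp: orthonormal_set_def)

text \<open>The projection of a weakly null sequence onto the span of the finite set \<open>F\<close> tends to zero, together with
its \<open>G\<close>-partner, because \<open>F\<close> lies in the form domain. Subtracting it costs a vanishing amount
and produces vectors to which the bound on the complement of \<open>F\<close> applies.\<close>
lemma form_bound_weakly_null:
  fixes G :: "('h::real_inner \<times> 'h) set"
  assumes G: "subspace G" and fb: "form_bound G t" and vw: "\<And>n. (v n, w n) \<in> G"
    and wn: "\<And>x. x \<in> fst ` G \<Longrightarrow> (\<lambda>n. inner (v n) x) \<longlonglongrightarrow> 0"
    and bv: "\<And>n. norm (v n) \<le> K" and bw: "\<And>n. norm (w n) \<le> K" and e: "0 < e"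
  shows "eventually (\<lambda>n. t * (norm (v n))\<^sup>2 - e \<le> (norm (w n))\<^sup>2) sequentially"
proof -
  obtain F where F: "finite F" "F \<subseteq> fst ` G" "orthonormal_set F"
    and Fb: "\<And>u w. (u, w) \<in> G \<Longrightarrow> (\<And>e. e \<in> F \<Longrightarrow> inner u e = 0) \<Longrightarrow> t * (norm u)\<^sup>2 \<le> (norm w)\<^sup>2"
  proof -
    from fb obtain F where "finite F \<and> F \<subseteq> fst ` G \<and> orthonormal_set F \<and>
      (\<forall>(u, w)\<in>G. (\<forall>e\<in>F. inner u e = 0) \<longrightarrow> t * (norm u)\<^sup>2 \<le> (norm w)\<^sup>2)"
      unfolding form_bound_def ..
    then show ?thesis by (intro that[of F]) auto
  qed
  have "\<exists>y. (x, y) \<in> G" if "x \<in> F" for x using F(2) that by force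
  then obtain h where h: "\<And>x. x \<in> F \<Longrightarrow> (x, h x) \<in> G" by metis
  \<comment> \<open>\<open>p n\<close> is the projection of \<open>v n\<close> onto the span of \<open>F\<close>, and \<open>q n\<close> accompanies it in \<open>G\<close>.\<close>
  define p where "p n = (\<Sum>x\<in>F. inner (v n) x *\<^sub>R x)" for n
  define q where "q n = (\<Sum>x\<in>F. inner (v n) x *\<^sub>R h x)" for n
  have pq: "(p n, q n) \<in> G" for n
  proof -
    have "(\<Sum>x\<in>F. inner (v n) x *\<^sub>R (x, h x)) \<in> G"
      using h by (intro subspace_sum[OF G] subspace_scale[OF G])
    moreover have "(\<Sum>x\<in>F. inner (v n) x *\<^sub>R (x, h x)) = (p n, q n)"
      unfolding p_def q_def by (rule prod_eqI) (simp_all only: fst_sum snd_sum fst_scaleR snd_scaleR fst_conv snd_conv)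
    ultimately show ?thesis by (simp only:)
  qed
  have "(v n, w n) - (p n, q n) \<in> G" for n using vw pq by (intro subspace_diff[OF G])
  then have d: "(v n - p n, w n - q n) \<in> G" for n by simp
  have orth: "inner (v n - p n) x = 0" if "x \<in> F" for x n
  proof -
    have "inner (p n) x = (\<Sum>y\<in>F. if y = x then inner (v n) y else 0)"
      unfolding p_def inner_sum_left using F(3) that
      by (intro sum.cong) (auto simp: orthonormal_set_def)
    also have "\<dots> = inner (v n) x" using that F(1) by simp
    finally show ?thesis by (simp add: inner_diff_left)
  qed
  have p0: "p \<longlonglongrightarrow> (\<Sum>x\<in>F. 0 *\<^sub>R x)" unfolding p_def
    by (intro tendsto_intros wn) (use F in auto)
  have q0: "q \<longlonglongrightarrow> (\<Sum>x\<in>F. 0 *\<^sub>R h x)" unfolding q_def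
    by (intro tendsto_intros wn) (use F in auto)
  have main: "t * (norm (v n - p n))\<^sup>2 \<le> (norm (w n - q n))\<^sup>2" for n
    using Fb[OF d orth] by auto
  define r where "r n = (norm (w n - q n))\<^sup>2 - (norm (w n))\<^sup>2
     - t * ((norm (v n - p n))\<^sup>2 - (norm (v n))\<^sup>2)" for n
  have aux: "(\<lambda>n. (norm (a n - b n))\<^sup>2 - (norm (a n))\<^sup>2) \<longlonglongrightarrow> 0"
    if b: "b \<longlonglongrightarrow> 0" and a: "\<And>n. norm (a n) \<le> K" for a b :: "nat \<Rightarrow> 'h"
  proof (rule tendsto_0_le[where K=1])
    show "(\<lambda>n. 2 * K * norm (b n) + (norm (b n))\<^sup>2) \<longlonglongrightarrow> 0"
      using tendsto_norm[OF b] by (auto intro!: tendsto_eq_intros b)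
    show "\<forall>\<^sub>F n in sequentially. norm ((norm (a n - b n))\<^sup>2 - (norm (a n))\<^sup>2)
      \<le> norm (2 * K * norm (b n) + (norm (b n))\<^sup>2) * 1"
    proof (rule always_eventually, rule allI)
      fix n
      have K: "0 \<le> K" using a[of n] norm_ge_zero order_trans by blast
      have "(norm (a n - b n))\<^sup>2 - (norm (a n))\<^sup>2 = (norm (b n))\<^sup>2 - 2 * inner (a n) (b n)"
        by (simp add: power2_norm_eq_inner inner_simps inner_commute)
      moreover have "\<bar>inner (a n) (b n)\<bar> \<le> K * norm (b n)"
        using Cauchy_Schwarz_ineq2[of "a n" "b n"] mult_right_mono[OF a[of n], of "norm (b n)"] by simp
      ultimately show "norm ((norm (a n - b n))\<^sup>2 - (norm (a n))\<^sup>2)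
      \<le> norm (2 * K * norm (b n) + (norm (b n))\<^sup>2) * 1"
        using mult_nonneg_nonneg[OF K norm_ge_zero[of "b n"]] zero_le_power2[of "norm (b n)"]
        unfolding real_norm_def mult_1_right mult.assoc by linarith
    qed
  qed
  have "(\<lambda>n. r n) \<longlonglongrightarrow> 0 - t * 0" unfolding r_def
    using p0 q0 by (intro tendsto_diff tendsto_mult tendsto_const aux bv bw) auto
  then have "eventually (\<lambda>n. r n < e) sequentially" using e by (auto dest: order_tendstoD(2))
  then show ?thesis
  proof eventually_elim
    case (elim n)
    then show ?case using main[of n] by (simp add: r_def algebra_simps)
  qed
qed

text \<open>The given orthonormal sequence with bounded form values ensures that \<open>\<mu>\<close> is finite. The
conclusions on \<open>v\<close>, \<open>w\<close>, \<open>f\<close> say that \<open>v n\<close> is in the domain of the operator, which maps it to \<open>f n\<close>,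
and that the \<open>v n\<close> form a singular sequence for \<open>\<mu>\<close>. The first two conclusions bound \<open>\<mu>\<close> by the limit
of the form along normalized weakly null sequences and by its bound on orthonormal ones.\<close>
theorem singular_sequence_at_infimum:
  fixes G :: "('h::{real_inner, complete_space} \<times> 'h) set"
    and \<phi> \<omega> :: "nat \<Rightarrow> 'h"
  assumes G: "subspace G" "closed G"
    and phi: "\<And>n. (\<phi> n, \<omega> n) \<in> G" "\<And>i j. inner (\<phi> i) (\<phi> j) = (if i = j then 1 else 0)"
       "\<And>n. (norm (\<omega> n))\<^sup>2 \<le> \<Lambda>"
  obtains \<mu> and v w f :: "nat \<Rightarrow> 'h" where
    "\<And>(\<phi> :: nat \<Rightarrow> 'h) \<omega> \<Lambda>. (\<And>n. (\<phi> n, \<omega> n) \<in> G) \<Longrightarrow> (\<And>n. norm (\<phi> n) = 1) \<Longrightarrow>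
       (\<And>x. x \<in> fst ` G \<Longrightarrow> (\<lambda>n. inner (\<phi> n) x) \<longlonglongrightarrow> 0) \<Longrightarrow>
       (\<lambda>n. (norm (\<omega> n))\<^sup>2) \<longlonglongrightarrow> \<Lambda> \<Longrightarrow> \<mu> \<le> \<Lambda>"
    "\<And>(\<phi> :: nat \<Rightarrow> 'h) \<omega> \<Lambda>. (\<And>n. (\<phi> n, \<omega> n) \<in> G) \<Longrightarrow> (\<And>i j. inner (\<phi> i) (\<phi> j) = (if i = j then 1 else 0)) \<Longrightarrow>
       (\<And>n. (norm (\<omega> n))\<^sup>2 \<le> \<Lambda>) \<Longrightarrow> \<mu> \<le> \<Lambda>"
    "\<And>n. (v n, w n) \<in> G" "\<And>n. f n \<in> fst ` G" "\<And>n. norm (v n) = 1"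
    "\<And>x. (\<lambda>n. inner (v n) x) \<longlonglongrightarrow> 0"
    "\<And>n x z. (x, z) \<in> G \<Longrightarrow> inner (w n) z = inner (f n) x"
    "(\<lambda>n. norm (f n - \<mu> *\<^sub>R v n)) \<longlonglongrightarrow> 0"
proof -
  define \<mu> where "\<mu> = Sup {t. form_bound G t}"
  have bound: "t \<le> \<Lambda>'" if fb: "form_bound G t" and G': "\<And>n. (\<phi>' n, \<omega>' n) \<in> G" and n: "\<And>n. norm (\<phi>' n) = 1"
     and wn: "\<And>x::'h. x \<in> fst ` G \<Longrightarrow> (\<lambda>n. inner (\<phi>' n) x) \<longlonglongrightarrow> 0"
     and K: "\<And>n. norm (\<omega>' n) \<le> K" and ub: "\<And>e. e > 0 \<Longrightarrow> eventually (\<lambda>n. (norm (\<omega>' n))\<^sup>2 \<le> \<Lambda>' + e) sequentially"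
     for t K \<Lambda>' and \<phi>' \<omega>' :: "nat \<Rightarrow> 'h"
  proof (rule field_le_epsilon)
    fix e :: real assume e: "0 < e"
    have "eventually (\<lambda>n. t * (norm (\<phi>' n))\<^sup>2 - e/2 \<le> (norm (\<omega>' n))\<^sup>2) sequentially"
      using e by (intro form_bound_weakly_null[OF G(1) fb G' wn, of "max 1 K"]) (auto simp: n K le_max_iff_disj)
    moreover have "eventually (\<lambda>n. (norm (\<omega>' n))\<^sup>2 \<le> \<Lambda>' + e/2) sequentially" using ub e by simp
    ultimately have "eventually (\<lambda>n. t \<le> \<Lambda>' + e) sequentially"
      by eventually_elim (use n in auto)
    then show "t \<le> \<Lambda>' + e" by simp
  qed
  have bound2: "t \<le> \<Lambda>'" if fb: "form_bound G t" and G': "\<And>n. (\<phi>' n, \<omega>' n) \<in> G" and n: "\<And>i j. inner (\<phi>' i) (\<phi>' j) = (if i = j then 1 else 0)"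
     and ub: "\<And>n. (norm (\<omega>' n))\<^sup>2 \<le> \<Lambda>'" for t \<Lambda>' and \<phi>' \<omega>' :: "nat \<Rightarrow> 'h"
  proof (rule bound[OF fb G'])
    show "norm (\<phi>' n) = 1" for n by (simp add: norm_eq_sqrt_inner n)
    show "(\<lambda>n. inner (\<phi>' n) x) \<longlonglongrightarrow> 0" for x :: 'h by (rule orthonormal_seq_weakly_null[OF n])
    show "norm (\<omega>' n) \<le> sqrt \<Lambda>'" for n using ub[of n] by (rule real_le_rsqrt)
    show "\<forall>\<^sub>F n in sequentially. (norm (\<omega>' n))\<^sup>2 \<le> \<Lambda>' + e" if "e > 0" for e
      using ub that by (intro always_eventually allI) (smt (verit))
  qed
  have bdd: "bdd_above {t. form_bound G t}"
    using bound2[OF _ phi] by (intro bdd_aboveI[of _ \<Lambda>]) auto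
  have mu0: "0 \<le> \<mu>" unfolding \<mu>_def using bdd form_bound_0 by (intro cSup_upper) auto
  have fb: "form_bound G t" if "t < \<mu>" for t
    using less_cSupD[of "{t. form_bound G t}" t] that form_bound_0 form_bound_mono less_imp_le
    unfolding \<mu>_def by blast
  have nfb: "\<not> form_bound G t" if "\<mu> < t" for t
    using cSup_upper[OF _ bdd, of t] that unfolding \<mu>_def by auto
  have prop1: "\<mu> \<le> \<Lambda>'" if G': "\<And>n. (\<phi>' n, \<omega>' n) \<in> G" and n: "\<And>n. norm (\<phi>' n) = 1"
     and wn: "\<And>x::'h. x \<in> fst ` G \<Longrightarrow> (\<lambda>n. inner (\<phi>' n) x) \<longlonglongrightarrow> 0"
     and lim: "(\<lambda>n. (norm (\<omega>' n))\<^sup>2) \<longlonglongrightarrow> \<Lambda>'" for \<Lambda>' and \<phi>' \<omega>' :: "nat \<Rightarrow> 'h"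
  proof -
    have "Bseq (\<lambda>n. (norm (\<omega>' n))\<^sup>2)" using lim by (intro convergent_imp_Bseq convergentI)
    then obtain B where B: "\<And>n. (norm (\<omega>' n))\<^sup>2 \<le> B" by (auto simp: Bseq_def)
    have "t \<le> \<Lambda>'" if "form_bound G t" for t
    proof (rule bound[OF that G' n wn])
      show "norm (\<omega>' n) \<le> sqrt B" for n using B[of n] by (rule real_le_rsqrt)
      show "\<forall>\<^sub>F n in sequentially. (norm (\<omega>' n))\<^sup>2 \<le> \<Lambda>' + e" if "e > 0" for e
        using order_tendstoD(2)[OF lim, of "\<Lambda>' + e"] that by (auto elim: eventually_mono)
    qed
    then show ?thesis unfolding \<mu>_def using form_bound_0 by (intro cSup_least) auto
  qed
  have prop2: "\<mu> \<le> \<Lambda>'" if G': "\<And>n. (\<phi>' n, \<omega>' n) \<in> G" and n: "\<And>i j. inner (\<phi>' i) (\<phi>' j) = (if i = j then 1 else 0)"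
     and ub: "\<And>n. (norm (\<omega>' n))\<^sup>2 \<le> \<Lambda>'" for \<Lambda>' and \<phi>' \<omega>' :: "nat \<Rightarrow> 'h"
    unfolding \<mu>_def using form_bound_0 bound2[OF _ that] by (intro cSup_least) auto

  \<comment> \<open>No number above \<open>\<mu>\<close> is a form bound, so each step can pick a vector orthogonal to all previous ones.\<close>
  define P where "P U n r \<longleftrightarrow> r \<in> G \<and> norm (fst r) = 1 \<and> (norm (snd r))\<^sup>2 < \<mu> + 1 / real (Suc n)
     \<and> (\<forall>m<n. inner (fst r) (fst (U m)) = 0)" for U :: "nat \<Rightarrow> 'h \<times> 'h" and n r
  have "\<exists>U. \<forall>n. P U n (U n)"
  proof (rule dependent_wellorder_choice)
    show "P U n r = P U' n r" if "\<And>m. m < n \<Longrightarrow> U m = U' m" for r U U' n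
      using that by (simp add: P_def)
    fix n U assume P: "\<And>m. m < n \<Longrightarrow> P U m (U m)"
    define F where "F = (\<lambda>m. fst (U m)) ` {..<n}"
    have FG: "finite F" "F \<subseteq> fst ` G" unfolding F_def using P by (auto simp: P_def)
    have "inner (fst (U i)) (fst (U j)) = 0" if "i < n" "j < n" "i \<noteq> j" for i j
      using P[of i] P[of j] that by (metis P_def inner_commute linorder_neqE_nat)
    moreover have "inner (fst (U i)) (fst (U i)) = 1" if "i < n" for i
      using P[OF that] by (metis P_def norm_eq_1)
    ultimately have "orthonormal_set F" unfolding orthonormal_set_def F_def
      by auto
    then have "\<not> (\<forall>(u, w)\<in>G. (\<forall>e\<in>F. inner u e = 0) \<longrightarrow> (\<mu> + 1 / real (Suc n)) * (norm u)\<^sup>2 \<le> (norm w)\<^sup>2)"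
      using nfb[of "\<mu> + 1 / real (Suc n)"] FG unfolding form_bound_def by auto
    then obtain u w where uw: "(u, w) \<in> G" "\<And>e. e \<in> F \<Longrightarrow> inner u e = 0"
      "(norm w)\<^sup>2 < (\<mu> + 1 / real (Suc n)) * (norm u)\<^sup>2" by (force simp: not_le)
    have u0: "norm u > 0" using uw(3) by auto
    have "(1 / norm u) *\<^sub>R (u, w) \<in> G" by (rule subspace_scale[OF G(1) uw(1)])
    then have "P U n ((1 / norm u) *\<^sub>R (u, w))"
      using uw(2,3) u0 by (auto simp: P_def F_def power_divide divide_less_eq)
    then show "\<exists>r. P U n r" by blast
  qed
  then obtain U where U: "\<And>n. P U n (U n)" by blast
  define u a where "u n = fst (U n)" and "a n = snd (U n)" for n
  have uG: "(u n, a n) \<in> G" for n using U[of n] by (simp add: P_def u_def a_def)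
  have u1: "norm (u n) = 1" for n using U[of n] by (simp add: P_def u_def)
  have a_le: "(norm (a n))\<^sup>2 < \<mu> + 1 / real (Suc n)" for n using U[of n] by (simp add: P_def a_def)
  have uorth: "inner (u i) (u j) = (if i = j then 1 else 0)" for i j
    using U[of i] U[of j] u1[of i]
    by (cases i j rule: linorder_cases) (auto simp: P_def u_def inner_commute norm_eq_1)
  have u_null: "(\<lambda>n. inner (u n) x) \<longlonglongrightarrow> 0" for x by (rule orthonormal_seq_weakly_null[OF uorth])

  \<comment> \<open>Projecting \<open>(y, 0)\<close> onto \<open>G\<close> gives \<open>(B y, C y)\<close>, where \<open>B\<close> is the resolvent at \<open>-1\<close> of the operator.\<close>
  have "\<forall>y. \<exists>p. p \<in> G \<and> (\<forall>x\<in>G. inner ((y, 0) - p) x = 0)"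
    by (rule allI, rule closed_subspace_projection[OF G]) blast
  from choice[OF this] obtain R where R: "\<And>y. R y \<in> G" "\<And>y x. x \<in> G \<Longrightarrow> inner ((y, 0) - R y) x = 0"
    by blast
  define B C where "B y = fst (R y)" and "C y = snd (R y)" for y
  have BG: "(B y, C y) \<in> G" for y using R(1) by (simp add: B_def C_def)
  have BC: "inner (B y) x + inner (C y) z = inner y x" if "(x, z) \<in> G" for x y z
    using R(2)[OF that, of y] by (simp add: B_def C_def inner_prod_def inner_diff_left)
  define v0 w0 where "v0 n = B ((\<mu> + 1) *\<^sub>R u n)" and "w0 n = C ((\<mu> + 1) *\<^sub>R u n)" for n
  have v0G: "(v0 n, w0 n) \<in> G" for n by (simp add: v0_def w0_def BG)
  have v0w0: "inner (v0 n) x + inner (w0 n) z = (\<mu> + 1) * inner (u n) x" if "(x, z) \<in> G" for n x z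
    using BC[OF that, of "(\<mu> + 1) *\<^sub>R u n"] by (simp add: v0_def w0_def)
  \<comment> \<open>The resolvent is symmetric, so it preserves weak convergence.\<close>
  have v0_null: "(\<lambda>n. inner (v0 n) x) \<longlonglongrightarrow> 0" for x
  proof -
    have "inner (v0 n) x = (\<mu> + 1) * inner (u n) (B x)" for n
      using v0w0[OF BG[of x], of n] BC[OF v0G[of n], of x] by (simp add: inner_commute)
    then show ?thesis using tendsto_mult_left[OF u_null[of "B x"], of "\<mu> + 1"] by simp
  qed
  \<comment> \<open>\<open>N n\<close> is the squared form norm of \<open>u n - v0 n\<close>; the task is to show that it tends to zero.\<close>
  define N where "N n = (norm (u n - v0 n))\<^sup>2 + (norm (a n - w0 n))\<^sup>2" for n
  have dG: "(u n - v0 n, a n - w0 n) \<in> G" for n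
    using subspace_diff[OF G(1) uG v0G, of n n] by simp
  have N: "N n = inner (a n) (a n - w0 n) - \<mu> * inner (u n) (u n - v0 n)" for n
    using v0w0[OF dG[of n], of n]
    by (simp add: N_def power2_norm_eq_inner inner_diff_left inner_diff_right inner_commute algebra_simps)
  have a_bd: "(norm (a n))\<^sup>2 \<le> \<mu> + 1" for n
    using a_le[of n] by (smt (verit) divide_le_eq_1_pos of_nat_0_less_iff of_nat_Suc of_nat_0_le_iff zero_less_Suc)
  \<comment> \<open>Complete squares in the identity \<open>N\<close>.\<close>
  have N_bd: "N n \<le> (\<mu> + 1) + \<mu>\<^sup>2" for n
  proof -
    have "0 \<le> (norm (a n - (a n - w0 n)))\<^sup>2 + (norm (\<mu> *\<^sub>R u n + (u n - v0 n)))\<^sup>2" by simp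
    also have "\<dots> = (norm (a n))\<^sup>2 - 2 * inner (a n) (a n - w0 n) + (norm (a n - w0 n))\<^sup>2
      + \<mu>\<^sup>2 * (norm (u n))\<^sup>2 + 2 * \<mu> * inner (u n) (u n - v0 n) + (norm (u n - v0 n))\<^sup>2"
      unfolding power2_norm_eq_inner
      by (simp add: inner_diff_left inner_diff_right inner_add_left inner_add_right inner_commute
          power2_eq_square algebra_simps)
    also have "\<dots> = (norm (a n))\<^sup>2 + \<mu>\<^sup>2 - N n"
      using u1[of n] N[of n] by (simp add: N_def)
    finally show ?thesis using a_bd[of n] by simp
  qed
  define K where "K = sqrt (\<mu> + 1 + \<mu>\<^sup>2) + sqrt (\<mu> + 1) + 1"
  have d_bd: "norm (u n - v0 n) \<le> sqrt (\<mu> + 1 + \<mu>\<^sup>2)" "norm (a n - w0 n) \<le> sqrt (\<mu> + 1 + \<mu>\<^sup>2)" for n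
    using N_bd[of n] unfolding N_def by (auto intro!: real_le_rsqrt) (smt (verit) zero_le_power2)+
  have v_bd: "norm (v0 n) \<le> K" for n
    using norm_triangle_sub[of "v0 n" "u n"] d_bd(1)[of n] u1[of n] mu0
    by (simp add: K_def norm_minus_commute) (smt (verit) real_sqrt_ge_zero)
  have w_bd: "norm (w0 n) \<le> K" for n
    using norm_triangle_sub[of "w0 n" "a n"] d_bd(2)[of n] real_le_rsqrt[OF a_bd[of n]]
    by (simp add: K_def norm_minus_commute)
  \<comment> \<open>Expand the form minus \<open>\<mu>\<close> at \<open>v0 = u - (u - v0)\<close>; the mixed term is \<open>- 2 N\<close>, the quadratic one at most \<open>N\<close>.\<close>
  have N_le: "N n \<le> 1 / real (Suc n) - ((norm (w0 n))\<^sup>2 - \<mu> * (norm (v0 n))\<^sup>2)" for n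
  proof -
    have "(norm (w0 n))\<^sup>2 - \<mu> * (norm (v0 n))\<^sup>2 =
       ((norm (a n))\<^sup>2 - \<mu> * (norm (u n))\<^sup>2) - 2 * N n + ((norm (a n - w0 n))\<^sup>2 - \<mu> * (norm (u n - v0 n))\<^sup>2)"
      unfolding N
      by (simp only: power2_norm_eq_inner inner_diff_left inner_diff_right)
        (simp add: inner_commute algebra_simps)
    also have "\<dots> \<le> 1 / real (Suc n) - 2 * N n + N n"
      using a_le[of n] mu0 u1[of n] by (simp add: N_def) (smt (verit) mult_nonneg_nonneg zero_le_power2)
    finally show ?thesis by simp
  qed
  have N0: "N \<longlonglongrightarrow> 0"
  proof (rule order_tendstoI)
    show "\<forall>\<^sub>F n in sequentially. e < N n" if "e < 0" for e
      using that by (intro always_eventually allI) (smt (verit) N_def zero_le_power2)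
    fix e :: real assume e: "0 < e"
    have K0: "K > 0" using v_bd[of 0] mu0 by (simp add: K_def add_nonneg_pos)
    \<comment> \<open>Replacing \<open>\<mu>\<close> by \<open>t\<close> changes the form at \<open>v0 n\<close> by at most \<open>e / 4\<close>.\<close>
    define t where "t = \<mu> - e / (4 * K\<^sup>2)"
    have "t < \<mu>" using e K0 by (simp add: t_def)
    have "\<forall>\<^sub>F n in sequentially. t * (norm (v0 n))\<^sup>2 - e/4 \<le> (norm (w0 n))\<^sup>2"
      using e by (intro form_bound_weakly_null[OF G(1) fb[OF \<open>t < \<mu>\<close>] v0G v0_null v_bd w_bd]) auto
    moreover have "(\<lambda>n. 1 / real (Suc n)) \<longlonglongrightarrow> 0" by (rule LIMSEQ_Suc[OF lim_1_over_n])
    then have "\<forall>\<^sub>F n in sequentially. 1 / real (Suc n) < e / 4"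
      using e by (intro order_tendstoD(2)) auto
    ultimately show "\<forall>\<^sub>F n in sequentially. N n < e"
    proof eventually_elim
      case (elim n)
      have "(\<mu> - t) * (norm (v0 n))\<^sup>2 \<le> (\<mu> - t) * K\<^sup>2"
        using \<open>t < \<mu>\<close> v_bd[of n] by (intro mult_left_mono power_mono) auto
      also have "\<dots> = e / 4" using K0 by (simp add: t_def)
      finally have "(\<mu> - t) * (norm (v0 n))\<^sup>2 \<le> e/4" .
      then show ?case using elim N_le[of n] e by (simp add: algebra_simps)
    qed
  qed
  have d0: "(\<lambda>n. norm (u n - v0 n)) \<longlonglongrightarrow> 0"
  proof (rule tendsto_sandwich[where f="\<lambda>_. 0"])
    show "(\<lambda>n. sqrt (N n)) \<longlonglongrightarrow> 0" using tendsto_real_sqrt[OF N0] by simp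
    show "\<forall>\<^sub>F n in sequentially. norm (u n - v0 n) \<le> sqrt (N n)"
      by (intro always_eventually allI real_le_rsqrt) (simp add: N_def)
  qed auto
  have v1: "(\<lambda>n. norm (v0 n)) \<longlonglongrightarrow> 1"
  proof (rule LIM_zero_cancel, rule tendsto_0_le[OF d0, where K=1])
    show "\<forall>\<^sub>F n in sequentially. norm (norm (v0 n) - 1) \<le> norm (norm (u n - v0 n)) * 1"
    proof (intro always_eventually allI)
      show "norm (norm (v0 n) - 1) \<le> norm (norm (u n - v0 n)) * 1" for n
        using norm_triangle_ineq3[of "v0 n" "u n"] by (simp add: u1 norm_minus_commute)
    qed
  qed
  then have "\<forall>\<^sub>F n in sequentially. norm (v0 n) > 1/2" by (intro order_tendstoD(1)) auto
  \<comment> \<open>Drop the first \<open>M\<close> terms so that the rest can be normalized.\<close>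
  then obtain M where M: "\<And>n. n \<ge> M \<Longrightarrow> norm (v0 n) > 1/2" by (auto simp: eventually_sequentially)
  define s where "s n = 1 / norm (v0 (n + M))" for n
  have s: "s \<longlonglongrightarrow> 1 / 1" unfolding s_def
    by (intro tendsto_intros LIMSEQ_ignore_initial_segment[OF v1]) auto
  define v w f where "v n = s n *\<^sub>R v0 (n + M)" and "w n = s n *\<^sub>R w0 (n + M)"
    and "f n = s n *\<^sub>R ((\<mu> + 1) *\<^sub>R u (n + M) - v0 (n + M))" for n
  show ?thesis
  proof (rule that[of \<mu> v w f])
    show "\<mu> \<le> \<Lambda>'" if "\<And>n. (\<phi>' n, \<omega>' n) \<in> G" "\<And>n. norm (\<phi>' n) = 1"
      "\<And>x. x \<in> fst ` G \<Longrightarrow> (\<lambda>n. inner (\<phi>' n) x) \<longlonglongrightarrow> 0" "(\<lambda>n. (norm (\<omega>' n))\<^sup>2) \<longlonglongrightarrow> \<Lambda>'"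
      for \<phi>' \<omega>' :: "nat \<Rightarrow> 'h" and \<Lambda>'
      using that by (rule prop1)
    show "\<mu> \<le> \<Lambda>'" if "\<And>n. (\<phi>' n, \<omega>' n) \<in> G" "\<And>i j. inner (\<phi>' i) (\<phi>' j) = (if i = j then 1 else 0)"
      "\<And>n. (norm (\<omega>' n))\<^sup>2 \<le> \<Lambda>'"
      for \<phi>' \<omega>' :: "nat \<Rightarrow> 'h" and \<Lambda>'
      using that by (rule prop2)
    show "(v n, w n) \<in> G" for n
      using subspace_scale[OF G(1) v0G[of "n + M"], of "s n"] by (simp add: v_def w_def)
    have "s n *\<^sub>R ((\<mu> + 1) *\<^sub>R (u (n + M), a (n + M)) - (v0 (n + M), w0 (n + M))) \<in> G" for n
      by (intro subspace_scale subspace_diff uG v0G G)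
    then show "f n \<in> fst ` G" for n by (force simp: f_def)
    show "norm (v n) = 1" for n using M[of "n + M"] by (auto simp: v_def s_def)
    show "(\<lambda>n. inner (v n) x) \<longlonglongrightarrow> 0" for x
      unfolding v_def using tendsto_mult[OF s LIMSEQ_ignore_initial_segment[OF v0_null, of M x]] by simp
    show "inner (w n) z = inner (f n) x" if "(x, z) \<in> G" for n x z
    proof -
      have "inner (w0 (n + M)) z = inner ((\<mu> + 1) *\<^sub>R u (n + M) - v0 (n + M)) x"
        using v0w0[OF that, of "n + M"] by (simp add: inner_diff_left)
      then show ?thesis by (simp add: w_def f_def)
    qed
    have "f n - \<mu> *\<^sub>R v n = (s n * (\<mu> + 1)) *\<^sub>R (u (n + M) - v0 (n + M))" for n
      by (simp add: f_def v_def algebra_simps)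
    then show "(\<lambda>n. norm (f n - \<mu> *\<^sub>R v n)) \<longlonglongrightarrow> 0"
      using tendsto_mult[OF tendsto_rabs[OF tendsto_mult_right[OF s, of "\<mu> + 1"]] LIMSEQ_ignore_initial_segment[OF d0, of M]]
      by simp
  qed
qed

section \<open>The Hilbert space of square-integrable fields\<close>
type_synonym vfield = "real^3 \<Rightarrow> complex^3"

definition sq_int :: "vfield \<Rightarrow> bool" where
  "sq_int f \<longleftrightarrow> f \<in> borel_measurable lebesgue \<and> integrable lebesgue (\<lambda>x. (norm (f x))\<^sup>2)"

lemma sq_int_inner_integrable:
  assumes "sq_int f" "sq_int g"
  shows "integrable lebesgue (\<lambda>x. inner (f x) (g x))"
proof (rule Bochner_Integration.integrable_bound)
  show "integrable lebesgue (\<lambda>x. (norm (f x))\<^sup>2 + (norm (g x))\<^sup>2)"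
    using assms by (auto simp: sq_int_def)
  show "(\<lambda>x. inner (f x) (g x)) \<in> borel_measurable lebesgue"
    using assms by (auto simp: sq_int_def)
  show "AE x in lebesgue. norm (inner (f x) (g x)) \<le> norm ((norm (f x))\<^sup>2 + (norm (g x))\<^sup>2)"
  proof (rule AE_I2)
    fix x
    have "norm (inner (f x) (g x)) \<le> norm (f x) * norm (g x)" using Cauchy_Schwarz_ineq2 by simp
    also have "\<dots> \<le> (norm (f x))\<^sup>2 + (norm (g x))\<^sup>2"
      using sum_squares_bound[of "norm (f x)" "norm (g x)"] mult_nonneg_nonneg[OF norm_ge_zero[of "f x"] norm_ge_zero[of "g x"]]
      by linarith
    finally show "norm (inner (f x) (g x)) \<le> norm ((norm (f x))\<^sup>2 + (norm (g x))\<^sup>2)" by simp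
  qed
qed

lemma sq_int_add: assumes "sq_int f" "sq_int g" shows "sq_int (\<lambda>x. f x + g x)"
  unfolding sq_int_def
proof
  show "(\<lambda>x. f x + g x) \<in> borel_measurable lebesgue" using assms by (auto simp: sq_int_def)
  have "(norm (f x + g x))\<^sup>2 = (norm (f x))\<^sup>2 + 2 * inner (f x) (g x) + (norm (g x))\<^sup>2" for x
    by (simp add: power2_norm_eq_inner inner_simps inner_commute)
  then show "integrable lebesgue (\<lambda>x. (norm (f x + g x))\<^sup>2)"
    using assms sq_int_inner_integrable[OF assms] by (simp add: sq_int_def)
qed

lemma sq_int_scaleR: "sq_int f \<Longrightarrow> sq_int (\<lambda>x. c *\<^sub>R f x)"
  by (auto simp: sq_int_def power_mult_distrib)

lemma sq_int_diff: assumes "sq_int f" "sq_int g" shows "sq_int (\<lambda>x. f x - g x)"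
  using sq_int_add[OF assms(1) sq_int_scaleR[OF assms(2), of "-1"]] by simp

lemma sq_int_0: "sq_int (\<lambda>x. 0)" by (simp add: sq_int_def)

definition l2_rel :: "vfield \<Rightarrow> vfield \<Rightarrow> bool" where
  "l2_rel f g \<longleftrightarrow> sq_int f \<and> sq_int g \<and> (AE x in lebesgue. f x = g x)"

text \<open>One type serves all domains: fields on \<open>\<Omega>\<close> are extended by zero. The inner product is the real part of the
Hermitian one, which makes \<open>l2\<close> an instance of the class of real inner product spaces.\<close>
quotient_type l2 = "vfield" / partial: l2_rel
proof (rule part_equivpI)
  show "\<exists>x. l2_rel x x" using sq_int_0 by (auto simp: l2_rel_def)
  show "symp l2_rel" unfolding symp_def l2_rel_def by (auto simp: eq_commute)
  show "transp l2_rel"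
  proof (rule transpI)
    fix f g h assume "l2_rel f g" "l2_rel g h"
    then show "l2_rel f h" unfolding l2_rel_def by (auto elim: eventually_elim2)
  qed
qed

instantiation l2 :: real_vector
begin

lift_definition zero_l2 :: l2 is "\<lambda>x. 0" by (simp add: l2_rel_def sq_int_0)
lift_definition plus_l2 :: "l2 \<Rightarrow> l2 \<Rightarrow> l2" is "\<lambda>f g x. f x + g x"
  by (auto simp: l2_rel_def sq_int_add elim: eventually_elim2)
lift_definition minus_l2 :: "l2 \<Rightarrow> l2 \<Rightarrow> l2" is "\<lambda>f g x. f x - g x"
  by (auto simp: l2_rel_def sq_int_diff elim: eventually_elim2)
lift_definition uminus_l2 :: "l2 \<Rightarrow> l2" is "\<lambda>f x. - f x"
  using sq_int_scaleR[of _ "-1"] by (auto simp: l2_rel_def)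
lift_definition scaleR_l2 :: "real \<Rightarrow> l2 \<Rightarrow> l2" is "\<lambda>c f x. c *\<^sub>R f x"
  by (auto simp: l2_rel_def sq_int_scaleR elim: eventually_mono)

instance
proof
  fix x y z :: l2 and a b :: real
  show "x + y + z = x + (y + z)" by transfer (auto simp: l2_rel_def sq_int_add add.assoc)
  show "x + y = y + x" by transfer (auto simp: l2_rel_def sq_int_add add.commute)
  show "0 + x = x" by transfer (auto simp: l2_rel_def)
  show "- x + x = 0" by transfer (auto simp: l2_rel_def sq_int_0)
  show "x - y = x + - y"
    by transfer (auto simp: l2_rel_def sq_int_diff)
  show "a *\<^sub>R (x + y) = a *\<^sub>R x + a *\<^sub>R y"
    by transfer (auto simp: l2_rel_def scaleR_add_right sq_int_add sq_int_scaleR)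
  show "(a + b) *\<^sub>R x = a *\<^sub>R x + b *\<^sub>R x"
    by transfer (auto simp: l2_rel_def scaleR_add_left sq_int_add sq_int_scaleR)
  show "a *\<^sub>R b *\<^sub>R x = (a * b) *\<^sub>R x"
    by transfer (auto simp: l2_rel_def sq_int_scaleR)
  show "1 *\<^sub>R x = x" by transfer (auto simp: l2_rel_def)
qed

end

instantiation l2 :: real_inner
begin

lift_definition inner_l2 :: "l2 \<Rightarrow> l2 \<Rightarrow> real" is "\<lambda>f g. LINT x|lebesgue. inner (f x) (g x)"
proof -
  fix f f' g g' assume a: "l2_rel f f'" "l2_rel g g'"
  show "(LINT x|lebesgue. inner (f x) (g x)) = (LINT x|lebesgue. inner (f' x) (g' x))"
  proof (rule integral_cong_AE)
    show "AE x in lebesgue. inner (f x) (g x) = inner (f' x) (g' x)"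
      using a by (auto simp: l2_rel_def elim: eventually_elim2)
  qed (use a in \<open>auto simp: l2_rel_def sq_int_def\<close>)
qed

definition norm_l2 :: "l2 \<Rightarrow> real" where "norm_l2 x = sqrt (inner x x)"
definition dist_l2 :: "l2 \<Rightarrow> l2 \<Rightarrow> real" where "dist_l2 x y = norm (x - y)"
definition sgn_l2 :: "l2 \<Rightarrow> l2" where "sgn_l2 x = x /\<^sub>R norm x"
definition uniformity_l2 :: "(l2 \<times> l2) filter"
  where "uniformity_l2 = (INF e\<in>{0 <..}. principal {(x, y). dist x y < e})"
definition open_l2 :: "l2 set \<Rightarrow> bool"
  where "open_l2 U \<longleftrightarrow> (\<forall>x\<in>U. \<forall>\<^sub>F (x', y) in uniformity. x' = x \<longrightarrow> y \<in> U)"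

instance
proof
  fix x y z :: l2 and a :: real
  show "dist x y = norm (x - y)" by (rule dist_l2_def)
  show "sgn x = x /\<^sub>R norm x" by (rule sgn_l2_def)
  show "uniformity = (INF e\<in>{0 <..}. principal {(x::l2, y). dist x y < e})" by (rule uniformity_l2_def)
  show "open U \<longleftrightarrow> (\<forall>x\<in>U. \<forall>\<^sub>F (x', y) in uniformity. x' = x \<longrightarrow> y \<in> U)" for U :: "l2 set"
    by (rule open_l2_def)
  show "inner x y = inner y x" by transfer (simp add: inner_commute)
  show "inner (x + y) z = inner x z + inner y z"
    by transfer (simp add: l2_rel_def inner_add_left sq_int_inner_integrable)
  show "inner (a *\<^sub>R x) y = a * inner x y" by transfer simp
  show "0 \<le> inner x x" by transfer simp
  show "inner x x = 0 \<longleftrightarrow> x = 0"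
  proof transfer
    fix f assume f: "l2_rel f f"
    then have i: "integrable lebesgue (\<lambda>x. inner (f x) (f x))"
      by (auto simp: l2_rel_def sq_int_inner_integrable)
    show "(LINT x|lebesgue. inner (f x) (f x)) = 0 \<longleftrightarrow> l2_rel f (\<lambda>x. 0)"
      using integral_nonneg_eq_0_iff_AE[OF i] f by (simp add: l2_rel_def sq_int_0)
  qed
  show "norm x = sqrt (inner x x)" by (rule norm_l2_def)
qed

end

lemma rep_l2_sq_int: "sq_int (rep_l2 x)"
  using Quotient_rep_reflp[OF Quotient_l2, of x] by (simp add: l2_rel_def)

lemma abs_rep_l2: "abs_l2 (rep_l2 x) = x"
  using Quotient_abs_rep[OF Quotient_l2] by simp

lemma abs_l2_eq_iff: "sq_int f \<Longrightarrow> sq_int g \<Longrightarrow> abs_l2 f = abs_l2 g \<longleftrightarrow> (AE x in lebesgue. f x = g x)"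
  using Quotient_rel[OF Quotient_l2, of f g] by (auto simp: l2_rel_def)

lemma inner_abs_l2: "sq_int f \<Longrightarrow> sq_int g \<Longrightarrow> inner (abs_l2 f) (abs_l2 g) = (LINT x|lebesgue. inner (f x) (g x))"
  by (rule inner_l2.abs_eq) (auto simp: l2_rel_def)
lemma diff_abs_l2: "sq_int f \<Longrightarrow> sq_int g \<Longrightarrow> abs_l2 f - abs_l2 g = abs_l2 (\<lambda>x. f x - g x)"
  by (rule minus_l2.abs_eq) (auto simp: l2_rel_def)
lemma add_abs_l2: "sq_int f \<Longrightarrow> sq_int g \<Longrightarrow> abs_l2 f + abs_l2 g = abs_l2 (\<lambda>x. f x + g x)"
  by (rule plus_l2.abs_eq) (auto simp: l2_rel_def)
lemma scaleR_abs_l2: "sq_int f \<Longrightarrow> c *\<^sub>R abs_l2 f = abs_l2 (\<lambda>x. c *\<^sub>R f x)"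
  by (rule scaleR_l2.abs_eq) (auto simp: l2_rel_def)
lemma norm_abs_l2: "sq_int f \<Longrightarrow> (norm (abs_l2 f))\<^sup>2 = (LINT x|lebesgue. (norm (f x))\<^sup>2)"
  by (simp add: power2_norm_eq_inner inner_abs_l2)

lemma nn_integral_norm_l2: "(\<integral>\<^sup>+x. ennreal ((norm (rep_l2 a x - rep_l2 b x))\<^sup>2) \<partial>lebesgue) = ennreal ((norm (a - b))\<^sup>2)"
proof -
  have s: "sq_int (\<lambda>x. rep_l2 a x - rep_l2 b x)" by (intro sq_int_diff rep_l2_sq_int)
  have "a - b = abs_l2 (\<lambda>x. rep_l2 a x - rep_l2 b x)"
    using diff_abs_l2[OF rep_l2_sq_int rep_l2_sq_int, of a b] by (simp add: abs_rep_l2)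
  then show ?thesis using s norm_abs_l2[OF s]
    by (simp add: nn_integral_eq_integral sq_int_def)
qed

text \<open>Riesz-Fischer. For a subsequence \<open>F\<close> with increments below \<open>2\<^sup>-\<^sup>k\<close> in norm, the sum of \<open>2\<^sup>k |F (k + 1) - F k|\<^sup>2\<close> has a
finite integral, hence is finite almost everywhere, and \<open>F\<close> converges pointwise there. Fatou's lemma turns
pointwise convergence into convergence in norm.\<close>
instance l2 :: complete_space
proof
  fix X :: "nat \<Rightarrow> l2" assume X: "Cauchy X"
  have "\<exists>N. \<forall>m\<ge>N. \<forall>n\<ge>N. norm (X m - X n) < (1/2)^k" for k :: nat
    using X unfolding Cauchy_def dist_norm by (meson zero_less_power half_gt_zero zero_less_one)
  then obtain N where N: "\<And>k m n. m \<ge> N k \<Longrightarrow> n \<ge> N k \<Longrightarrow> norm (X m - X n) < (1/2::real)^k"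
    by metis
  define M where "M k = Max (N ` {..k}) " for k
  have MN: "N k \<le> M j" if "k \<le> j" for k j using that by (auto simp: M_def)
  define F where "F k = rep_l2 (X (M k))" for k
  have F: "sq_int (F k)" for k by (simp add: F_def rep_l2_sq_int)
  have Fm[measurable]: "F k \<in> borel_measurable lebesgue" for k using F by (simp add: sq_int_def)
  have cl: "(\<integral>\<^sup>+x. ennreal ((norm (F j x - F k x))\<^sup>2) \<partial>lebesgue) \<le> ennreal (((1/2)^k)\<^sup>2)" if "k \<le> j" for j k
    unfolding F_def nn_integral_norm_l2
    using N[of k "M j" "M k"] MN[of k j] MN[of k k] that by (intro ennreal_leI power_mono) auto
  define S where "S x = (\<Sum>k. ennreal (2^k * (norm (F (Suc k) x - F k x))\<^sup>2))" for x
  have "(\<integral>\<^sup>+x. S x \<partial>lebesgue) = (\<Sum>k. \<integral>\<^sup>+x. ennreal (2^k * (norm (F (Suc k) x - F k x))\<^sup>2) \<partial>lebesgue)"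
    unfolding S_def by (intro nn_integral_suminf) auto
  also have "\<dots> \<le> (\<Sum>k. ennreal ((1/2)^k))"
  proof (intro suminf_le)
    fix k
    have "(\<integral>\<^sup>+x. ennreal (2^k * (norm (F (Suc k) x - F k x))\<^sup>2) \<partial>lebesgue)
      = ennreal (2^k) * (\<integral>\<^sup>+x. ennreal ((norm (F (Suc k) x - F k x))\<^sup>2) \<partial>lebesgue)"
      by (subst nn_integral_cmult[symmetric]) (auto simp: ennreal_mult)
    also have "\<dots> \<le> ennreal (2^k) * ennreal (((1/2)^k)\<^sup>2)" by (intro mult_left_mono cl) auto
    also have "\<dots> = ennreal ((1/2)^k)"
    proof -
      have "(2::real)^k * ((1/2)^k)\<^sup>2 = (2 * (1/2) * (1/2))^k"
        by (simp only: power2_eq_square power_mult_distrib mult.assoc)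
      then show ?thesis by (simp add: ennreal_mult[symmetric])
    qed
    finally show "(\<integral>\<^sup>+x. ennreal (2^k * (norm (F (Suc k) x - F k x))\<^sup>2) \<partial>lebesgue) \<le> ennreal ((1/2)^k)" .
  qed auto
  also have "\<dots> < \<infinity>"
    by (subst suminf_ennreal2) (auto intro: summable_geometric)
  finally have "(\<integral>\<^sup>+x. S x \<partial>lebesgue) \<noteq> \<infinity>" by simp
  moreover have [measurable]: "S \<in> borel_measurable lebesgue" unfolding S_def by measurable
  ultimately have AES: "AE x in lebesgue. S x \<noteq> \<infinity>" by (intro nn_integral_noteq_infinite) auto
  have conv: "convergent (\<lambda>k. F k x)" if "S x \<noteq> \<infinity>" for x
  proof -
    define d where "d k = F (Suc k) x - F k x" for k
    have "summable (\<lambda>k. 2^k * (norm (d k))\<^sup>2)"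
      using that unfolding S_def d_def by (intro summable_suminf_not_top) (auto simp: top_unique infinity_ennreal_def)
    then have s: "summable (\<lambda>k. 2^k * (norm (d k))\<^sup>2 + (1/2)^k)"
      by (intro summable_add summable_geometric) auto
    have "summable (\<lambda>k. norm (d k))"
    proof (rule summable_comparison_test'[OF s, of 0])
      fix k :: nat
      \<comment> \<open>From \<open>2 a \<le> a\<^sup>2 + 1\<close>: the increments are dominated by the finite weighted sum plus a geometric series.\<close>
      have "0 \<le> (2^k * norm (d k) - 1)\<^sup>2" by simp
      then have "2 * (2^k * norm (d k)) \<le> (2^k * norm (d k))\<^sup>2 + 1" by (simp add: power2_eq_square algebra_simps)
      moreover have "0 \<le> 2^k * norm (d k)" by simp
      ultimately have "2^k * norm (d k) \<le> (2^k * norm (d k))\<^sup>2 + 1" by linarith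
      then have "2^k * norm (d k) \<le> 2^k * (2^k * (norm (d k))\<^sup>2 + (1/2)^k)"
        by (simp add: power2_eq_square algebra_simps power_divide)
      then show "norm (norm (d k)) \<le> 2^k * (norm (d k))\<^sup>2 + (1/2)^k" by (simp add: mult_le_cancel_left)
    qed
    then have "summable d" by (rule summable_norm_cancel)
    then have "convergent (\<lambda>n. \<Sum>k<n. d k)" by (simp add: summable_iff_convergent)
    moreover have "(\<Sum>k<n. d k) = F n x - F 0 x" for n
      unfolding d_def by (rule sum_lessThan_telescope)
    ultimately have "convergent (\<lambda>n. (F n x - F 0 x) + F 0 x)"
      by (intro convergent_add convergent_const) simp
    then show ?thesis by simp
  qed
  define G where "G x = lim (\<lambda>k. F k x)" for x
  have Gm[measurable]: "G \<in> borel_measurable lebesgue"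
    unfolding G_def by (rule borel_measurable_lim_metric) simp
  have FG: "AE x in lebesgue. (\<lambda>k. F k x) \<longlonglongrightarrow> G x"
    using AES conv by (auto simp: G_def convergent_LIMSEQ_iff)
  have fatou: "(\<integral>\<^sup>+x. ennreal ((norm (G x - F k x))\<^sup>2) \<partial>lebesgue) \<le> ennreal (((1/2)^k)\<^sup>2)" for k
  proof -
    have "(\<integral>\<^sup>+x. ennreal ((norm (G x - F k x))\<^sup>2) \<partial>lebesgue)
      = (\<integral>\<^sup>+x. liminf (\<lambda>j. ennreal ((norm (F j x - F k x))\<^sup>2)) \<partial>lebesgue)"
    proof (intro nn_integral_cong_AE)
      show "AE x in lebesgue. ennreal ((norm (G x - F k x))\<^sup>2) = liminf (\<lambda>j. ennreal ((norm (F j x - F k x))\<^sup>2))"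
        using FG
      proof eventually_elim
        case (elim x)
        then have "(\<lambda>j. ennreal ((norm (F j x - F k x))\<^sup>2)) \<longlonglongrightarrow> ennreal ((norm (G x - F k x))\<^sup>2)"
          by (intro tendsto_intros tendsto_ennrealI)
        then show ?case by (intro lim_imp_Liminf[symmetric] sequentially_bot)
      qed
    qed
    also have "\<dots> \<le> liminf (\<lambda>j. \<integral>\<^sup>+x. ennreal ((norm (F j x - F k x))\<^sup>2) \<partial>lebesgue)"
      by (intro nn_integral_liminf) simp
    also have "\<dots> \<le> limsup (\<lambda>j. \<integral>\<^sup>+x. ennreal ((norm (F j x - F k x))\<^sup>2) \<partial>lebesgue)"
      by (intro Liminf_le_Limsup) simp
    also have "\<dots> \<le> ennreal (((1/2)^k)\<^sup>2)"
      using cl by (intro Limsup_bounded) (auto simp: eventually_sequentially intro!: exI[of _ k])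
    finally show ?thesis .
  qed
  have D: "sq_int (\<lambda>x. G x - F k x)" for k
    unfolding sq_int_def
  proof
    show "integrable lebesgue (\<lambda>x. (norm (G x - F k x))\<^sup>2)"
      using le_less_trans[OF fatou[of k] ennreal_less_top] by (intro integrableI_nonneg) auto
  qed simp
  have "sq_int G" using sq_int_add[OF D[of 0] F[of 0]] by simp
  have near: "norm (abs_l2 G - X (M k)) \<le> (1/2)^k" for k
  proof -
    have "abs_l2 G - X (M k) = abs_l2 (\<lambda>x. G x - F k x)"
      using diff_abs_l2[OF \<open>sq_int G\<close> F, of k] by (simp add: F_def abs_rep_l2)
    then have "ennreal ((norm (abs_l2 G - X (M k)))\<^sup>2) \<le> ennreal (((1/2)^k)\<^sup>2)"
      using fatou[of k] norm_abs_l2[OF D[of k]] D[of k]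
      by (simp add: nn_integral_eq_integral sq_int_def)
    then have "(norm (abs_l2 G - X (M k)))\<^sup>2 \<le> ((1/2)^k)\<^sup>2"
      by (subst (asm) ennreal_le_iff) auto
    then show ?thesis by (rule power2_le_imp_le) simp
  qed
  have "X \<longlonglongrightarrow> abs_l2 G"
  proof (rule LIMSEQ_I)
    fix e :: real assume "0 < e"
    then obtain k where k: "(1/2::real)^k < e/2" using real_arch_pow_inv[of "e/2" "1/2"] by auto
    have "norm (X n - abs_l2 G) < e" if "n \<ge> M k" for n
    proof -
      have "norm (X n - abs_l2 G) \<le> norm (X n - X (M k)) + norm (abs_l2 G - X (M k))"
        using norm_triangle_ineq[of "X n - X (M k)" "X (M k) - abs_l2 G"]
        by (simp add: norm_minus_commute)
      moreover have "norm (X n - X (M k)) < (1/2)^k"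
        using MN[of k k] that by (intro N) auto
      ultimately show ?thesis using near[of k] k by linarith
    qed
    then show "\<exists>n0. \<forall>n\<ge>n0. norm (X n - abs_l2 G) < e" by blast
  qed
  then show "convergent X" by (rule convergentI)
qed

section \<open>Partial derivatives\<close>
lemma partial_deriv_eq:
  assumes "(f has_derivative f') (at x)"
  shows "partial_deriv i f x = f' (axis i 1)"
  using frechet_derivative_at[OF assms] by (simp add: partial_deriv_def)

lemma partial_deriv_const [simp]: "partial_deriv i (\<lambda>x. c) x = 0"
  by (rule partial_deriv_eq) (rule has_derivative_const)

lemma partial_deriv_add:
  assumes "f differentiable (at x)" "g differentiable (at x)"
  shows "partial_deriv i (\<lambda>x. f x + g x) x = partial_deriv i f x + partial_deriv i g x"
  using assms unfolding frechet_derivative_works partial_deriv_def[of i f] partial_deriv_def[of i g]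
  by (intro partial_deriv_eq) (rule has_derivative_add)

lemma partial_deriv_linear:
  assumes "f differentiable (at x)" "bounded_linear L"
  shows "partial_deriv i (\<lambda>x. L (f x)) x = L (partial_deriv i f x)"
  using assms unfolding frechet_derivative_works partial_deriv_def[of i f]
  by (intro partial_deriv_eq) (rule bounded_linear.has_derivative)

lemma partial_deriv_bilinear:
  assumes "f differentiable (at x)" "g differentiable (at x)" "bounded_bilinear p"
  shows "partial_deriv i (\<lambda>x. p (f x) (g x)) x = p (f x) (partial_deriv i g x) + p (partial_deriv i f x) (g x)"
  using assms unfolding frechet_derivative_works partial_deriv_def[of i f] partial_deriv_def[of i g]
  by (intro partial_deriv_eq) (rule bounded_bilinear.FDERIV)

lemma partial_deriv_affine:
  assumes "f differentiable (at (s *\<^sub>R x + c))"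
  shows "partial_deriv i (\<lambda>x. f (s *\<^sub>R x + c)) x = s *\<^sub>R partial_deriv i f (s *\<^sub>R x + c)"
proof -
  let ?f' = "frechet_derivative f (at (s *\<^sub>R x + c))"
  have f': "(f has_derivative ?f') (at (s *\<^sub>R x + c))"
    using assms frechet_derivative_works by blast
  have "((\<lambda>x. f (s *\<^sub>R x + c)) has_derivative (\<lambda>h. ?f' (s *\<^sub>R h))) (at x)"
    by (rule has_derivative_compose[where f="\<lambda>x. s *\<^sub>R x + c" and g=f, OF _ f'])
      (auto intro!: derivative_eq_intros)
  from partial_deriv_eq[OF this] show ?thesis
    using linear_cmul[OF has_derivative_linear[OF f']] by (simp add: partial_deriv_def)
qed

section \<open>Smooth functions\<close>

text \<open>Smoothness by coinduction: iterated partial derivatives never leave a class that is closed under partial derivatives.\<close>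
lemma smoothI_closed_under_partial_deriv:
  assumes "\<And>f x. f \<in> S \<Longrightarrow> f differentiable (at x)" "\<And>f i. f \<in> S \<Longrightarrow> partial_deriv i f \<in> S" "f \<in> S"
  shows "smooth f"
proof -
  have "foldr partial_deriv is f \<in> S" for "is" by (induction "is") (auto simp: assms)
  then show ?thesis unfolding smooth_def differentiable_on_def using assms(1) by blast
qed

lemma smooth_differentiable: "smooth f \<Longrightarrow> f differentiable (at x)"
  unfolding smooth_def differentiable_on_def by (metis UNIV_I foldr_Nil id_apply)

lemma smooth_partial_deriv: "smooth f \<Longrightarrow> smooth (partial_deriv i f)"
  unfolding smooth_def
proof
  fix "is" assume a: "\<forall>is. foldr partial_deriv is f differentiable_on UNIV"
  show "foldr partial_deriv is (partial_deriv i f) differentiable_on UNIV"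
    using a[rule_format, of "is @ [i]"] by simp
qed

lemma smooth_continuous_on: "smooth f \<Longrightarrow> continuous_on S f"
  using smooth_differentiable differentiable_imp_continuous_within
  by (metis continuous_at_imp_continuous_on)

lemma smooth_add: assumes "smooth f" "smooth g" shows "smooth (\<lambda>x. f x + g x)"
proof (rule smoothI_closed_under_partial_deriv[where S="{h. \<exists>f g. smooth f \<and> smooth g \<and> h = (\<lambda>x. f x + g x)}"])
  fix h i x assume "h \<in> {h. \<exists>f g. smooth f \<and> smooth g \<and> h = (\<lambda>x. f x + g x)}"
  then obtain f g where fg: "smooth f" "smooth g" and h: "h = (\<lambda>x. f x + g x)" by blast
  show "h differentiable (at x)" unfolding h
    by (intro differentiable_add smooth_differentiable fg)
  have "partial_deriv i h = (\<lambda>x. partial_deriv i f x + partial_deriv i g x)"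
    unfolding h by (intro ext partial_deriv_add smooth_differentiable fg)
  then show "partial_deriv i h \<in> {h. \<exists>f g. smooth f \<and> smooth g \<and> h = (\<lambda>x. f x + g x)}"
    using fg smooth_partial_deriv by blast
qed (use assms in blast)

lemma smooth_linear: assumes L: "bounded_linear L" and "smooth f" shows "smooth (\<lambda>x. L (f x))"
proof (rule smoothI_closed_under_partial_deriv[where S="{h. \<exists>f. smooth f \<and> h = (\<lambda>x. L (f x))}"])
  fix h i x assume "h \<in> {h. \<exists>f. smooth f \<and> h = (\<lambda>x. L (f x))}"
  then obtain f where f: "smooth f" and h: "h = (\<lambda>x. L (f x))" by blast
  show "h differentiable (at x)" unfolding h
    using bounded_linear.has_derivative[OF L] smooth_differentiable[OF f, of x]
    unfolding differentiable_def by blast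
  have "partial_deriv i h = (\<lambda>x. L (partial_deriv i f x))"
    unfolding h by (intro ext partial_deriv_linear L smooth_differentiable f)
  then show "partial_deriv i h \<in> {h. \<exists>f. smooth f \<and> h = (\<lambda>x. L (f x))}"
    using f smooth_partial_deriv by blast
qed (use assms in blast)

lemma smooth_affine: assumes "smooth f" shows "smooth (\<lambda>x. f (s *\<^sub>R x + c))"
proof (rule smoothI_closed_under_partial_deriv[where S="{h. \<exists>f. smooth f \<and> h = (\<lambda>x. f (s *\<^sub>R x + c))}"])
  fix h i x assume "h \<in> {h. \<exists>f. smooth f \<and> h = (\<lambda>x. f (s *\<^sub>R x + c))}"
  then obtain f where f: "smooth f" and h: "h = (\<lambda>x. f (s *\<^sub>R x + c))" by blast
  show "h differentiable (at x)" unfolding h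
    by (rule differentiable_compose[OF smooth_differentiable[OF f]]) simp
  have "partial_deriv i h = (\<lambda>x. s *\<^sub>R partial_deriv i f (s *\<^sub>R x + c))"
    unfolding h by (intro ext partial_deriv_affine smooth_differentiable f)
  then show "partial_deriv i h \<in> {h. \<exists>f. smooth f \<and> h = (\<lambda>x. f (s *\<^sub>R x + c))}"
    using smooth_linear[OF bounded_linear_scaleR_right smooth_partial_deriv[OF f]]
    by (auto intro!: exI[of _ "\<lambda>x. s *\<^sub>R partial_deriv i f x"])
qed (use assms in blast)

section \<open>Bump functions\<close>

text \<open>For \<open>k = 0\<close> this is the standard flat function. The higher \<open>k\<close> are needed to express its
derivatives: they make the family closed under differentiation up to linear combinations.\<close>
definition flat_exp :: "nat \<Rightarrow> real \<Rightarrow> real" where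
  "flat_exp k t = (if t \<le> 0 then 0 else exp (- inverse t) * inverse t ^ k)"

lemma flat_exp_tendsto_0: "(flat_exp k \<longlongrightarrow> 0) (at 0)"
proof -
  have "((\<lambda>x::real. x ^ k / exp x) \<longlongrightarrow> 0) at_top" by (rule tendsto_power_div_exp_0)
  then have "((\<lambda>t. inverse t ^ k / exp (inverse t)) \<longlongrightarrow> 0) (at_right (0::real))"
    by (rule filterlim_compose[OF _ filterlim_inverse_at_top_right])
  moreover have "eventually (\<lambda>t. inverse t ^ k / exp (inverse t) = flat_exp k t) (at_right 0)"
    by (auto simp: eventually_at_filter flat_exp_def exp_minus field_simps)
  ultimately have R: "(flat_exp k \<longlongrightarrow> 0) (at_right 0)" by (rule Lim_transform_eventually)
  have "eventually (\<lambda>t. 0 = flat_exp k t) (at_left 0)"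
    by (auto simp: eventually_at_filter flat_exp_def)
  then have L: "(flat_exp k \<longlongrightarrow> 0) (at_left 0)" by (rule Lim_transform_eventually[OF tendsto_const])
  from L R show ?thesis by (simp add: filterlim_at_split)
qed

lemma flat_exp_deriv:
  "(flat_exp k has_real_derivative (flat_exp (k+2) t - real k * flat_exp (k+1) t)) (at t)"
proof (cases t "0::real" rule: linorder_cases)
  case less
  have "((\<lambda>t. 0) has_real_derivative 0) (at t)" by simp
  then have "(flat_exp k has_real_derivative 0) (at t)"
    by (rule has_field_derivative_transform_within_open[where S="{..<0}"])
      (use less in \<open>auto simp: flat_exp_def\<close>)
  then show ?thesis using less by (simp add: flat_exp_def)
next
  case equal
  have "((\<lambda>h. flat_exp k h / h) \<longlongrightarrow> 0) (at 0)"
    by (rule Lim_transform_eventually[OF flat_exp_tendsto_0[of "k+1"]])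
      (auto simp: eventually_at_filter flat_exp_def field_simps)
  then show ?thesis using equal by (simp add: DERIV_def) (simp add: flat_exp_def)
next
  case greater
  have "((\<lambda>t. exp (- inverse t) * inverse t ^ k) has_real_derivative
      (flat_exp (k+2) t - real k * flat_exp (k+1) t)) (at t)"
    by (rule derivative_eq_intros refl | use greater in \<open>simp; fail\<close>)+
      (use greater in \<open>cases k; simp add: flat_exp_def power2_eq_square algebra_simps\<close>)
  then show ?thesis
    by (rule has_field_derivative_transform_within_open[where S="{0<..}"])
      (use greater in \<open>auto simp: flat_exp_def\<close>)
qed

text \<open>The algebra generated by the constants and the flat functions of an affine function of one coordinate. It is closed
under partial derivatives, so its members are smooth, and mixed derivatives are seen to commute by induction
on the generation.\<close>
inductive_set bump_algebra :: "(real^3 \<Rightarrow> real) set" where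
  bump_const: "(\<lambda>x. c) \<in> bump_algebra"
| bump_gen: "(\<lambda>x. flat_exp k (c * x $ i + d)) \<in> bump_algebra"
| bump_add: "f \<in> bump_algebra \<Longrightarrow> g \<in> bump_algebra \<Longrightarrow> (\<lambda>x. f x + g x) \<in> bump_algebra"
| bump_mult: "f \<in> bump_algebra \<Longrightarrow> g \<in> bump_algebra \<Longrightarrow> (\<lambda>x. f x * g x) \<in> bump_algebra"

lemma flat_exp_has_derivative:
  "((\<lambda>x::real^3. flat_exp k (c * x $ i + d)) has_derivative
     (\<lambda>h. (c * h $ i) * (flat_exp (k+2) (c * x $ i + d) - real k * flat_exp (k+1) (c * x $ i + d)))) (at x)"
proof -
  have "((\<lambda>x::real^3. c * x $ i + d) has_derivative (\<lambda>h. c * h $ i)) (at x)"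
    by (auto intro!: derivative_eq_intros bounded_linear_imp_has_derivative bounded_linear_vec_nth)
  from DERIV_compose_FDERIV[OF flat_exp_deriv this] show ?thesis .
qed

lemma partial_deriv_flat_exp:
  "partial_deriv j (\<lambda>x. flat_exp k (c * x $ i + d)) =
    (\<lambda>x. (if i = j then c else 0) * (flat_exp (k+2) (c * x $ i + d) + (- real k) * flat_exp (k+1) (c * x $ i + d)))"
  by (rule ext, subst partial_deriv_eq[OF flat_exp_has_derivative]) (simp add: axis_def)

lemma bump_algebra_differentiable: "f \<in> bump_algebra \<Longrightarrow> f differentiable (at x)"
proof (induction rule: bump_algebra.induct)
  case (bump_gen k c i d)
  then show ?case using flat_exp_has_derivative differentiable_def by blast
qed auto

lemma partial_deriv_bump_mult:
  assumes "f \<in> bump_algebra" "g \<in> bump_algebra"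
  shows "partial_deriv i (\<lambda>x. f x * g x) = (\<lambda>x. f x * partial_deriv i g x + partial_deriv i f x * g x)"
  by (intro ext partial_deriv_bilinear bump_algebra_differentiable assms bounded_bilinear_mult)

lemma partial_deriv_bump_add:
  assumes "f \<in> bump_algebra" "g \<in> bump_algebra"
  shows "partial_deriv i (\<lambda>x. f x + g x) = (\<lambda>x. partial_deriv i f x + partial_deriv i g x)"
  by (intro ext partial_deriv_add bump_algebra_differentiable assms)

lemma partial_deriv_bump_algebra: "f \<in> bump_algebra \<Longrightarrow> partial_deriv i f \<in> bump_algebra"
proof (induction rule: bump_algebra.induct)
  case (bump_const c)
  show ?case using bump_algebra.bump_const[of 0] by (simp add: fun_eq_iff[symmetric] partial_deriv_const[abs_def])
next
  case (bump_gen k c j d)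
  show ?case unfolding partial_deriv_flat_exp
    by (intro bump_algebra.intros)
next
  case (bump_add f g)
  then show ?case unfolding partial_deriv_bump_add[OF bump_add.hyps] by (intro bump_algebra.intros)
next
  case (bump_mult f g)
  then show ?case unfolding partial_deriv_bump_mult[OF bump_mult.hyps] by (intro bump_algebra.intros)
qed

lemma bump_algebra_smooth: "f \<in> bump_algebra \<Longrightarrow> smooth f"
  by (rule smoothI_closed_under_partial_deriv[where S=bump_algebra])
    (auto intro: bump_algebra_differentiable partial_deriv_bump_algebra)

lemma bump_algebra_partial_deriv_commute:
  "f \<in> bump_algebra \<Longrightarrow> partial_deriv i (partial_deriv j f) = partial_deriv j (partial_deriv i f)"
proof (induction rule: bump_algebra.induct)
  case (bump_const c)
  show ?case by (simp add: partial_deriv_const[abs_def])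
next
  case (bump_gen k c m d)
  let ?D = "\<lambda>x::real^3. flat_exp (k+2) (c * x $ m + d) + (- real k) * flat_exp (k+1) (c * x $ m + d)"
  have D: "?D \<in> bump_algebra" by (intro bump_algebra.intros)
  have z: "partial_deriv l ?D = (\<lambda>x. 0)" if "l \<noteq> m" for l
    using that by (subst partial_deriv_bump_add, (intro bump_algebra.intros)+,
      subst partial_deriv_bump_mult, (intro bump_algebra.intros)+)
      (simp add: partial_deriv_flat_exp fun_eq_iff)
  have e: "partial_deriv l (\<lambda>x. a * ?D x) = (\<lambda>x. a * partial_deriv l ?D x)" for l a
    using partial_deriv_bump_mult[OF bump_algebra.bump_const D, of l a] by simp
  show ?case unfolding partial_deriv_flat_exp e using z by (auto simp: fun_eq_iff)
next
  case (bump_add f g)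
  then show ?case
    by (simp add: partial_deriv_bump_add partial_deriv_bump_algebra)
next
  case (bump_mult f g)
  then show ?case
    by (simp add: partial_deriv_bump_mult partial_deriv_bump_add partial_deriv_bump_algebra bump_algebra.intros
        algebra_simps)
qed

text \<open>Positive exactly on \<open>box a b\<close> when \<open>k > 0\<close>. The factors are written in the form of the generators of \<open>bump_algebra\<close>.\<close>
definition bump :: "real \<Rightarrow> real^3 \<Rightarrow> real^3 \<Rightarrow> real^3 \<Rightarrow> real" where
  "bump k a b x = (\<Prod>i\<in>UNIV. flat_exp 0 (k * x $ i + - k * a $ i) * flat_exp 0 ((- k) * x $ i + k * b $ i))"

lemma bump_prod: "finite I \<Longrightarrow> (\<And>i. F i \<in> bump_algebra) \<Longrightarrow> (\<lambda>x. \<Prod>i\<in>I. F i x) \<in> bump_algebra"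
  by (induction I rule: finite_induct) (auto intro: bump_algebra.intros)

lemma bump_in_bump_algebra: "bump k a b \<in> bump_algebra"
  unfolding bump_def[abs_def]
  by (rule bump_prod, simp, intro bump_mult bump_gen)

lemma smooth_bump: "smooth (bump k a b)"
  by (rule bump_algebra_smooth[OF bump_in_bump_algebra])

lemma flat_exp_bounds: "0 \<le> flat_exp 0 t" "flat_exp 0 t \<le> 1"
  by (auto simp: flat_exp_def)

lemma flat_exp_pos_iff: "flat_exp 0 t > 0 \<longleftrightarrow> t > 0" "flat_exp 0 t = 0 \<longleftrightarrow> t \<le> 0"
  by (auto simp: flat_exp_def)

lemma bump_bounds: "0 \<le> bump k a b x" "bump k a b x \<le> 1"
  unfolding bump_def
  by (auto intro!: prod_nonneg prod_le_1 mult_nonneg_nonneg mult_le_one simp: flat_exp_bounds)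

lemma bump_nonzero_iff:
  assumes "k > 0" shows "bump k a b x \<noteq> 0 \<longleftrightarrow> x \<in> box a b"
proof -
  have "k * x $ i + - k * a $ i \<le> 0 \<longleftrightarrow> x $ i \<le> a $ i" "(- k) * x $ i + k * b $ i \<le> 0 \<longleftrightarrow> b $ i \<le> x $ i" for i
    using assms by auto
  then show ?thesis unfolding bump_def mem_box_cart by (simp add: flat_exp_pos_iff not_le)
qed

text \<open>Each factor is \<open>exp (- 1 / (n s))\<close> with \<open>s > 0\<close> inside the box, and this tends to one.\<close>
lemma bump_tendsto_indicator:
  "(\<lambda>n. bump (real (Suc n)) a b x) \<longlonglongrightarrow> indicator (box a b) x"
proof (cases "x \<in> box a b")
  case True
  have t: "(\<lambda>n. flat_exp 0 (real (Suc n) * s)) \<longlonglongrightarrow> 1" if "s > 0" for s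
  proof -
    have "(\<lambda>n. exp (- (inverse (real (Suc n)) * inverse s))) \<longlonglongrightarrow> exp (- (0 * inverse s))"
      by (intro tendsto_intros LIMSEQ_inverse_real_of_nat)
    moreover have "flat_exp 0 (real (Suc n) * s) = exp (- (inverse (real (Suc n)) * inverse s))" for n
      using that by (simp add: flat_exp_def mult_le_0_iff)
    ultimately show ?thesis by simp
  qed
  have "(\<lambda>n. \<Prod>i\<in>UNIV. flat_exp 0 (real (Suc n) * (x $ i - a $ i)) * flat_exp 0 (real (Suc n) * (b $ i - x $ i)))
    \<longlonglongrightarrow> (\<Prod>i\<in>(UNIV::3 set). 1 * 1)"
    using True by (intro tendsto_prod tendsto_mult t) (auto simp: mem_box_cart)
  then show ?thesis using True by (simp add: bump_def algebra_simps)
next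
  case False
  then show ?thesis using bump_nonzero_iff[of "real (Suc _)" a b x] by simp
qed

section \<open>Operations on test functions\<close>

lemma zero_off_support: "x \<notin> closure {x. \<psi> x \<noteq> 0} \<Longrightarrow> \<psi> x = 0"
  using closure_subset[of "{x. \<psi> x \<noteq> 0}"] by blast

lemma test_functions_subset_support:
  assumes "\<psi> \<in> test_functions \<Omega>" "smooth \<phi>" "{x. \<phi> x \<noteq> 0} \<subseteq> closure {x. \<psi> x \<noteq> 0}"
  shows "\<phi> \<in> test_functions \<Omega>"
proof -
  have c: "closure {x. \<phi> x \<noteq> 0} \<subseteq> closure {x. \<psi> x \<noteq> 0}"
    using assms(3) by (rule closure_minimal) simp
  moreover have "compact (closure {x. \<psi> x \<noteq> 0})" using assms(1) by (simp add: test_functions_def)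
  ultimately have "compact (closure {x. \<phi> x \<noteq> 0})"
    by (meson bounded_subset closed_closure compact_eq_bounded_closed)
  with c show ?thesis using assms c by (auto simp: test_functions_def)
qed

lemma test_functions_smooth: "\<psi> \<in> test_functions \<Omega> \<Longrightarrow> smooth \<psi>"
  by (simp add: test_functions_def)

lemma test_functions_differentiable: "\<psi> \<in> test_functions \<Omega> \<Longrightarrow> \<psi> differentiable (at x)"
  by (intro smooth_differentiable test_functions_smooth)

lemma test_functions_linear:
  assumes L: "bounded_linear L" and "\<psi> \<in> test_functions \<Omega>"
  shows "(\<lambda>x. L (\<psi> x)) \<in> test_functions \<Omega>"
proof (rule test_functions_subset_support[OF assms(2)])
  show "smooth (\<lambda>x. L (\<psi> x))" by (rule smooth_linear[OF L test_functions_smooth[OF assms(2)]])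
  show "{x. L (\<psi> x) \<noteq> 0} \<subseteq> closure {x. \<psi> x \<noteq> 0}"
    using linear_0[OF bounded_linear.linear[OF L]] closure_subset[of "{x. \<psi> x \<noteq> 0}"] by auto
qed

lemma test_functions_scaleR: "\<psi> \<in> test_functions \<Omega> \<Longrightarrow> (\<lambda>x. c *\<^sub>R \<psi> x) \<in> test_functions \<Omega>"
  by (rule test_functions_linear[OF bounded_linear_scaleR_right])

lemma test_functions_add:
  assumes "\<psi> \<in> test_functions \<Omega>" "\<phi> \<in> test_functions \<Omega>"
  shows "(\<lambda>x. \<psi> x + \<phi> x) \<in> test_functions \<Omega>"
proof -
  let ?C = "\<lambda>f. closure {x. f x \<noteq> 0}"
  have "?C (\<lambda>x. \<psi> x + \<phi> x) \<subseteq> closure ({x. \<psi> x \<noteq> 0} \<union> {x. \<phi> x \<noteq> 0})"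
    by (rule closure_mono) auto
  also have "\<dots> = ?C \<psi> \<union> ?C \<phi>" by simp
  finally have s: "?C (\<lambda>x. \<psi> x + \<phi> x) \<subseteq> ?C \<psi> \<union> ?C \<phi>" .
  have "compact (?C \<psi> \<union> ?C \<phi>)" using assms by (auto simp: test_functions_def)
  with s have "compact (?C (\<lambda>x. \<psi> x + \<phi> x))"
    by (meson bounded_subset closed_closure compact_eq_bounded_closed)
  then show ?thesis using assms s smooth_add by (auto simp: test_functions_def)
qed

lemma test_functions_0: "(\<lambda>x. 0) \<in> test_functions \<Omega>"
  using bump_algebra_smooth[OF bump_const] smooth_linear[OF bounded_linear_zero]
  by (auto simp: test_functions_def)

lemma partial_deriv_support:
  assumes "x \<notin> closure {x. \<psi> x \<noteq> 0}"
  shows "partial_deriv i \<psi> x = 0"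
proof -
  have "((\<lambda>x. 0) has_derivative (\<lambda>h. 0)) (at x)" by simp
  then have "(\<psi> has_derivative (\<lambda>h. 0)) (at x)"
  proof (rule has_derivative_transform_within_open[where s="- closure {x. \<psi> x \<noteq> 0}"])
    show "0 = \<psi> y" if "y \<in> - closure {x. \<psi> x \<noteq> 0}" for y
      using that closure_subset[of "{x. \<psi> x \<noteq> 0}"] by auto
  qed (use assms in auto)
  from partial_deriv_eq[OF this] show ?thesis .
qed

lemma test_functions_partial_deriv:
  assumes "\<psi> \<in> test_functions \<Omega>" shows "partial_deriv i \<psi> \<in> test_functions \<Omega>"
proof (rule test_functions_subset_support[OF assms smooth_partial_deriv])
  show "smooth \<psi>" by (rule test_functions_smooth[OF assms])
  show "{x. partial_deriv i \<psi> x \<noteq> 0} \<subseteq> closure {x. \<psi> x \<noteq> 0}"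
    using partial_deriv_support by blast
qed

text \<open>The cross product with the \<open>i\<close>-th unit vector from the left; the curl is the sum of these, applied to the partial derivatives.\<close>
definition unit_cross :: "3 \<Rightarrow> complex^3 \<Rightarrow> complex^3" where
  "unit_cross i v = (if i = 1 then vector [0, - v $ 3, v $ 2] else
     if i = 2 then vector [v $ 3, 0, - v $ 1] else vector [- v $ 2, v $ 1, 0])"

lemma bounded_linear_unit_cross: "bounded_linear (unit_cross i)"
  unfolding linear_conv_bounded_linear[symmetric]
  by (rule linearI) (auto simp: unit_cross_def vec_eq_iff forall_3)

lemma inner_unit_cross: "inner (unit_cross i v) w = - inner v (unit_cross i w)"
  by (auto simp: unit_cross_def inner_vec_def sum_3 inner_commute)

lemma curl_eq:
  assumes "\<psi> differentiable (at x)"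
  shows "curl \<psi> x = (\<Sum>i\<in>UNIV. unit_cross i (partial_deriv i \<psi> x))"
proof -
  have "partial_deriv i (\<lambda>y. \<psi> y $ j) x = partial_deriv i \<psi> x $ j" for i j
    by (rule partial_deriv_linear[OF assms bounded_linear_vec_nth])
  then show ?thesis unfolding curl_def by (simp add: sum_3 unit_cross_def vec_eq_iff forall_3)
qed

lemma curl_test_function: "\<psi> \<in> test_functions \<Omega> \<Longrightarrow>
  curl \<psi> = (\<lambda>x. unit_cross 1 (partial_deriv 1 \<psi> x) + unit_cross 2 (partial_deriv 2 \<psi> x) + unit_cross 3 (partial_deriv 3 \<psi> x))"
  by (rule ext) (simp add: curl_eq test_functions_differentiable sum_3)

lemma test_functions_curl: "\<psi> \<in> test_functions \<Omega> \<Longrightarrow> curl \<psi> \<in> test_functions \<Omega>"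
  unfolding curl_test_function
  by (intro test_functions_add test_functions_linear[OF bounded_linear_unit_cross] test_functions_partial_deriv)

lemma curl_add:
  assumes "\<psi> \<in> test_functions \<Omega>" "\<phi> \<in> test_functions \<Omega>"
  shows "curl (\<lambda>x. \<psi> x + \<phi> x) x = curl \<psi> x + curl \<phi> x"
  using assms test_functions_add[OF assms]
  by (simp add: curl_eq test_functions_differentiable partial_deriv_add sum.distrib
      linear_add[OF bounded_linear.linear[OF bounded_linear_unit_cross]])

lemma curl_linear:
  assumes "\<psi> \<in> test_functions \<Omega>" and L: "bounded_linear L"
    and LL: "\<And>i v. L (unit_cross i v) = unit_cross i (L v)"
  shows "curl (\<lambda>x. L (\<psi> x)) x = L (curl \<psi> x)"
  using assms test_functions_linear[OF L assms(1)]
  by (simp add: curl_eq test_functions_differentiable partial_deriv_linear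
      linear_sum[OF bounded_linear.linear[OF L]])

section \<open>Integration by parts\<close>

lemma continuous_compact_support_integrable:
  fixes f :: "real^3 \<Rightarrow> 'b::euclidean_space"
  assumes "continuous_on UNIV f" "compact K" "\<And>x. x \<notin> K \<Longrightarrow> f x = 0"
  shows "integrable lborel f"
proof -
  have "integrable lborel (\<lambda>x. indicator K x *\<^sub>R f x)"
    by (rule borel_integrable_compact[OF assms(2)]) (rule continuous_on_subset[OF assms(1)], simp)
  also have "(\<lambda>x. indicator K x *\<^sub>R f x) = f" using assms(3) by (auto simp: indicator_def)
  finally show ?thesis .
qed

lemma lborel_integral_translate:
  fixes f :: "real^3 \<Rightarrow> 'b::euclidean_space"
  assumes "f \<in> borel_measurable borel"
  shows "(LINT x|lborel. f (x + c)) = (LINT x|lborel. f x)"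
proof -
  have "(LINT x|lborel. f x) = (LINT x|distr lborel borel ((+) c). f x)"
    by (simp add: lborel_distr_plus)
  also have "\<dots> = (LINT x|lborel. f (c + x))" using assms by (subst integral_distr) auto
  finally show ?thesis by (simp add: add.commute)
qed

text \<open>Difference quotients of \<open>g\<close> have integral zero by translation invariance. They converge to
the partial derivative, dominated by its supremum on a fixed ball.\<close>
lemma integral_partial_deriv_eq_0:
  fixes g :: "real^3 \<Rightarrow> real"
  assumes d: "\<And>x. g differentiable (at x)" and c: "continuous_on UNIV (partial_deriv i g)"
    and K: "compact K" "\<And>x. x \<notin> K \<Longrightarrow> g x = 0"
  shows "(LINT x|lborel. partial_deriv i g x) = 0"
proof -
  define e :: "real^3" where "e = axis i 1"
  have ne: "norm e = 1" by (simp add: e_def)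
  have gc: "continuous_on UNIV g"
    using d by (metis continuous_at_imp_continuous_on differentiable_imp_continuous_within)
  have [measurable]: "g \<in> borel_measurable borel" using gc by (rule borel_measurable_continuous_onI)
  have gi: "integrable lborel g" by (rule continuous_compact_support_integrable[OF gc K])
  obtain r where r: "r > 0" "\<And>x. x \<in> K \<Longrightarrow> norm x \<le> r" using compact_imp_bounded[OF K(1)] bounded_pos by metis
  have dg: "((\<lambda>t. g (x + t *\<^sub>R e)) has_real_derivative partial_deriv i g (x + t *\<^sub>R e)) (at t)" for x t
  proof -
    have 1: "((\<lambda>t. x + t *\<^sub>R e) has_derivative (\<lambda>h. h *\<^sub>R e)) (at t)"
      by (auto intro!: derivative_eq_intros)
    have 2: "(g has_derivative frechet_derivative g (at (x + t *\<^sub>R e))) (at (x + t *\<^sub>R e))"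
      using d frechet_derivative_works by blast
    from has_derivative_compose[OF 1 2] show ?thesis
      unfolding has_field_derivative_def partial_deriv_def e_def[symmetric]
      using linear_cmul[OF has_derivative_linear[OF 2]] by (simp add: mult.commute[of _ "frechet_derivative _ _ _"])
  qed
  have pz: "partial_deriv i g x = 0" if "x \<notin> K" for x
  proof (rule partial_deriv_support)
    have "closure {x. g x \<noteq> 0} \<subseteq> K" using K by (intro closure_minimal compact_imp_closed) auto
    then show "x \<notin> closure {x. g x \<noteq> 0}" using that by blast
  qed
  have "compact (partial_deriv i g ` K)" using K c by (intro compact_continuous_image continuous_on_subset[OF c]) auto
  then obtain B where B: "B > 0" "\<And>x. x \<in> K \<Longrightarrow> norm (partial_deriv i g x) \<le> B"
    using compact_imp_bounded bounded_pos by (metis imageI)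
  have B': "\<bar>partial_deriv i g x\<bar> \<le> B" for x using B pz[of x] by (cases "x \<in> K") auto
  define s where "s n = inverse (real (Suc n))" for n
  have s: "0 < s n" "s n \<le> 1" for n by (auto simp: s_def field_simps)
  define f where "f n x = (g (x + s n *\<^sub>R e) - g x) / s n" for n x
  have [measurable]: "f n \<in> borel_measurable borel" for n unfolding f_def by measurable
  have "(\<lambda>n. LINT x|lborel. f n x) \<longlonglongrightarrow> (LINT x|lborel. partial_deriv i g x)"
  proof (rule integral_dominated_convergence[where w="\<lambda>x. indicator (cball 0 (r+1)) x *\<^sub>R B"])
    show "partial_deriv i g \<in> borel_measurable lborel" using c by (simp add: borel_measurable_continuous_onI)
    show "integrable lborel (\<lambda>x. indicator (cball (0::real^3) (r+1)) x *\<^sub>R B)"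
      by (rule borel_integrable_compact) auto
    show "AE x in lborel. (\<lambda>n. f n x) \<longlonglongrightarrow> partial_deriv i g x"
    proof (rule AE_I2)
      fix x
      have "((\<lambda>h. (g (x + h *\<^sub>R e) - g x) / h) \<longlongrightarrow> partial_deriv i g x) (at 0)"
        using dg[of x 0] by (simp add: DERIV_def)
      moreover have "filterlim s (at 0) sequentially"
        using s LIMSEQ_inverse_real_of_nat by (auto simp: filterlim_at s_def[abs_def])
      ultimately show "(\<lambda>n. f n x) \<longlonglongrightarrow> partial_deriv i g x"
        unfolding f_def by (rule filterlim_compose)
    qed
    show "AE x in lborel. norm (f n x) \<le> indicator (cball 0 (r+1)) x *\<^sub>R B" for n
    proof (rule AE_I2)
      fix x
      have "norm (f n x) \<le> B"
      proof -
        obtain t where t: "g (x + s n *\<^sub>R e) - g (x + 0 *\<^sub>R e) = (s n - 0) * partial_deriv i g (x + t *\<^sub>R e)"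
          using MVT2[OF s(1) dg, of n x] by auto
        then have "f n x = partial_deriv i g (x + t *\<^sub>R e)" using s(1)[of n] by (simp add: f_def)
        then show ?thesis using B' by simp
      qed
      moreover have "f n x = 0" if x: "x \<notin> cball 0 (r+1)"
      proof -
        have "norm (s n *\<^sub>R e) \<le> 1" using s[of n] ne by simp
        then have "norm (x + s n *\<^sub>R e) > r" using x norm_triangle_ineq2[of x "- (s n *\<^sub>R e)"] by simp
        then have "x + s n *\<^sub>R e \<notin> K" "x \<notin> K" using r x by force+
        then show ?thesis by (simp add: f_def K)
      qed
      ultimately show "norm (f n x) \<le> indicator (cball 0 (r+1)) x *\<^sub>R B" by (cases "x \<in> cball 0 (r+1)") auto
    qed
  qed auto
  moreover have "(LINT x|lborel. f n x) = 0" for n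
  proof -
    have "integrable lborel (\<lambda>x. g (x + s n *\<^sub>R e))"
    proof (rule continuous_compact_support_integrable)
      show "continuous_on UNIV (\<lambda>x. g (x + s n *\<^sub>R e))"
        by (intro continuous_on_compose2[OF gc]) (auto intro!: continuous_intros)
      show "compact ((\<lambda>x. x - s n *\<^sub>R e) ` K)" by (intro compact_continuous_image K continuous_intros)
      show "g (x + s n *\<^sub>R e) = 0" if "x \<notin> (\<lambda>x. x - s n *\<^sub>R e) ` K" for x
        using that K(2)[of "x + s n *\<^sub>R e"] by force
    qed
    then show ?thesis unfolding f_def using gi lborel_integral_translate[of g "s n *\<^sub>R e"]
      by (simp add: integral_divide_zero)
  qed
  ultimately show ?thesis by (simp add: LIMSEQ_const_iff)
qed

lemma test_functions_continuous_on: "\<psi> \<in> test_functions \<Omega> \<Longrightarrow> continuous_on S \<psi>"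
  by (rule smooth_continuous_on[OF test_functions_smooth])

lemma test_functions_compact_support: "\<psi> \<in> test_functions \<Omega> \<Longrightarrow> compact (closure {x. \<psi> x \<noteq> 0})"
  by (simp add: test_functions_def)

lemma test_functions_prod_integrable:
  fixes \<psi> \<phi> :: "real^3 \<Rightarrow> 'b::euclidean_space"
  assumes "\<psi> \<in> test_functions \<Omega>" "\<phi> \<in> test_functions \<Omega>'"
  shows "integrable lborel (\<lambda>x. inner (\<psi> x) (\<phi> x))"
proof (rule continuous_compact_support_integrable)
  show "continuous_on UNIV (\<lambda>x. inner (\<psi> x) (\<phi> x))"
    by (intro continuous_intros test_functions_continuous_on[OF assms(1)] test_functions_continuous_on[OF assms(2)])
  show "compact (closure {x. \<psi> x \<noteq> 0})" by (rule test_functions_compact_support[OF assms(1)])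
  show "inner (\<psi> x) (\<phi> x) = 0" if "x \<notin> closure {x. \<psi> x \<noteq> 0}" for x
    using zero_off_support[OF that] by simp
qed

lemma integration_by_parts:
  fixes \<psi> \<phi> :: "real^3 \<Rightarrow> 'b::euclidean_space"
  assumes "\<psi> \<in> test_functions \<Omega>" "\<phi> \<in> test_functions \<Omega>'"
  shows "(LINT x|lborel. inner (\<psi> x) (partial_deriv i \<phi> x)) = - (LINT x|lborel. inner (partial_deriv i \<psi> x) (\<phi> x))"
proof -
  have eq: "partial_deriv i (\<lambda>x. inner (\<psi> x) (\<phi> x)) = (\<lambda>x. inner (\<psi> x) (partial_deriv i \<phi> x) + inner (partial_deriv i \<psi> x) (\<phi> x))"
    using assms by (intro ext partial_deriv_bilinear bounded_bilinear_inner test_functions_differentiable)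
  have "(LINT x|lborel. partial_deriv i (\<lambda>x. inner (\<psi> x) (\<phi> x)) x) = 0"
  proof (rule integral_partial_deriv_eq_0)
    show "(\<lambda>x. inner (\<psi> x) (\<phi> x)) differentiable (at x)" for x
      using assms by (intro differentiable_inner test_functions_differentiable)
    show "continuous_on UNIV (partial_deriv i (\<lambda>x. inner (\<psi> x) (\<phi> x)))" unfolding eq
      by (intro continuous_intros test_functions_continuous_on[OF assms(1)] test_functions_continuous_on[OF assms(2)]
        test_functions_continuous_on[OF test_functions_partial_deriv[OF assms(1)]]
        test_functions_continuous_on[OF test_functions_partial_deriv[OF assms(2)]])
    show "compact (closure {x. \<psi> x \<noteq> 0})" by (rule test_functions_compact_support[OF assms(1)])
    show "inner (\<psi> x) (\<phi> x) = 0" if "x \<notin> closure {x. \<psi> x \<noteq> 0}" for x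
      using zero_off_support[OF that] by simp
  qed
  then show ?thesis unfolding eq using assms
    by (subst (asm) Bochner_Integration.integral_add)
      (auto intro!: test_functions_prod_integrable test_functions_partial_deriv)
qed

text \<open>Integration by parts changes the sign, and so does moving \<open>unit_cross i\<close> to the other factor.\<close>
lemma curl_symmetric:
  assumes p: "\<psi> \<in> test_functions \<Omega>" and f: "\<phi> \<in> test_functions \<Omega>'"
  shows "(LINT x|lborel. inner (\<psi> x) (curl \<phi> x)) = (LINT x|lborel. inner (curl \<psi> x) (\<phi> x))"
proof -
  have "(LINT x|lborel. inner (\<psi> x) (curl \<phi> x)) = (\<Sum>i\<in>UNIV. LINT x|lborel. inner (\<psi> x) (unit_cross i (partial_deriv i \<phi> x)))"
    using f by (simp add: curl_eq test_functions_differentiable inner_sum_right,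
      intro Bochner_Integration.integral_sum test_functions_prod_integrable[OF p] test_functions_linear[OF bounded_linear_unit_cross]
        test_functions_partial_deriv)
  also have "\<dots> = (\<Sum>i\<in>UNIV. LINT x|lborel. inner (unit_cross i (partial_deriv i \<psi> x)) (\<phi> x))"
  proof (rule sum.cong[OF refl])
    fix i :: 3
    have "(LINT x|lborel. inner (\<psi> x) (unit_cross i (partial_deriv i \<phi> x))) = - (LINT x|lborel. inner (unit_cross i (\<psi> x)) (partial_deriv i \<phi> x))"
      by (simp add: inner_unit_cross)
    also have "\<dots> = (LINT x|lborel. inner (partial_deriv i (\<lambda>x. unit_cross i (\<psi> x)) x) (\<phi> x))"
      by (subst integration_by_parts[OF test_functions_linear[OF bounded_linear_unit_cross p] f]) simp
    also have "\<dots> = (LINT x|lborel. inner (unit_cross i (partial_deriv i \<psi> x)) (\<phi> x))"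
      by (simp add: partial_deriv_linear[OF test_functions_differentiable[OF p] bounded_linear_unit_cross])
    finally show "(LINT x|lborel. inner (\<psi> x) (unit_cross i (partial_deriv i \<phi> x))) = (LINT x|lborel. inner (unit_cross i (partial_deriv i \<psi> x)) (\<phi> x))" .
  qed
  also have "\<dots> = (LINT x|lborel. inner (curl \<psi> x) (\<phi> x))"
    using p by (simp add: curl_eq test_functions_differentiable inner_sum_left,
      intro Bochner_Integration.integral_sum[symmetric] test_functions_prod_integrable[OF _ f] test_functions_linear[OF bounded_linear_unit_cross]
        test_functions_partial_deriv)
  finally show ?thesis .
qed

section \<open>The fundamental lemma of the calculus of variations\<close>

lemma closure_box_subset: "closure (box a b) \<subseteq> cbox a (b::real^3)"
  by (rule closure_minimal[OF box_subset_cbox closed_cbox])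

lemma bump_test_function:
  assumes "k > 0" "cbox a b \<subseteq> \<Omega>"
  shows "bump k a b \<in> test_functions \<Omega>"
proof -
  have s: "{x. bump k a b x \<noteq> 0} = box a b" using bump_nonzero_iff[OF assms(1)] by auto
  have "compact (closure (box a b))"
    by (simp add: compact_closure)
  then show ?thesis using closure_box_subset[of a b] assms(2) by (auto simp: test_functions_def smooth_bump s)
qed

lemma sq_int_set_integrable:
  assumes "sq_int w" "A \<in> lmeasurable"
  shows "set_integrable lebesgue A w"
  unfolding set_integrable_def
proof (rule Bochner_Integration.integrable_bound)
  have [measurable]: "A \<in> sets lebesgue" using assms(2) by (rule fmeasurableD)
  have [measurable]: "w \<in> borel_measurable lebesgue" using assms(1) by (simp add: sq_int_def)
  have "integrable lebesgue (indicator A :: real^3 \<Rightarrow> real)"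
    using assms(2) by (intro integrable_real_indicator) (auto simp: fmeasurable_def)
  then show "integrable lebesgue (\<lambda>x. indicator A x + (norm (w x))\<^sup>2)"
    using assms(1) unfolding sq_int_def by (intro Bochner_Integration.integrable_add) auto
  show "(\<lambda>x. indicator A x *\<^sub>R w x) \<in> borel_measurable lebesgue"
    by measurable
  show "AE x in lebesgue. norm (indicator A x *\<^sub>R w x) \<le> norm (indicator A x + (norm (w x))\<^sup>2)"
  proof (rule AE_I2)
    fix x
    have "norm (w x) \<le> 1 + (norm (w x))\<^sup>2"
      using sum_squares_bound[of 1 "norm (w x)"] norm_ge_zero[of "w x"] unfolding power_one by linarith
    then show "norm (indicator A x *\<^sub>R w x) \<le> norm (indicator A x + (norm (w x))\<^sup>2)"
      by (auto simp: indicator_def)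
  qed
qed

text \<open>The multiples of the bumps on the box, tested against \<open>w\<close>, converge to its indicator times an arbitrary vector.\<close>
lemma integral_box_eq_0:
  assumes w: "sq_int w" and ab: "cbox a b \<subseteq> \<Omega>"
    and orth: "\<And>\<psi>. \<psi> \<in> test_functions \<Omega> \<Longrightarrow> (LINT x|lebesgue. inner (w x) (\<psi> x)) = 0"
  shows "integral (cbox a b) w = 0"
proof -
  have [measurable]: "w \<in> borel_measurable lebesgue" using w by (simp add: sq_int_def)
  have int: "set_integrable lebesgue (box a b) w" by (rule sq_int_set_integrable[OF w]) simp
  have bumpm [measurable]: "bump k a b \<in> borel_measurable lebesgue" for k
    by (intro measurable_completion) (simp add: borel_measurable_continuous_onI smooth_continuous_on smooth_bump)
  have "inner (LINT x:box a b|lebesgue. w x) c = 0" for c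
  proof -
    have "(\<lambda>n. LINT x|lebesgue. inner (w x) (bump (real (Suc n)) a b x *\<^sub>R c)) \<longlonglongrightarrow>
      (LINT x|lebesgue. inner (w x) (indicator (box a b) x *\<^sub>R c))"
    proof (rule integral_dominated_convergence[where w="\<lambda>x. norm (indicator (box a b) x *\<^sub>R w x) * norm c"])
      show "integrable lebesgue (\<lambda>x. norm (indicator (box a b) x *\<^sub>R w x) * norm c)"
        using int unfolding set_integrable_def by (intro integrable_mult_left integrable_norm)
      show "AE x in lebesgue. (\<lambda>n. inner (w x) (bump (real (Suc n)) a b x *\<^sub>R c)) \<longlonglongrightarrow> inner (w x) (indicator (box a b) x *\<^sub>R c)"
        by (intro AE_I2 tendsto_intros bump_tendsto_indicator)
      show "AE x in lebesgue. norm (inner (w x) (bump (real (Suc n)) a b x *\<^sub>R c)) \<le> norm (indicator (box a b) x *\<^sub>R w x) * norm c" for n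
      proof (rule AE_I2)
        fix x
        have "bump (real (Suc n)) a b x \<le> indicator (box a b) x"
          using bump_nonzero_iff[of "real (Suc n)" a b x] bump_bounds(2)[of "real (Suc n)" a b x]
          by (cases "x \<in> box a b") auto
        then have "bump (real (Suc n)) a b x * \<bar>inner (w x) c\<bar> \<le> indicator (box a b) x * (norm (w x) * norm c)"
          by (intro mult_mono Cauchy_Schwarz_ineq2) auto
        then show "norm (inner (w x) (bump (real (Suc n)) a b x *\<^sub>R c)) \<le> norm (indicator (box a b) x *\<^sub>R w x) * norm c"
          using bump_bounds(1)[of "real (Suc n)" a b x] by (simp add: abs_mult mult_ac)
      qed
      show "(\<lambda>x. inner (w x) (indicator (box a b) x *\<^sub>R c)) \<in> borel_measurable lebesgue"
        by (intro borel_measurable_inner borel_measurable_scaleR borel_measurable_indicator borel_measurable_const) simp_all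
    qed simp_all
    moreover have "(LINT x|lebesgue. inner (w x) (bump (real (Suc n)) a b x *\<^sub>R c)) = 0" for n
      by (rule orth, rule test_functions_linear[OF bounded_linear_scaleR_left bump_test_function]) (use ab in auto)
    ultimately have "(LINT x|lebesgue. inner (w x) (indicator (box a b) x *\<^sub>R c)) = 0"
      by (simp only: LIMSEQ_const_iff)
    also have "(LINT x|lebesgue. inner (w x) (indicator (box a b) x *\<^sub>R c)) = (LINT x|lebesgue. inner (indicator (box a b) x *\<^sub>R w x) c)"
      by simp
    also have "\<dots> = inner (LINT x:box a b|lebesgue. w x) c"
      unfolding set_lebesgue_integral_def using int unfolding set_integrable_def by (rule integral_inner_left)
    finally show ?thesis .
  qed
  then have "(LINT x:box a b|lebesgue. w x) = 0" by (metis inner_eq_zero_iff)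
  then show ?thesis
    using set_lebesgue_integral_eq_integral(2)[OF int] by (simp add: integral_open_interval)
qed

text \<open>Almost every point is a limit of averages of \<open>w\<close> over small cubes at that point, and cubes inside \<open>\<Omega>\<close> have average zero.\<close>
lemma fundamental_lemma:
  assumes \<Omega>: "open \<Omega>" and w: "sq_int w"
    and orth: "\<And>\<psi>. \<psi> \<in> test_functions \<Omega> \<Longrightarrow> (LINT x|lebesgue. inner (w x) (\<psi> x)) = 0"
  shows "AE x in lebesgue. x \<in> \<Omega> \<longrightarrow> w x = 0"
proof -
  have "w integrable_on cbox a b" for a b
    using set_lebesgue_integral_eq_integral(1)[OF sq_int_set_integrable[OF w, of "cbox a b"]] by simp
  then obtain N where N: "negligible N" and lim: "\<And>x e. x \<notin> N \<Longrightarrow> 0 < e \<Longrightarrow>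
      \<exists>d>0. \<forall>h. 0 < h \<and> h < d \<longrightarrow> norm (integral (cbox x (x + h *\<^sub>R One)) w /\<^sub>R h ^ DIM(real^3) - w x) < e"
    using integrable_ccontinuous_explicit[of w] by blast
  have "w x = 0" if x: "x \<in> \<Omega>" "x \<notin> N" for x
  proof (rule ccontr)
    assume "w x \<noteq> 0"
    then obtain d where d: "d > 0" "\<And>h. 0 < h \<Longrightarrow> h < d \<Longrightarrow>
        norm (integral (cbox x (x + h *\<^sub>R One)) w /\<^sub>R h ^ DIM(real^3) - w x) < norm (w x)"
      using lim[OF x(2), of "norm (w x)"] by auto
    obtain e where e: "e > 0" "cball x e \<subseteq> \<Omega>" using \<Omega> x(1) open_contains_cball by blast
    define o1 where "o1 = norm (One :: real^3)"
    have o1: "o1 \<ge> 0" by (simp add: o1_def)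
    define h where "h = min (d/2) (e / (o1 + 1))"
    have "h \<le> d/2" unfolding h_def by (rule min.cobounded1)
    moreover have "0 < h" using d(1) e(1) o1 by (simp add: h_def)
    ultimately have h: "0 < h" "h < d" using d(1) by linarith+
    have "cbox x (x + h *\<^sub>R One) \<subseteq> cball x e"
    proof
      fix y assume y: "y \<in> cbox x (x + h *\<^sub>R One)"
      have "norm (y - x) \<le> norm (h *\<^sub>R (One :: real^3))"
        using y h(1) by (intro norm_le_componentwise) (auto simp: mem_box inner_simps abs_if)
      also have "\<dots> = h * o1" using h by (simp add: o1_def)
      also have "\<dots> \<le> (e / (o1 + 1)) * o1" using o1 by (intro mult_right_mono) (auto simp: h_def)
      also have "\<dots> \<le> e" using e o1 by (simp add: field_simps)
      finally show "y \<in> cball x e" by (simp add: dist_norm norm_minus_commute)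
    qed
    then have "integral (cbox x (x + h *\<^sub>R One)) w = 0"
      using e by (intro integral_box_eq_0[OF w _ orth]) auto
    then show False using d(2)[OF h] by simp
  qed
  then have "{x. \<not> (x \<in> \<Omega> \<longrightarrow> w x = 0)} \<subseteq> N" by blast
  then have "negligible {x. \<not> (x \<in> \<Omega> \<longrightarrow> w x = 0)}" using N negligible_subset by blast
  then show ?thesis by (simp add: AE_iff_null_sets eventually_ae_filter negligible_iff_null_sets Compl_eq)
     (metis (mono_tags, lifting) mem_Collect_eq subsetI)
qed

section \<open>A divergence-free field in a ball\<close>

definition model_bump :: "real^3 \<Rightarrow> real" where
  "model_bump = bump 1 (\<chi> i. -1/2) (\<chi> i. 1/2)"

text \<open>The curl of the field with components \<open>0\<close>, \<open>0\<close> and \<open>model_bump\<close>; this is what makes it divergence-free.\<close>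
definition model_field :: "real^3 \<Rightarrow> complex^3" where
  "model_field x = partial_deriv 2 model_bump x *\<^sub>R axis 1 1 - partial_deriv 1 model_bump x *\<^sub>R axis 2 1"

definition model_cube :: "(real^3) set" where "model_cube = cbox (\<chi> i. -1/2) (\<chi> i. 1/2)"

lemma model_bump_test: "model_bump \<in> test_functions model_cube"
  unfolding model_bump_def model_cube_def by (rule bump_test_function) auto

lemma model_bump_algebra: "model_bump \<in> bump_algebra"
  unfolding model_bump_def by (rule bump_in_bump_algebra)

lemma model_field_test: "model_field \<in> test_functions model_cube"
proof -
  have "(\<lambda>x. partial_deriv 2 model_bump x *\<^sub>R (axis 1 1 :: complex^3) + partial_deriv 1 model_bump x *\<^sub>R (- axis 2 1)) \<in> test_functions model_cube"
    by (rule test_functions_add[OF test_functions_linear[OF bounded_linear_scaleR_left] test_functions_linear[OF bounded_linear_scaleR_left]])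
      (intro test_functions_partial_deriv model_bump_test)+
  then show ?thesis by (simp add: model_field_def[abs_def])
qed

lemma model_field_divergence_free: "(\<Sum>i\<in>UNIV. partial_deriv i model_field x $ i) = 0"
proof -
  have d: "model_field differentiable (at x)" "partial_deriv j model_bump differentiable (at x)" for j x
    using test_functions_differentiable[OF model_field_test]
      test_functions_differentiable[OF test_functions_partial_deriv[OF model_bump_test]] by blast+
  have 1: "partial_deriv i model_field x $ i = partial_deriv i (\<lambda>x. model_field x $ i) x" for i
    by (rule partial_deriv_linear[OF d(1) bounded_linear_vec_nth, symmetric])
  have c1: "(\<lambda>x. model_field x $ 1) = (\<lambda>x. complex_of_real (partial_deriv 2 model_bump x))"
    by (simp add: model_field_def axis_def fun_eq_iff scaleR_conv_of_real[where 'a=complex])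
  have c2: "(\<lambda>x. model_field x $ 2) = (\<lambda>x. complex_of_real (- partial_deriv 1 model_bump x))"
    by (simp add: model_field_def axis_def fun_eq_iff scaleR_conv_of_real[where 'a=complex])
  have c3: "(\<lambda>x. model_field x $ 3) = (\<lambda>x. 0)"
    by (simp add: model_field_def axis_def fun_eq_iff)
  have "partial_deriv 1 (\<lambda>x. model_field x $ 1) x = complex_of_real (partial_deriv 1 (partial_deriv 2 model_bump) x)"
    unfolding c1 by (rule partial_deriv_linear[OF d(2) bounded_linear_of_real])
  moreover have "partial_deriv 2 (\<lambda>x. model_field x $ 2) x = complex_of_real (- partial_deriv 2 (partial_deriv 1 model_bump) x)"
    unfolding c2 by (rule partial_deriv_linear[OF d(2)])
      (intro bounded_linear_minus[OF bounded_linear_of_real, simplified of_real_minus[symmetric]])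
  moreover have "partial_deriv 3 (\<lambda>x. model_field x $ 3) x = 0" unfolding c3 by simp
  ultimately show ?thesis
    using fun_cong[OF bump_algebra_partial_deriv_commute[OF model_bump_algebra, of 1 2], of x]
    by (simp add: sum_3 1)
qed

lemma model_field_real: "cnj (model_field x $ i) = model_field x $ i"
  by (simp add: model_field_def axis_def)

text \<open>Otherwise the bump would be constant along the second axis, but it is positive at the origin and zero at distance one.\<close>
lemma model_field_nonzero: "\<exists>x. model_field x \<noteq> 0"
proof (rule ccontr)
  assume "\<not> ?thesis"
  then have z: "model_field x $ 1 = 0" for x by simp
  have pd: "partial_deriv 2 model_bump x = 0" for x
    using z[of x] by (simp add: model_field_def axis_def scaleR_conv_of_real[where 'a=complex])
  let ?e = "axis 2 1 :: real^3"
  have "((\<lambda>t. model_bump (0 + t *\<^sub>R ?e)) has_real_derivative 0) (at t)" for t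
  proof -
    have 1: "((\<lambda>t. 0 + t *\<^sub>R ?e) has_derivative (\<lambda>h. h *\<^sub>R ?e)) (at t)"
      by (auto intro!: derivative_eq_intros)
    have 2: "(model_bump has_derivative frechet_derivative model_bump (at (0 + t *\<^sub>R ?e))) (at (0 + t *\<^sub>R ?e))"
      using bump_algebra_differentiable[OF model_bump_algebra] frechet_derivative_works by blast
    from has_derivative_compose[OF 1 2] show ?thesis
      using linear_cmul[OF has_derivative_linear[OF 2]] pd[of "0 + t *\<^sub>R ?e"]
      by (intro has_derivative_imp_has_field_derivative) (auto simp: partial_deriv_def)
  qed
  then have "\<forall>t. ((\<lambda>t. model_bump (0 + t *\<^sub>R ?e)) has_real_derivative 0) (at t)" by blast
  from DERIV_isconst_all[OF this, of 0 1] have eq: "model_bump 0 = model_bump ?e" by simp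
  have "model_bump 0 \<noteq> 0"
    unfolding model_bump_def by (subst bump_nonzero_iff) (auto simp: mem_box_cart)
  moreover have "\<not> model_bump ?e \<noteq> 0"
    unfolding model_bump_def by (subst bump_nonzero_iff) (auto simp: mem_box_cart axis_def intro!: exI[of _ 2])
  ultimately show False using eq by simp
qed

text \<open>The cube of edge length one fits into the unit ball: half its diagonal is \<open>\<surd>3 / 2\<close>.\<close>
lemma model_cube_norm: "y \<in> model_cube \<Longrightarrow> norm y < 1"
proof -
  assume y: "y \<in> model_cube"
  have "(y $ i)\<^sup>2 \<le> 1/4" for i
  proof -
    have "-1/2 \<le> y $ i" "y $ i \<le> 1/2" using y by (simp_all add: model_cube_def mem_box_cart)
    then have "\<bar>y $ i\<bar> \<le> 1/2" by linarith
    then have "\<bar>y $ i\<bar>\<^sup>2 \<le> (1/2)\<^sup>2" by (intro power_mono) auto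
    then show ?thesis by (simp add: power2_eq_square)
  qed
  then have "(norm y)\<^sup>2 \<le> 3/4"
    using sum_mono[of UNIV "\<lambda>i. (y $ i)\<^sup>2" "\<lambda>i. 1/4"] by (simp add: norm_vec_def L2_set_def sum_3)
  then have "(norm y)\<^sup>2 < 1\<^sup>2" by simp
  then show "norm y < 1" by (rule power2_less_imp_less) simp
qed

definition ball_field :: "real^3 \<Rightarrow> real \<Rightarrow> real^3 \<Rightarrow> complex^3" where
  "ball_field a r x = model_field ((1/r) *\<^sub>R x + (- (1/r)) *\<^sub>R a)"

lemma ball_field_off_ball:
  assumes "r > 0" "ball_field a r x \<noteq> 0"
  shows "(1/r) *\<^sub>R x + (- (1/r)) *\<^sub>R a \<in> model_cube"
proof (rule ccontr)
  let ?y = "(1/r) *\<^sub>R x + (- (1/r)) *\<^sub>R a"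
  assume "?y \<notin> model_cube"
  moreover have "closure {x. model_field x \<noteq> 0} \<subseteq> model_cube" using model_field_test by (simp add: test_functions_def)
  ultimately have "?y \<notin> closure {x. model_field x \<noteq> 0}" by blast
  then have "model_field ?y = 0" by (rule zero_off_support)
  then show False using assms(2) unfolding ball_field_def by contradiction
qed

lemma scaled_cube_subset_ball:
  assumes "r > 0" "(1/r) *\<^sub>R x + (- (1/r)) *\<^sub>R a \<in> model_cube" shows "x \<in> ball a r"
proof -
  have "(1/r) *\<^sub>R x + (- (1/r)) *\<^sub>R a = (1/r) *\<^sub>R (x - a)" by (simp add: algebra_simps)
  then have "norm ((1/r) *\<^sub>R (x - a)) < 1" using model_cube_norm assms(2) by metis
  then have "norm (x - a) / r < 1" using assms(1) unfolding norm_scaleR by simp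
  then show ?thesis using assms(1) by (simp add: dist_norm norm_minus_commute)
qed

lemma ball_field_test:
  assumes r: "r > 0" "ball a r \<subseteq> \<Omega>"
  shows "ball_field a r \<in> test_functions \<Omega>"
proof -
  let ?f = "\<lambda>x. (1/r) *\<^sub>R x + (- (1/r)) *\<^sub>R a"
  let ?S = "?f -` model_cube"
  have sm: "smooth (ball_field a r)" unfolding ball_field_def[abs_def]
    by (rule smooth_affine[OF test_functions_smooth[OF model_field_test]])
  have "closed ?S" by (intro closed_vimage continuous_intros) (auto simp: model_cube_def)
  moreover have "{x. ball_field a r x \<noteq> 0} \<subseteq> ?S" using ball_field_off_ball[OF r(1)] by auto
  ultimately have c: "closure {x. ball_field a r x \<noteq> 0} \<subseteq> ?S" by (intro closure_minimal)
  moreover have "?S \<subseteq> ball a r" using scaled_cube_subset_ball[OF r(1)] by auto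
  ultimately have "closure {x. ball_field a r x \<noteq> 0} \<subseteq> ball a r" by blast
  then show ?thesis using sm r(2) bounded_subset[OF bounded_ball]
    by (auto simp: test_functions_def compact_eq_bounded_closed)
qed

lemma partial_deriv_ball_field:
  "partial_deriv i (ball_field a r) x = (1/r) *\<^sub>R partial_deriv i model_field ((1/r) *\<^sub>R x + (- (1/r)) *\<^sub>R a)"
  unfolding ball_field_def[abs_def]
  by (rule partial_deriv_affine[OF test_functions_differentiable[OF model_field_test]])

lemma ball_field_divergence_free: "(\<Sum>i\<in>UNIV. partial_deriv i (ball_field a r) x $ i) = 0"
  using model_field_divergence_free[of "(1/r) *\<^sub>R x + (- (1/r)) *\<^sub>R a"]
  unfolding partial_deriv_ball_field vector_scaleR_component scaleR_sum_right[symmetric] by simp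

lemma ball_field_real: "cnj (ball_field a r x $ i) = ball_field a r x $ i"
  unfolding ball_field_def by (rule model_field_real)

lemma curl_ball_field:
  "curl (ball_field a r) x = (1/r) *\<^sub>R curl model_field ((1/r) *\<^sub>R x + (- (1/r)) *\<^sub>R a)"
proof -
  have "ball_field a r differentiable (at x)"
    by (rule smooth_differentiable) (unfold ball_field_def[abs_def], rule smooth_affine[OF test_functions_smooth[OF model_field_test]])
  then show ?thesis
    by (simp add: curl_eq test_functions_differentiable[OF model_field_test] partial_deriv_ball_field scaleR_sum_right
        linear_cmul[OF bounded_linear.linear[OF bounded_linear_unit_cross]])
qed

lemma lborel_integral_scale:
  fixes f :: "real^3 \<Rightarrow> real"
  assumes f: "f \<in> borel_measurable borel" and s: "s > 0"
  shows "(LINT x|lborel. f x) = s ^ 3 * (LINT x|lborel. f (s *\<^sub>R x + c))"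
proof -
  have "(LINT x|lborel. f x) = (LINT x|density (distr lborel borel (\<lambda>x. c + s *\<^sub>R x)) (\<lambda>_. \<bar>s\<bar> ^ DIM(real^3)). f x)"
    using lborel_affine[of s c] s by simp
  also have "\<dots> = (LINT x|distr lborel borel (\<lambda>x. c + s *\<^sub>R x). \<bar>s\<bar> ^ DIM(real^3) *\<^sub>R f x)"
    using f by (intro integral_density) auto
  also have "\<dots> = (LINT x|lborel. \<bar>s\<bar> ^ DIM(real^3) *\<^sub>R f (c + s *\<^sub>R x))"
    using f by (intro integral_distr) auto
  finally show ?thesis using s by (simp add: add.commute power3_eq_cube)
qed

text \<open>Both integrals pick up the Jacobian \<open>r\<^sup>3\<close>; the curl in addition gains \<open>1 / r\<close> from the chain rule.\<close>
lemma ball_field_norms: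
  assumes r: "r > 0"
  shows "(LINT x|lborel. (norm (ball_field a r x))\<^sup>2) = r ^ 3 * (LINT x|lborel. (norm (model_field x))\<^sup>2)"
    and "(LINT x|lborel. (norm (curl (ball_field a r) x))\<^sup>2) = r ^ 3 * ((LINT x|lborel. (norm (curl model_field x))\<^sup>2) / r\<^sup>2)"
proof -
  have m: "(\<lambda>x. (norm (f x))\<^sup>2) \<in> borel_measurable borel" if "f \<in> test_functions \<Omega>" for f :: "real^3 \<Rightarrow> complex^3" and \<Omega>
    by (intro borel_measurable_continuous_onI continuous_intros test_functions_continuous_on[OF that])
  show "(LINT x|lborel. (norm (ball_field a r x))\<^sup>2) = r ^ 3 * (LINT x|lborel. (norm (model_field x))\<^sup>2)"
    using lborel_integral_scale[OF m[OF model_field_test], of "1/r" "(- (1/r)) *\<^sub>R a"] r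
    by (simp add: ball_field_def power_divide)
  show "(LINT x|lborel. (norm (curl (ball_field a r) x))\<^sup>2) = r ^ 3 * ((LINT x|lborel. (norm (curl model_field x))\<^sup>2) / r\<^sup>2)"
  proof -
    have "(LINT x|lborel. (norm (curl model_field ((1/r) *\<^sub>R x + (- (1/r)) *\<^sub>R a)))\<^sup>2) =
        r ^ 3 * (LINT x|lborel. (norm (curl model_field x))\<^sup>2)"
      using lborel_integral_scale[OF m[OF test_functions_curl[OF model_field_test]], of "1/r" "(- (1/r)) *\<^sub>R a"] r
      by (simp add: power_divide)
    then show ?thesis unfolding curl_ball_field norm_scaleR power_mult_distrib
      by (simp add: power_divide)
  qed
qed

lemma model_field_norm_pos: "0 < (LINT x|lborel. (norm (model_field x))\<^sup>2)"
proof -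
  let ?f = "\<lambda>x. (norm (model_field x))\<^sup>2"
  have i: "integrable lborel ?f"
    using test_functions_prod_integrable[OF model_field_test model_field_test] by (simp add: power2_norm_eq_inner)
  have "(LINT x|lborel. ?f x) \<noteq> 0"
  proof
    assume "(LINT x|lborel. ?f x) = 0"
    then have ae: "AE x in lborel. ?f x = 0" using integral_nonneg_eq_0_iff_AE[OF i] by auto
    have o: "open {x. ?f x \<noteq> 0}"
      by (intro open_Collect_neq continuous_intros test_functions_continuous_on[OF model_field_test])
    have "AE x in lebesgue. ?f x = 0" using ae by (rule AE_completion)
    then have "{x. ?f x \<noteq> 0} \<in> null_sets lebesgue"
      using o by (subst (asm) AE_iff_null) (auto intro: lborelD)
    then have "{x. ?f x \<noteq> 0} = {}" using open_not_negligible[OF o] by (auto simp: negligible_iff_null_sets)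
    then show False using model_field_nonzero by auto
  qed
  moreover have "0 \<le> (LINT x|lborel. ?f x)" by simp
  ultimately show ?thesis by linarith
qed

section \<open>Multiplication by the imaginary unit\<close>

definition mult_i :: "complex^3 \<Rightarrow> complex^3" where
  "mult_i v = (\<chi> j. \<i> * v $ j)"

lemma bounded_linear_mult_i: "bounded_linear mult_i"
  unfolding linear_conv_bounded_linear[symmetric]
  by (rule linearI) (auto simp: mult_i_def vec_eq_iff algebra_simps)

lemma inner_mult_i: "inner (mult_i v) (mult_i w) = inner v w" "inner (mult_i v) w = - inner v (mult_i w)"
  by (auto simp: mult_i_def inner_vec_def inner_complex_def sum_3 algebra_simps)

lemma norm_mult_i: "norm (mult_i v) = norm v"
  by (simp add: norm_eq_sqrt_inner inner_mult_i(1))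

lemma mult_i_unit_cross: "mult_i (unit_cross i v) = unit_cross i (mult_i v)"
  by (auto simp: mult_i_def unit_cross_def vec_eq_iff forall_3)

text \<open>The imaginary part of the Hermitian product is a real inner product with \<open>mult_i b\<close>. This reduces all complex identities to real ones.\<close>
lemma hermitian_eq: "hermitian a b = complex_of_real (inner a b) + \<i> * complex_of_real (inner a (mult_i b))"
  by (simp add: hermitian_def mult_i_def inner_vec_def inner_complex_def complex_eq_iff sum_3)

lemma borel_measurable_mult_i [measurable]: "mult_i \<in> borel_measurable borel"
  by (intro borel_measurable_continuous_onI linear_continuous_on bounded_linear_mult_i)

lemma sq_int_mult_i: "sq_int f \<Longrightarrow> sq_int (\<lambda>x. mult_i (f x))"
  by (auto simp: sq_int_def norm_mult_i intro: measurable_compose)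

lift_definition mult_i_l2 :: "l2 \<Rightarrow> l2" is "\<lambda>f x. mult_i (f x)"
  by (auto simp: l2_rel_def sq_int_mult_i elim: eventually_mono)

lemma mult_i_abs_l2: "sq_int f \<Longrightarrow> mult_i_l2 (abs_l2 f) = abs_l2 (\<lambda>x. mult_i (f x))"
  by (rule mult_i_l2.abs_eq) (simp add: l2_rel_def)

lemma inner_mult_i_l2: "inner (mult_i_l2 a) b = - inner a (mult_i_l2 b)"
  by transfer (simp add: inner_mult_i(2))

lemma mult_i_l2_diff: "mult_i_l2 (a - b) = mult_i_l2 a - mult_i_l2 b"
  by transfer (simp add: l2_rel_def linear_diff[OF bounded_linear.linear[OF bounded_linear_mult_i]] sq_int_mult_i sq_int_diff)

lemma norm_mult_i_l2: "norm (mult_i_l2 a) = norm a"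
proof -
  have "inner (mult_i_l2 a) (mult_i_l2 a) = inner a a" by transfer (simp add: inner_mult_i(1))
  then show ?thesis by (simp add: norm_eq_sqrt_inner)
qed

lemma mult_i_l2_continuous: "continuous_on S mult_i_l2"
  unfolding continuous_on_iff by (auto simp: dist_norm norm_mult_i_l2 mult_i_l2_diff[symmetric])

lemma mult_i_mult_i_l2: "mult_i_l2 (mult_i_l2 a) = - a"
proof transfer
  fix f assume "l2_rel f f"
  then have f: "sq_int f" by (simp add: l2_rel_def)
  have "mult_i (mult_i v) = - v" for v by (simp add: mult_i_def vec_eq_iff mult.assoc[symmetric])
  then show "l2_rel (\<lambda>x. mult_i (mult_i (f x))) (\<lambda>x. - f x)"
    using f sq_int_scaleR[OF f, of "-1"] by (simp add: l2_rel_def)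
qed

section \<open>The class of a field on an open set\<close>

definition zero_ext :: "(real^3) set \<Rightarrow> vfield \<Rightarrow> vfield" where
  "zero_ext \<Omega> u = (\<lambda>x. indicator \<Omega> x *\<^sub>R u x)"

definition field_class :: "(real^3) set \<Rightarrow> vfield \<Rightarrow> l2" where
  "field_class \<Omega> u = abs_l2 (zero_ext \<Omega> u)"

text \<open>The graph of the curl on test fields; its closure is the graph of the weak curl on \<open>H0_curl \<Omega>\<close>.\<close>
definition test_graph :: "(real^3) set \<Rightarrow> (l2 \<times> l2) set" where
  "test_graph \<Omega> = (\<lambda>\<psi>. (field_class \<Omega> \<psi>, field_class \<Omega> (curl \<psi>))) ` test_functions \<Omega>"

text \<open>Two real conditions replace the vanishing of the Hermitian product with each gradient.\<close>
definition solenoidal :: "(real^3) set \<Rightarrow> l2 set" where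
  "solenoidal \<Omega> = {a. \<forall>\<xi>\<in>dot_H1_0 \<Omega>. inner a (field_class \<Omega> (weak_grad \<Omega> \<xi>)) = 0 \<and>
     inner a (mult_i_l2 (field_class \<Omega> (weak_grad \<Omega> \<xi>))) = 0}"

definition form_graph :: "(real^3) set \<Rightarrow> (l2 \<times> l2) set" where
  "form_graph \<Omega> = closure (test_graph \<Omega>) \<inter> {p. fst p \<in> solenoidal \<Omega>}"

context
  fixes \<Omega> :: "(real^3) set"
  assumes open_\<Omega>: "open \<Omega>"
begin

lemma sets_\<Omega> [measurable]: "\<Omega> \<in> sets lebesgue"
  using open_\<Omega> by (simp add: borel_open sets_completionI_sets)

lemma Lp_iff: "u \<in> Lp 2 \<Omega> \<longleftrightarrow> sq_int (zero_ext \<Omega> u)"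
proof -
  have "(\<lambda>x. indicator \<Omega> x *\<^sub>R (norm (u x))\<^sup>2) = (\<lambda>x. (norm (zero_ext \<Omega> u x))\<^sup>2)"
    by (auto simp: zero_ext_def indicator_def)
  then show ?thesis
    by (simp add: Lp_def sq_int_def borel_measurable_restrict_space_iff integrable_restrict_space zero_ext_def[abs_def] set_integrable_def)
qed

lemma zero_ext_sq_int: "u \<in> Lp 2 \<Omega> \<Longrightarrow> sq_int (zero_ext \<Omega> u)" by (simp add: Lp_iff)

lemma L2_norm_eq: "u \<in> Lp 2 \<Omega> \<Longrightarrow> L2_norm \<Omega> u = norm (field_class \<Omega> u)"
proof -
  assume u: "u \<in> Lp 2 \<Omega>"
  have "(\<lambda>x. indicator \<Omega> x *\<^sub>R (norm (u x))\<^sup>2) = (\<lambda>x. (norm (zero_ext \<Omega> u x))\<^sup>2)"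
    by (auto simp: zero_ext_def indicator_def)
  then have "L2_norm \<Omega> u = sqrt ((norm (field_class \<Omega> u))\<^sup>2)"
    unfolding L2_norm_def field_class_def norm_abs_l2[OF zero_ext_sq_int[OF u]] by (simp add: integral_restrict_space)
  then show ?thesis by simp
qed

lemma zero_ext_linear: "bounded_linear L \<Longrightarrow> zero_ext \<Omega> (\<lambda>x. L (u x)) = (\<lambda>x. L (zero_ext \<Omega> u x))"
  by (auto simp: zero_ext_def linear_cmul[OF bounded_linear.linear])

lemma Lp_add: "u \<in> Lp 2 \<Omega> \<Longrightarrow> v \<in> Lp 2 \<Omega> \<Longrightarrow> (\<lambda>x. u x + v x) \<in> Lp 2 \<Omega>"
  and field_class_add: "u \<in> Lp 2 \<Omega> \<Longrightarrow> v \<in> Lp 2 \<Omega> \<Longrightarrow> field_class \<Omega> (\<lambda>x. u x + v x) = field_class \<Omega> u + field_class \<Omega> v"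
proof -
  have *: "zero_ext \<Omega> (\<lambda>x. u x + v x) = (\<lambda>x. zero_ext \<Omega> u x + zero_ext \<Omega> v x)" by (auto simp: zero_ext_def algebra_simps)
  show "u \<in> Lp 2 \<Omega> \<Longrightarrow> v \<in> Lp 2 \<Omega> \<Longrightarrow> (\<lambda>x. u x + v x) \<in> Lp 2 \<Omega>" by (simp add: Lp_iff * sq_int_add)
  show "u \<in> Lp 2 \<Omega> \<Longrightarrow> v \<in> Lp 2 \<Omega> \<Longrightarrow> field_class \<Omega> (\<lambda>x. u x + v x) = field_class \<Omega> u + field_class \<Omega> v"
    by (simp add: field_class_def * add_abs_l2 Lp_iff)
qed

lemma Lp_scaleR: "u \<in> Lp 2 \<Omega> \<Longrightarrow> (\<lambda>x. c *\<^sub>R u x) \<in> Lp 2 \<Omega>"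
  and field_class_scaleR: "u \<in> Lp 2 \<Omega> \<Longrightarrow> field_class \<Omega> (\<lambda>x. c *\<^sub>R u x) = c *\<^sub>R field_class \<Omega> u"
  by (simp_all add: Lp_iff field_class_def zero_ext_linear[OF bounded_linear_scaleR_right] sq_int_scaleR scaleR_abs_l2)

lemma Lp_diff: "u \<in> Lp 2 \<Omega> \<Longrightarrow> v \<in> Lp 2 \<Omega> \<Longrightarrow> (\<lambda>x. u x - v x) \<in> Lp 2 \<Omega>"
  and field_class_diff: "u \<in> Lp 2 \<Omega> \<Longrightarrow> v \<in> Lp 2 \<Omega> \<Longrightarrow> field_class \<Omega> (\<lambda>x. u x - v x) = field_class \<Omega> u - field_class \<Omega> v"
  using Lp_add[of u "\<lambda>x. (-1) *\<^sub>R v x"] field_class_add[of u "\<lambda>x. (-1) *\<^sub>R v x"] Lp_scaleR[of v "-1"] field_class_scaleR[of v "-1"]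
  by simp_all

lemma Lp_mult_i: "u \<in> Lp 2 \<Omega> \<Longrightarrow> (\<lambda>x. mult_i (u x)) \<in> Lp 2 \<Omega>"
  and field_class_mult_i: "u \<in> Lp 2 \<Omega> \<Longrightarrow> field_class \<Omega> (\<lambda>x. mult_i (u x)) = mult_i_l2 (field_class \<Omega> u)"
  by (simp_all add: Lp_iff field_class_def zero_ext_linear[OF bounded_linear_mult_i] sq_int_mult_i mult_i_abs_l2)

lemma L2_inner_eq:
  assumes u: "u \<in> Lp 2 \<Omega>" and v: "v \<in> Lp 2 \<Omega>"
  shows "L2_inner \<Omega> u v = complex_of_real (inner (field_class \<Omega> u) (field_class \<Omega> v)) + \<i> * complex_of_real (inner (field_class \<Omega> u) (mult_i_l2 (field_class \<Omega> v)))"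
proof -
  have s: "sq_int (zero_ext \<Omega> u)" "sq_int (zero_ext \<Omega> v)" "sq_int (\<lambda>x. mult_i (zero_ext \<Omega> v x))"
    using u v by (auto simp: Lp_iff sq_int_mult_i)
  note i1 = sq_int_inner_integrable[OF s(1,2)] and i2 = sq_int_inner_integrable[OF s(1,3)]
  have "L2_inner \<Omega> u v = (LINT x|lebesgue. indicator \<Omega> x *\<^sub>R hermitian (u x) (v x))"
    unfolding L2_inner_def by (simp add: integral_restrict_space)
  also have "\<dots> = (LINT x|lebesgue. complex_of_real (inner (zero_ext \<Omega> u x) (zero_ext \<Omega> v x)) + \<i> * complex_of_real (inner (zero_ext \<Omega> u x) (mult_i (zero_ext \<Omega> v x))))"
    by (intro Bochner_Integration.integral_cong refl)
      (auto simp: zero_ext_def hermitian_eq indicator_def)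
  also have "\<dots> = complex_of_real (LINT x|lebesgue. inner (zero_ext \<Omega> u x) (zero_ext \<Omega> v x)) + \<i> * complex_of_real (LINT x|lebesgue. inner (zero_ext \<Omega> u x) (mult_i (zero_ext \<Omega> v x)))"
    using i1 i2 by simp
  also have "\<dots> = complex_of_real (inner (field_class \<Omega> u) (field_class \<Omega> v)) + \<i> * complex_of_real (inner (field_class \<Omega> u) (mult_i_l2 (field_class \<Omega> v)))"
    using s by (simp add: field_class_def inner_abs_l2 mult_i_abs_l2)
  finally show ?thesis .
qed

lemma L2_inner_eq_0_iff:
  assumes "u \<in> Lp 2 \<Omega>" "v \<in> Lp 2 \<Omega>"
  shows "L2_inner \<Omega> u v = 0 \<longleftrightarrow> inner (field_class \<Omega> u) (field_class \<Omega> v) = 0 \<and> inner (field_class \<Omega> u) (mult_i_l2 (field_class \<Omega> v)) = 0"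
  unfolding L2_inner_eq[OF assms] by (simp add: complex_eq_iff)

lemma rep_in_Lp: "rep_l2 a \<in> Lp 2 \<Omega>"
proof -
  have "sq_int (\<lambda>x. indicator \<Omega> x *\<^sub>R rep_l2 a x)"
    unfolding sq_int_def
  proof
    have [measurable]: "rep_l2 a \<in> borel_measurable lebesgue" using rep_l2_sq_int by (simp add: sq_int_def)
    show m: "(\<lambda>x. indicator \<Omega> x *\<^sub>R rep_l2 a x) \<in> borel_measurable lebesgue" by measurable
    show "integrable lebesgue (\<lambda>x. (norm (indicator \<Omega> x *\<^sub>R rep_l2 a x))\<^sup>2)"
      by (rule Bochner_Integration.integrable_bound[where f="\<lambda>x. (norm (rep_l2 a x))\<^sup>2"])
        (use rep_l2_sq_int[of a] m in \<open>auto simp: sq_int_def indicator_def\<close>)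
  qed
  then show ?thesis by (simp add: Lp_iff zero_ext_def)
qed

lemma field_class_rep_cls: "u \<in> Lp 2 \<Omega> \<Longrightarrow> field_class \<Omega> (rep_l2 (field_class \<Omega> u)) = field_class \<Omega> u"
proof -
  assume u: "u \<in> Lp 2 \<Omega>"
  have "AE x in lebesgue. rep_l2 (field_class \<Omega> u) x = zero_ext \<Omega> u x"
    using abs_l2_eq_iff[OF rep_l2_sq_int zero_ext_sq_int[OF u], of "field_class \<Omega> u"] by (simp add: abs_rep_l2 field_class_def)
  then have "AE x in lebesgue. zero_ext \<Omega> (rep_l2 (field_class \<Omega> u)) x = zero_ext \<Omega> u x"
    by eventually_elim (auto simp: zero_ext_def indicator_def)
  then show ?thesis unfolding field_class_def[of \<Omega> "rep_l2 _"]
    using abs_l2_eq_iff[OF zero_ext_sq_int[OF rep_in_Lp] zero_ext_sq_int[OF u]] by (simp add: field_class_def)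
qed

text \<open>The classes supported in \<open>\<Omega>\<close> are the fixed points of restriction to \<open>\<Omega>\<close>, which does not increase distances.\<close>
lemma closed_field_class_range: "closed {a. field_class \<Omega> (rep_l2 a) = a}"
proof (rule closed_Collect_eq)
  have "dist (field_class \<Omega> (rep_l2 a)) (field_class \<Omega> (rep_l2 b)) \<le> dist a b" for a b
  proof -
    have "(norm (field_class \<Omega> (rep_l2 a) - field_class \<Omega> (rep_l2 b)))\<^sup>2 \<le> (norm (a - b))\<^sup>2"
    proof -
      let ?d = "\<lambda>x. rep_l2 a x - rep_l2 b x"
      have d: "sq_int ?d" by (intro sq_int_diff rep_l2_sq_int)
      have dL: "?d \<in> Lp 2 \<Omega>" by (intro Lp_diff rep_in_Lp)
      have "field_class \<Omega> (rep_l2 a) - field_class \<Omega> (rep_l2 b) = abs_l2 (zero_ext \<Omega> ?d)"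
        using field_class_diff[OF rep_in_Lp rep_in_Lp, of a b] by (simp add: field_class_def)
      then have "(norm (field_class \<Omega> (rep_l2 a) - field_class \<Omega> (rep_l2 b)))\<^sup>2 = (LINT x|lebesgue. (norm (zero_ext \<Omega> ?d x))\<^sup>2)"
        by (simp only: norm_abs_l2[OF zero_ext_sq_int[OF dL]])
      also have "\<dots> \<le> (LINT x|lebesgue. (norm (?d x))\<^sup>2)"
        using d zero_ext_sq_int[OF dL] by (intro integral_mono) (auto simp: sq_int_def zero_ext_def indicator_def)
      also have "\<dots> = (norm (a - b))\<^sup>2"
        using norm_abs_l2[OF d] diff_abs_l2[OF rep_l2_sq_int rep_l2_sq_int, of a b] by (simp add: abs_rep_l2)
      finally show ?thesis .
    qed
    then show ?thesis by (simp add: dist_norm)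
  qed
  then show "continuous_on UNIV (\<lambda>a. field_class \<Omega> (rep_l2 a))"
    unfolding continuous_on_iff by (meson le_less_trans)
qed (rule continuous_on_id)

lemma test_function_zero_ext: "\<psi> \<in> test_functions \<Omega> \<Longrightarrow> zero_ext \<Omega> \<psi> = \<psi>"
proof
  fix x assume p: "\<psi> \<in> test_functions \<Omega>"
  have "\<psi> x = 0" if "x \<notin> \<Omega>" using p that by (intro zero_off_support) (auto simp: test_functions_def)
  then show "zero_ext \<Omega> \<psi> x = \<psi> x" by (auto simp: zero_ext_def indicator_def)
qed

lemma test_function_Lp:
  fixes \<psi> :: vfield
  assumes "\<psi> \<in> test_functions \<Omega>" shows "\<psi> \<in> Lp 2 \<Omega>"
proof -
  have "integrable lborel (\<lambda>x. inner (\<psi> x) (\<psi> x))"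
    by (rule test_functions_prod_integrable[OF assms assms])
  moreover have "\<psi> \<in> borel_measurable lborel"
    using test_functions_continuous_on[OF assms] by (simp add: borel_measurable_continuous_onI)
  ultimately have "sq_int \<psi>"
    unfolding sq_int_def power2_norm_eq_inner by (auto intro: integrable_completion[THEN iffD2] measurable_completion)
  then show ?thesis by (simp add: Lp_iff test_function_zero_ext[OF assms])
qed

lemma inner_field_class_test_function:
  assumes "u \<in> Lp 2 \<Omega>" "\<psi> \<in> test_functions \<Omega>"
  shows "inner (field_class \<Omega> u) (field_class \<Omega> \<psi>) = (LINT x|lebesgue. inner (zero_ext \<Omega> u x) (\<psi> x))"
  unfolding field_class_def
  by (subst inner_abs_l2) (use assms test_function_Lp[OF assms(2)] in \<open>auto simp: Lp_iff test_function_zero_ext\<close>)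

lemma inner_test_functions:
  assumes "\<phi> \<in> test_functions \<Omega>" "\<psi> \<in> test_functions \<Omega>"
  shows "inner (field_class \<Omega> \<phi>) (field_class \<Omega> \<psi>) = (LINT x|lborel. inner (\<phi> x) (\<psi> x))"
  unfolding inner_field_class_test_function[OF test_function_Lp[OF assms(1)] assms(2)] test_function_zero_ext[OF assms(1)]
  using test_functions_prod_integrable[OF assms] by (intro integral_completion borel_measurable_integrable)

section \<open>Weak curls\<close>

lemma test_functions_mult_i: "\<psi> \<in> test_functions \<Omega> \<Longrightarrow> (\<lambda>x. mult_i (\<psi> x)) \<in> test_functions \<Omega>"
  by (rule test_functions_linear[OF bounded_linear_mult_i])

lemma field_class_curl_mult_i: "\<psi> \<in> test_functions \<Omega> \<Longrightarrow> field_class \<Omega> (curl (\<lambda>x. mult_i (\<psi> x))) = mult_i_l2 (field_class \<Omega> (curl \<psi>))"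
  using curl_linear[OF _ bounded_linear_mult_i mult_i_unit_cross, of \<psi> \<Omega>]
    field_class_mult_i[OF test_function_Lp[OF test_functions_curl], of \<psi>]
  by (simp add: field_class_def zero_ext_def)

text \<open>The imaginary part of the defining identity is its real part for the test field multiplied by the imaginary unit.\<close>
lemma is_weak_curl_iff:
  assumes "u \<in> Lp 2 \<Omega>" "w \<in> Lp 2 \<Omega>"
  shows "is_weak_curl \<Omega> u w \<longleftrightarrow>
    (\<forall>\<psi>\<in>test_functions \<Omega>. inner (field_class \<Omega> u) (field_class \<Omega> (curl \<psi>)) = inner (field_class \<Omega> w) (field_class \<Omega> \<psi>))" (is "_ \<longleftrightarrow> ?R")
proof
  assume a: "is_weak_curl \<Omega> u w"
  show ?R
  proof
    fix \<psi> :: "real^3 \<Rightarrow> complex^3" assume p: "\<psi> \<in> test_functions \<Omega>"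
    have "L2_inner \<Omega> u (curl \<psi>) = L2_inner \<Omega> w \<psi>" using a p by (simp add: is_weak_curl_def)
    then show "inner (field_class \<Omega> u) (field_class \<Omega> (curl \<psi>)) = inner (field_class \<Omega> w) (field_class \<Omega> \<psi>)"
      using assms p by (simp add: L2_inner_eq test_function_Lp test_functions_curl complex_eq_iff)
  qed
next
  assume R: ?R
  show "is_weak_curl \<Omega> u w" unfolding is_weak_curl_def
  proof
    fix \<psi> :: "real^3 \<Rightarrow> complex^3" assume p: "\<psi> \<in> test_functions \<Omega>"
    show "L2_inner \<Omega> u (curl \<psi>) = L2_inner \<Omega> w \<psi>"
      using R[rule_format, OF p] R[rule_format, OF test_functions_mult_i[OF p]] assms p
      by (simp add: L2_inner_eq test_function_Lp test_functions_curl field_class_curl_mult_i field_class_mult_i)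
  qed
qed

lemma weak_curl_test_function: "\<psi> \<in> test_functions \<Omega> \<Longrightarrow> is_weak_curl \<Omega> \<psi> (curl \<psi>)"
  by (simp add: is_weak_curl_iff test_function_Lp test_functions_curl inner_test_functions curl_symmetric)

lemma orthogonal_test_functions:
  assumes w: "w \<in> Lp 2 \<Omega>" and o: "\<And>\<psi>. \<psi> \<in> test_functions \<Omega> \<Longrightarrow> inner (field_class \<Omega> w) (field_class \<Omega> \<psi>) = 0"
  shows "field_class \<Omega> w = 0"
proof -
  have "AE x in lebesgue. x \<in> \<Omega> \<longrightarrow> zero_ext \<Omega> w x = 0"
    by (rule fundamental_lemma[OF open_\<Omega> zero_ext_sq_int[OF w]]) (use o w in \<open>simp add: inner_field_class_test_function\<close>)
  then have "AE x in lebesgue. zero_ext \<Omega> w x = 0"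
    by eventually_elim (auto simp: zero_ext_def)
  then have "abs_l2 (zero_ext \<Omega> w) = abs_l2 (\<lambda>x. 0)"
    using abs_l2_eq_iff[OF zero_ext_sq_int[OF w] sq_int_0] by simp
  then show ?thesis by (simp add: field_class_def zero_l2_def)
qed

lemma weak_curl_unique:
  assumes "u \<in> Lp 2 \<Omega>" "w \<in> Lp 2 \<Omega>" "is_weak_curl \<Omega> u w" "w' \<in> Lp 2 \<Omega>" "is_weak_curl \<Omega> u w'"
  shows "field_class \<Omega> w = field_class \<Omega> w'"
proof -
  have "field_class \<Omega> (\<lambda>x. w x - w' x) = 0"
    using assms by (intro orthogonal_test_functions Lp_diff) (auto simp: is_weak_curl_iff field_class_diff inner_diff_left)
  then show ?thesis using assms by (simp add: field_class_diff)
qed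

lemma weak_curl_props:
  assumes "u \<in> Lp 2 \<Omega>" "w \<in> Lp 2 \<Omega>" "is_weak_curl \<Omega> u w"
  shows "weak_curl \<Omega> u \<in> Lp 2 \<Omega>" "is_weak_curl \<Omega> u (weak_curl \<Omega> u)" "field_class \<Omega> (weak_curl \<Omega> u) = field_class \<Omega> w"
proof -
  have "weak_curl \<Omega> u \<in> Lp 2 \<Omega> \<and> is_weak_curl \<Omega> u (weak_curl \<Omega> u)"
    unfolding weak_curl_def by (rule someI[of _ w]) (use assms in simp)
  then show 1: "weak_curl \<Omega> u \<in> Lp 2 \<Omega>" "is_weak_curl \<Omega> u (weak_curl \<Omega> u)" by auto
  show "field_class \<Omega> (weak_curl \<Omega> u) = field_class \<Omega> w" by (rule weak_curl_unique[OF assms(1) 1 assms(2,3)])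
qed

lemma H_curl_norm_diff_test_function:
  assumes u: "u \<in> Lp 2 \<Omega>" and w: "w \<in> Lp 2 \<Omega>" "is_weak_curl \<Omega> u w" and p: "\<psi> \<in> test_functions \<Omega>"
  shows "H_curl_norm \<Omega> (\<lambda>x. u x - \<psi> x) = dist (field_class \<Omega> \<psi>, field_class \<Omega> (curl \<psi>)) (field_class \<Omega> u, field_class \<Omega> w)"
proof -
  have L: "\<psi> \<in> Lp 2 \<Omega>" "curl \<psi> \<in> Lp 2 \<Omega>" using p by (auto intro: test_function_Lp test_functions_curl)
  have d: "(\<lambda>x. u x - \<psi> x) \<in> Lp 2 \<Omega>" "(\<lambda>x. w x - curl \<psi> x) \<in> Lp 2 \<Omega>" using u w L by (auto intro: Lp_diff)
  have "is_weak_curl \<Omega> (\<lambda>x. u x - \<psi> x) (\<lambda>x. w x - curl \<psi> x)"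
    using w(2) weak_curl_test_function[OF p] d u w L
    by (simp add: is_weak_curl_iff field_class_diff inner_diff_left)
  note wc = weak_curl_props[OF d this]
  show ?thesis unfolding H_curl_norm_def L2_norm_eq[OF d(1)] L2_norm_eq[OF wc(1)] wc(3)
    using u w L by (simp add: field_class_diff dist_prod_def dist_norm norm_minus_commute)
qed

section \<open>The form domain as a closed subspace\<close>

lemma weak_grad_Lp: "\<xi> \<in> dot_H1_0 \<Omega> \<Longrightarrow> weak_grad \<Omega> \<xi> \<in> Lp 2 \<Omega> \<and> is_weak_grad \<Omega> \<xi> (weak_grad \<Omega> \<xi>)"
proof -
  assume "\<xi> \<in> dot_H1_0 \<Omega>"
  then have "\<exists>g. g \<in> Lp 2 \<Omega> \<and> is_weak_grad \<Omega> \<xi> g" by (auto simp: dot_H1_0_def)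
  then show ?thesis unfolding weak_grad_def by (rule someI_ex)
qed

lemma H_div0_iff: "u \<in> H_div0 \<Omega> \<longleftrightarrow> u \<in> Lp 2 \<Omega> \<and> field_class \<Omega> u \<in> (solenoidal \<Omega>)"
  using weak_grad_Lp by (auto simp: H_div0_def solenoidal_def L2_inner_eq_0_iff)

lemma subspace_test_graph: "subspace (test_graph \<Omega>)"
  unfolding subspace_def
proof (intro conjI ballI allI)
  have "field_class \<Omega> (\<lambda>x. 0) = 0" by (simp add: field_class_def zero_ext_def zero_l2_def)
  moreover have "curl (\<lambda>x. 0) = (\<lambda>x. 0)"
    by (auto simp: curl_def vec_eq_iff forall_3)
  ultimately show "0 \<in> (test_graph \<Omega>)"
    unfolding test_graph_def using test_functions_0 by (intro image_eqI[of _ _ "\<lambda>x. 0"]) (auto simp: zero_prod_def)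
next
  fix p q assume "p \<in> (test_graph \<Omega>)" "q \<in> (test_graph \<Omega>)"
  then obtain \<psi> \<phi> where t: "\<psi> \<in> test_functions \<Omega>" "\<phi> \<in> test_functions \<Omega>"
    and p: "p = (field_class \<Omega> \<psi>, field_class \<Omega> (curl \<psi>))" and q: "q = (field_class \<Omega> \<phi>, field_class \<Omega> (curl \<phi>))"
    by (auto simp: test_graph_def)
  have c: "curl (\<lambda>x. \<psi> x + \<phi> x) = (\<lambda>x. curl \<psi> x + curl \<phi> x)" using curl_add[OF t] by blast
  show "p + q \<in> (test_graph \<Omega>)" unfolding test_graph_def p q
    using test_functions_add[OF t] t
    by (intro image_eqI[of _ _ "\<lambda>x. \<psi> x + \<phi> x"]) (simp_all add: c field_class_add test_function_Lp test_functions_curl)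
next
  fix r p assume "p \<in> (test_graph \<Omega>)"
  then obtain \<psi> where t: "\<psi> \<in> test_functions \<Omega>" and p: "p = (field_class \<Omega> \<psi>, field_class \<Omega> (curl \<psi>))"
    by (auto simp: test_graph_def)
  have c: "curl (\<lambda>x. r *\<^sub>R \<psi> x) = (\<lambda>x. r *\<^sub>R curl \<psi> x)"
    by (rule ext, rule curl_linear[OF t bounded_linear_scaleR_right])
      (simp add: linear_cmul[OF bounded_linear.linear[OF bounded_linear_unit_cross]])
  show "r *\<^sub>R p \<in> (test_graph \<Omega>)" unfolding test_graph_def p
    using test_functions_scaleR[OF t, of r] t
    by (intro image_eqI[of _ _ "\<lambda>x. r *\<^sub>R \<psi> x"]) (simp_all add: c field_class_scaleR test_function_Lp test_functions_curl)
qed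

lemma subspace_closure:
  fixes S :: "'k::real_normed_vector set" assumes S: "subspace S" shows "subspace (closure S)"
  unfolding subspace_def
proof (intro conjI ballI allI)
  show "0 \<in> closure S" using subspace_0[OF S] closure_subset by blast
next
  fix x y assume "x \<in> closure S" "y \<in> closure S"
  then obtain f g where "\<And>n. f n \<in> S" "f \<longlonglongrightarrow> x" "\<And>n. g n \<in> S" "g \<longlonglongrightarrow> y"
    unfolding closure_sequential by blast
  then show "x + y \<in> closure S" unfolding closure_sequential
    using subspace_add[OF S] tendsto_add by (intro exI[of _ "\<lambda>n. f n + g n"]) auto
next
  fix c x assume "x \<in> closure S"
  then obtain f where "\<And>n. f n \<in> S" "f \<longlonglongrightarrow> x" unfolding closure_sequential by blast
  then show "c *\<^sub>R x \<in> closure S" unfolding closure_sequential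
    using subspace_scale[OF S] by (intro exI[of _ "\<lambda>n. c *\<^sub>R f n"]) (auto intro!: tendsto_intros)
qed

lemma subspace_form_graph: "subspace (form_graph \<Omega>)"
proof -
  have "subspace {p :: l2 \<times> l2. fst p \<in> (solenoidal \<Omega>)}"
    by (auto simp: subspace_def solenoidal_def inner_add_left)
  then show ?thesis unfolding form_graph_def
    by (intro subspace_inter subspace_closure subspace_test_graph)
qed

lemma closed_form_graph: "closed (form_graph \<Omega>)"
proof -
  have "{p :: l2 \<times> l2. fst p \<in> (solenoidal \<Omega>)} =
     (\<Inter>\<xi>\<in>dot_H1_0 \<Omega>. {p. inner (fst p) (field_class \<Omega> (weak_grad \<Omega> \<xi>)) = 0} \<inter> {p. inner (fst p) (mult_i_l2 (field_class \<Omega> (weak_grad \<Omega> \<xi>))) = 0})"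
    by (auto simp: solenoidal_def)
  moreover have "closed \<dots>"
    by (intro closed_INT ballI closed_Int closed_Collect_eq continuous_intros)
  ultimately show ?thesis unfolding form_graph_def by (intro closed_Int closed_closure) simp
qed

lemma form_graph_mult_i:
  assumes "(a, b) \<in> (form_graph \<Omega>)" shows "(mult_i_l2 a, mult_i_l2 b) \<in> (form_graph \<Omega>)"
proof -
  let ?J = "\<lambda>p :: l2 \<times> l2. (mult_i_l2 (fst p), mult_i_l2 (snd p))"
  have "?J ` (test_graph \<Omega>) \<subseteq> (test_graph \<Omega>)"
  proof
    fix q assume "q \<in> ?J ` (test_graph \<Omega>)"
    then obtain \<psi> where t: "\<psi> \<in> test_functions \<Omega>" and q: "q = ?J (field_class \<Omega> \<psi>, field_class \<Omega> (curl \<psi>))"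
      by (auto simp: test_graph_def)
    show "q \<in> (test_graph \<Omega>)" unfolding test_graph_def q using t
      by (intro image_eqI[of _ _ "\<lambda>x. mult_i (\<psi> x)"])
        (simp_all add: field_class_mult_i field_class_curl_mult_i test_function_Lp test_functions_mult_i)
  qed
  then have "?J ` closure (test_graph \<Omega>) \<subseteq> closure (test_graph \<Omega>)"
    using closure_subset by (intro image_closure_subset)
      (force intro!: continuous_intros continuous_on_compose2[OF mult_i_l2_continuous])+
  moreover have "mult_i_l2 a \<in> (solenoidal \<Omega>)" using assms
    by (auto simp: form_graph_def solenoidal_def inner_mult_i_l2 mult_i_mult_i_l2)
  ultimately show ?thesis using assms by (force simp: form_graph_def)
qed

lemma X_N0_form_graph:
  assumes "u \<in> X_N0 \<Omega>"
  shows "u \<in> Lp 2 \<Omega>" "weak_curl \<Omega> u \<in> Lp 2 \<Omega>" "(field_class \<Omega> u, field_class \<Omega> (weak_curl \<Omega> u)) \<in> (form_graph \<Omega>)"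
proof -
  from assms obtain w where u: "u \<in> Lp 2 \<Omega>" and w: "w \<in> Lp 2 \<Omega>" "is_weak_curl \<Omega> u w"
    and ap: "\<And>e. e > 0 \<Longrightarrow> \<exists>\<psi>\<in>test_functions \<Omega>. H_curl_norm \<Omega> (\<lambda>x. u x - \<psi> x) < e"
    and dv: "u \<in> H_div0 \<Omega>"
    by (auto simp: X_N0_def H0_curl_def H_curl_def)
  note wc = weak_curl_props[OF u w]
  show "u \<in> Lp 2 \<Omega>" "weak_curl \<Omega> u \<in> Lp 2 \<Omega>" using u wc by auto
  have "(field_class \<Omega> u, field_class \<Omega> (weak_curl \<Omega> u)) \<in> closure (test_graph \<Omega>)"
    unfolding closure_approachable
  proof (intro allI impI)
    fix e :: real assume "0 < e"
    then obtain \<psi> where p: "\<psi> \<in> test_functions \<Omega>" "H_curl_norm \<Omega> (\<lambda>x. u x - \<psi> x) < e" using ap by blast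
    then show "\<exists>y\<in>(test_graph \<Omega>). dist y (field_class \<Omega> u, field_class \<Omega> (weak_curl \<Omega> u)) < e"
      unfolding H_curl_norm_diff_test_function[OF u wc(1,2) p(1)] test_graph_def by blast
  qed
  then show "(field_class \<Omega> u, field_class \<Omega> (weak_curl \<Omega> u)) \<in> (form_graph \<Omega>)"
    using dv by (simp add: form_graph_def H_div0_iff)
qed

text \<open>Every condition defining the weak curl is a closed linear condition on the pair, satisfied on \<open>test_graph \<Omega>\<close> by
\<open>curl_symmetric\<close> and hence on its closure.\<close>
lemma form_graph_X_N0:
  assumes ab: "(a, b) \<in> (form_graph \<Omega>)"
  obtains u where "u \<in> X_N0 \<Omega>" "field_class \<Omega> u = a" "field_class \<Omega> (weak_curl \<Omega> u) = b"
proof -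
  have cl: "(a, b) \<in> closure (test_graph \<Omega>)" and so: "a \<in> (solenoidal \<Omega>)" using ab by (auto simp: form_graph_def)
  define u w where "u = rep_l2 a" and "w = rep_l2 b"
  have u: "u \<in> Lp 2 \<Omega>" and w: "w \<in> Lp 2 \<Omega>" by (simp_all add: u_def w_def rep_in_Lp)
  have "closed ({a. field_class \<Omega> (rep_l2 a) = a} \<times> {a. field_class \<Omega> (rep_l2 a) = a})" by (intro closed_Times closed_field_class_range)
  moreover have "(test_graph \<Omega>) \<subseteq> {a. field_class \<Omega> (rep_l2 a) = a} \<times> {a. field_class \<Omega> (rep_l2 a) = a}"
    by (auto simp: test_graph_def field_class_rep_cls test_function_Lp test_functions_curl)
  ultimately have "closure (test_graph \<Omega>) \<subseteq> {a. field_class \<Omega> (rep_l2 a) = a} \<times> {a. field_class \<Omega> (rep_l2 a) = a}"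
    by (intro closure_minimal)
  then have ua: "field_class \<Omega> u = a" and wb: "field_class \<Omega> w = b" using cl by (auto simp: u_def w_def)
  define W where "W = (\<Inter>\<psi>\<in>test_functions \<Omega>. {p :: l2 \<times> l2. inner (fst p) (field_class \<Omega> (curl \<psi>)) = inner (snd p) (field_class \<Omega> \<psi>)})"
  have "closed W" unfolding W_def by (intro closed_INT ballI closed_Collect_eq continuous_intros)
  moreover have "(test_graph \<Omega>) \<subseteq> W"
    by (auto simp: W_def test_graph_def inner_test_functions test_functions_curl curl_symmetric)
  ultimately have "closure (test_graph \<Omega>) \<subseteq> W" by (intro closure_minimal)
  then have "(a, b) \<in> W" using cl by blast
  then have wc0: "is_weak_curl \<Omega> u w" by (auto simp: is_weak_curl_iff u w ua wb W_def)
  note wc = weak_curl_props[OF u w wc0]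
  have "\<exists>\<psi>\<in>test_functions \<Omega>. H_curl_norm \<Omega> (\<lambda>x. u x - \<psi> x) < e" if e: "e > 0" for e
  proof -
    obtain y where "y \<in> (test_graph \<Omega>)" and y: "dist y (a, b) < e"
      using cl e unfolding closure_approachable by blast
    then obtain \<psi> where p: "\<psi> \<in> test_functions \<Omega>" "y = (field_class \<Omega> \<psi>, field_class \<Omega> (curl \<psi>))"
      by (auto simp: test_graph_def)
    then show ?thesis
      using H_curl_norm_diff_test_function[OF u w wc0 p(1)] y by (intro bexI[of _ \<psi>]) (simp_all add: ua wb)
  qed
  then have "u \<in> X_N0 \<Omega>"
    using u w wc0 so by (auto simp: X_N0_def H0_curl_def H_curl_def H_div0_iff ua)
  then show ?thesis using that ua wb wc(3) by simp
qed

end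

section \<open>Divergence-free test fields\<close>
lemma lebesgue_on_integrable:
  fixes f :: "real^3 \<Rightarrow> 'b::{banach, second_countable_topology}"
  assumes "open \<Omega>" "integrable lborel f"
  shows "integrable (lebesgue_on \<Omega>) f"
proof -
  have "integrable lebesgue f" using assms(2) integrable_completion[OF borel_measurable_integrable[OF assms(2)]] by simp
  then show ?thesis using sets_\<Omega>[OF assms(1)]
    by (simp add: integrable_restrict_space integrable_mult_indicator set_integrable_def)
qed

lemma test_function_measurable:
  fixes \<phi> :: "real^3 \<Rightarrow> 'b::euclidean_space"
  assumes "\<phi> \<in> test_functions \<Omega>'" shows "\<phi> \<in> borel_measurable (lebesgue_on \<Omega>)"
proof -
  have "\<phi> \<in> borel_measurable lborel" using test_functions_continuous_on[OF assms] by (simp add: borel_measurable_continuous_onI)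
  then show ?thesis by (intro measurable_restrict_space1 measurable_completion)
qed

lemma L2_times_test_function_integrable:
  fixes \<phi> :: "real^3 \<Rightarrow> complex"
  assumes \<Omega>: "open \<Omega>" and v: "v \<in> Lp 2 \<Omega>" and p: "\<phi> \<in> test_functions \<Omega>'"
  shows "integrable (lebesgue_on \<Omega>) (\<lambda>x. v x $ i * \<phi> x)"
proof (rule Bochner_Integration.integrable_bound)
  have "integrable lborel (\<lambda>x. (norm (\<phi> x))\<^sup>2)"
    using test_functions_prod_integrable[OF p p] by (simp add: power2_norm_eq_inner)
  then have "integrable (lebesgue_on \<Omega>) (\<lambda>x. (norm (\<phi> x))\<^sup>2)" by (rule lebesgue_on_integrable[OF \<Omega>])
  moreover have "integrable (lebesgue_on \<Omega>) (\<lambda>x. (norm (v x))\<^sup>2)" using v by (simp add: Lp_def)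
  ultimately show "integrable (lebesgue_on \<Omega>) (\<lambda>x. (norm (v x))\<^sup>2 + (norm (\<phi> x))\<^sup>2)"
    by (intro Bochner_Integration.integrable_add)
  have "\<phi> \<in> borel_measurable (lebesgue_on \<Omega>)"
    by (rule test_function_measurable[OF p])
  moreover have "(\<lambda>x. v x $ i) \<in> borel_measurable (lebesgue_on \<Omega>)"
    using v by (intro measurable_compose[OF _ borel_measurable_continuous_onI[OF linear_continuous_on[OF bounded_linear_vec_nth]]]) (auto simp: Lp_def)
  ultimately show "(\<lambda>x. v x $ i * \<phi> x) \<in> borel_measurable (lebesgue_on \<Omega>)" by measurable
  show "AE x in lebesgue_on \<Omega>. norm (v x $ i * \<phi> x) \<le> norm ((norm (v x))\<^sup>2 + (norm (\<phi> x))\<^sup>2)"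
  proof (rule AE_I2)
    fix x
    have "norm (v x $ i * \<phi> x) \<le> norm (v x) * norm (\<phi> x)"
      unfolding norm_mult by (intro mult_right_mono Finite_Cartesian_Product.norm_nth_le) simp
    also have "\<dots> \<le> (norm (v x))\<^sup>2 + (norm (\<phi> x))\<^sup>2"
      using sum_squares_bound[of "norm (v x)" "norm (\<phi> x)"]
        mult_nonneg_nonneg[OF norm_ge_zero[of "v x"] norm_ge_zero[of "\<phi> x"]] by linarith
    finally show "norm (v x $ i * \<phi> x) \<le> norm ((norm (v x))\<^sup>2 + (norm (\<phi> x))\<^sup>2)" by simp
  qed
qed

lemma test_function_bounded:
  fixes \<phi> :: "real^3 \<Rightarrow> 'b::euclidean_space"
  assumes "\<phi> \<in> test_functions \<Omega>" obtains C where "C \<ge> 0" "\<And>x. norm (\<phi> x) \<le> C"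
proof -
  have "compact (\<phi> ` closure {x. \<phi> x \<noteq> 0})"
    by (intro compact_continuous_image test_functions_continuous_on[OF assms] test_functions_compact_support[OF assms])
  then obtain C where C: "C > 0" "\<And>y. y \<in> \<phi> ` closure {x. \<phi> x \<noteq> 0} \<Longrightarrow> norm y \<le> C"
    using compact_imp_bounded bounded_pos by metis
  have "norm (\<phi> x) \<le> C" for x
    using C zero_off_support[of x \<phi>] by (cases "x \<in> closure {x. \<phi> x \<noteq> 0}") auto
  then show ?thesis using that[of C] C(1) by simp
qed

text \<open>Uses \<open>t \<le> t\<^sup>6 + 1\<close> and the boundedness of the test function.\<close>
lemma L6_times_test_function_integrable:
  fixes \<phi> \<xi> :: "real^3 \<Rightarrow> complex"
  assumes \<Omega>: "open \<Omega>" and v: "\<xi> \<in> Lp 6 \<Omega>" and p: "\<phi> \<in> test_functions \<Omega>'"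
  shows "integrable (lebesgue_on \<Omega>) (\<lambda>x. \<xi> x * \<phi> x)"
proof -
  obtain C where C: "C \<ge> 0" "\<And>x. norm (\<phi> x) \<le> C" using test_function_bounded[OF p] by blast
  show ?thesis
  proof (rule Bochner_Integration.integrable_bound)
    have "integrable lborel \<phi>"
      by (rule continuous_compact_support_integrable[OF test_functions_continuous_on[OF p] test_functions_compact_support[OF p]])
        (rule zero_off_support)
    then have "integrable (lebesgue_on \<Omega>) \<phi>" by (rule lebesgue_on_integrable[OF \<Omega>])
    moreover have "integrable (lebesgue_on \<Omega>) (\<lambda>x. norm (\<xi> x) ^ 6)" using v by (simp add: Lp_def)
    ultimately show "integrable (lebesgue_on \<Omega>) (\<lambda>x. C * norm (\<xi> x) ^ 6 + norm (\<phi> x))"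
      by (intro Bochner_Integration.integrable_add integrable_norm integrable_mult_right)
    show "(\<lambda>x. \<xi> x * \<phi> x) \<in> borel_measurable (lebesgue_on \<Omega>)"
      using test_function_measurable[OF p] v by (auto simp: Lp_def)
    show "AE x in lebesgue_on \<Omega>. norm (\<xi> x * \<phi> x) \<le> norm (C * norm (\<xi> x) ^ 6 + norm (\<phi> x))"
    proof (rule AE_I2)
      fix x
      have t: "t \<le> t ^ 6 + 1" if "t \<ge> 0" for t :: real
      proof (cases "t \<ge> 1")
        case True then show ?thesis using power_increasing[of 1 6 t] by simp
      next
        case False then show ?thesis using that zero_le_power[OF that, of 6] by linarith
      qed
      have "norm (\<xi> x * \<phi> x) \<le> (norm (\<xi> x) ^ 6 + 1) * norm (\<phi> x)"
        unfolding norm_mult by (intro mult_right_mono t) auto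
      also have "\<dots> \<le> C * norm (\<xi> x) ^ 6 + norm (\<phi> x)"
        using mult_left_mono[OF C(2)[of x], of "norm (\<xi> x) ^ 6"] by (simp add: algebra_simps)
      finally show "norm (\<xi> x * \<phi> x) \<le> norm (C * norm (\<xi> x) ^ 6 + norm (\<phi> x))" using C(1) by simp
    qed
  qed
qed

text \<open>The components of \<open>u\<close> are admissible in the definition of the weak gradient, which moves the derivatives from \<open>\<xi>\<close> to \<open>u\<close> and
produces its divergence. Real components make the conjugation in the Hermitian product harmless.\<close>
lemma divergence_free_test_field:
  assumes \<Omega>: "open \<Omega>" and u: "u \<in> test_functions \<Omega>"
    and real: "\<And>x i. cnj (u x $ i) = u x $ i"
    and div: "\<And>x. (\<Sum>i\<in>UNIV. partial_deriv i u x $ i) = 0"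
  shows "u \<in> H_div0 \<Omega>"
proof -
  have "L2_inner \<Omega> u (weak_grad \<Omega> \<xi>) = 0" if \<xi>: "\<xi> \<in> dot_H1_0 \<Omega>" for \<xi>
  proof -
    define v where "v = weak_grad \<Omega> \<xi>"
    have v: "v \<in> Lp 2 \<Omega>" and wg: "is_weak_grad \<Omega> \<xi> v" using weak_grad_Lp[OF \<Omega> \<xi>] by (auto simp: v_def)
    have x6: "\<xi> \<in> Lp 6 \<Omega>" using \<xi> by (simp add: dot_H1_0_def)
    have ui: "(\<lambda>x. u x $ i) \<in> test_functions \<Omega>" for i
      by (rule test_functions_linear[OF bounded_linear_vec_nth u])
    have pd: "partial_deriv i (\<lambda>x. u x $ i) x = partial_deriv i u x $ i" for i x
      by (rule partial_deriv_linear[OF test_functions_differentiable[OF u] bounded_linear_vec_nth])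
    have pt: "(\<lambda>x. partial_deriv i u x $ i) \<in> test_functions \<Omega>" for i
      by (rule test_functions_linear[OF bounded_linear_vec_nth test_functions_partial_deriv[OF u]])
    have h: "hermitian (u x) (v x) = cnj (\<Sum>i\<in>UNIV. v x $ i * u x $ i)" for x
      by (simp add: hermitian_def real mult.commute)
    have "L2_inner \<Omega> u v = cnj (LINT x|lebesgue_on \<Omega>. (\<Sum>i\<in>UNIV. v x $ i * u x $ i))"
      unfolding L2_inner_def h by (rule Bochner_Integration.integral_cnj)
    also have "(LINT x|lebesgue_on \<Omega>. (\<Sum>i\<in>UNIV. v x $ i * u x $ i)) = (\<Sum>i\<in>UNIV. LINT x|lebesgue_on \<Omega>. v x $ i * u x $ i)"
      by (intro Bochner_Integration.integral_sum L2_times_test_function_integrable[OF \<Omega> v ui])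
    also have "\<dots> = (\<Sum>i\<in>UNIV. - (LINT x|lebesgue_on \<Omega>. \<xi> x * partial_deriv i u x $ i))"
      using wg ui unfolding is_weak_grad_def by (intro sum.cong refl) (simp flip: pd)
    also have "\<dots> = - (LINT x|lebesgue_on \<Omega>. (\<Sum>i\<in>UNIV. \<xi> x * partial_deriv i u x $ i))"
      unfolding sum_negf
      by (subst Bochner_Integration.integral_sum) (auto intro: L6_times_test_function_integrable[OF \<Omega> x6 pt])
    also have "\<dots> = 0" by (simp add: sum_distrib_left[symmetric] div)
    finally show ?thesis by (simp add: v_def)
  qed
  then show ?thesis using test_function_Lp[OF \<Omega> u] by (simp add: H_div0_def)
qed

section \<open>Orthonormal fields in disjoint balls\<close>
definition model_ratio :: real where
  "model_ratio = (LINT x|lborel. (norm (curl model_field x))\<^sup>2) / (LINT x|lborel. (norm (model_field x))\<^sup>2)"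

lemma model_ratio_nonneg: "0 \<le> model_ratio"
  unfolding model_ratio_def by (intro divide_nonneg_nonneg integral_nonneg) auto

definition admissible_radius :: "(real^3) set \<Rightarrow> real \<Rightarrow> bool" where
  "admissible_radius \<Omega> r \<longleftrightarrow> 0 < r \<and> (\<exists>x :: nat \<Rightarrow> real^3.
     disjoint_family (\<lambda>j. ball (x j) r) \<and> (\<forall>j. ball (x j) r \<subseteq> \<Omega>))"

lemma orthonormal_ball_fields:
  assumes \<Omega>: "open \<Omega>" and r: "admissible_radius \<Omega> r"
  obtains \<phi> \<omega> :: "nat \<Rightarrow> l2" where "\<And>n. (\<phi> n, \<omega> n) \<in> form_graph \<Omega>"
    "\<And>i j. inner (\<phi> i) (\<phi> j) = (if i = j then 1 else 0)" "\<And>n. (norm (\<omega> n))\<^sup>2 \<le> model_ratio / r\<^sup>2"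
proof -
  from r obtain a :: "nat \<Rightarrow> real^3" where r0: "0 < r" and dis: "disjoint_family (\<lambda>j. ball (a j) r)" and sub: "\<And>j. ball (a j) r \<subseteq> \<Omega>"
    by (auto simp: admissible_radius_def)
  let ?W = "\<lambda>j. ball_field (a j) r"
  define A where "A = (LINT x|lborel. (norm (model_field x))\<^sup>2)"
  define B where "B = (LINT x|lborel. (norm (curl model_field x))\<^sup>2)"
  have A: "A > 0" unfolding A_def by (rule model_field_norm_pos)
  have W: "?W j \<in> test_functions \<Omega>" for j by (rule ball_field_test[OF r0 sub])
  define c where "c = 1 / sqrt (r ^ 3 * A)"
  have c2: "c\<^sup>2 = 1 / (r ^ 3 * A)" using r0 A by (simp add: c_def power_divide)
  have g: "(field_class \<Omega> (?W j), field_class \<Omega> (curl (?W j))) \<in> form_graph \<Omega>" for j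
  proof -
    have "(field_class \<Omega> (?W j), field_class \<Omega> (curl (?W j))) \<in> test_graph \<Omega>"
      using W by (auto simp: test_graph_def)
    moreover have "?W j \<in> H_div0 \<Omega>"
      by (rule divergence_free_test_field[OF \<Omega> W ball_field_real ball_field_divergence_free])
    ultimately show ?thesis using closure_subset by (auto simp: form_graph_def H_div0_iff[OF \<Omega>])
  qed
  have n1: "inner (field_class \<Omega> (?W j)) (field_class \<Omega> (?W j)) = r ^ 3 * A" for j
    using ball_field_norms(1)[OF r0, of "a j"]
    by (simp add: inner_test_functions[OF \<Omega> W W] A_def power2_norm_eq_inner)
  have n2: "(norm (field_class \<Omega> (curl (?W j))))\<^sup>2 = r ^ 3 * (B / r\<^sup>2)" for j
    using ball_field_norms(2)[OF r0, of "a j"]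
    by (simp add: power2_norm_eq_inner inner_test_functions[OF \<Omega> test_functions_curl[OF W] test_functions_curl[OF W]] B_def)
  have n0: "inner (field_class \<Omega> (?W i)) (field_class \<Omega> (?W j)) = 0" if "i \<noteq> j" for i j
  proof -
    have "ball (a i) r \<inter> ball (a j) r = {}" using dis that by (auto simp: disjoint_family_on_def)
    then have "inner (?W i x) (?W j x) = 0" for x
      using scaled_cube_subset_ball[OF r0 ball_field_off_ball[OF r0, of "a i" x]]
        scaled_cube_subset_ball[OF r0 ball_field_off_ball[OF r0, of "a j" x]]
      by (metis disjoint_iff inner_zero_left inner_zero_right)
    then show ?thesis by (simp add: inner_test_functions[OF \<Omega> W W])
  qed
  show ?thesis
  proof (rule that[of "\<lambda>j. c *\<^sub>R field_class \<Omega> (?W j)" "\<lambda>j. c *\<^sub>R field_class \<Omega> (curl (?W j))"])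
    show "(c *\<^sub>R field_class \<Omega> (?W j), c *\<^sub>R field_class \<Omega> (curl (?W j))) \<in> form_graph \<Omega>" for j
      using subspace_scale[OF subspace_form_graph[OF \<Omega>] g[of j], of c] by simp
    show "inner (c *\<^sub>R field_class \<Omega> (?W i)) (c *\<^sub>R field_class \<Omega> (?W j)) = (if i = j then 1 else 0)" for i j
    proof (cases "i = j")
      case True
      have "inner (c *\<^sub>R field_class \<Omega> (?W i)) (c *\<^sub>R field_class \<Omega> (?W i)) = c\<^sup>2 * (r ^ 3 * A)"
        by (simp add: n1 power2_eq_square)
      also have "\<dots> = 1" unfolding c2 using A r0 by simp
      finally show ?thesis using True by simp
    qed (simp add: n0)
    show "(norm (c *\<^sub>R field_class \<Omega> (curl (?W j))))\<^sup>2 \<le> model_ratio / r\<^sup>2" for j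
      using A r0 by (simp add: power_mult_distrib n2 c2 model_ratio_def A_def[symmetric] B_def[symmetric])
  qed
qed

section \<open>The essential spectrum of the Maxwell operator\<close>
lemma complex_scale_eq: "(\<chi> i. z * v $ i) = Re z *\<^sub>R v + Im z *\<^sub>R mult_i v"
  by (simp add: vec_eq_iff mult_i_def complex_eq_iff algebra_simps)

lemma inner_mult_i_l2_self: "inner a (mult_i_l2 a) = 0"
  using inner_mult_i_l2[of a a] by (simp add: inner_commute)

text \<open>Pairing \<open>f n - z u n\<close> with \<open>u n\<close> and with \<open>\<i> u n\<close>, and using the form identity with \<open>u n\<close> itself as the test
field, gives \<open>\<parallel>w n\<parallel>\<^sup>2 - Re z\<close> and \<open>- Im z\<close>; both pairings tend to zero.\<close>
lemma essential_spectrum_lower_bound: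
  assumes \<Omega>: "open \<Omega>" and z: "z \<in> maxwell_essential_spectrum \<Omega>"
  obtains c w where "\<And>n. (c n, w n) \<in> form_graph \<Omega>" "\<And>n. norm (c n) = 1"
    "\<And>x. x \<in> fst ` form_graph \<Omega> \<Longrightarrow> (\<lambda>n. inner (c n) x) \<longlonglongrightarrow> 0"
    "(\<lambda>n. (norm (w n))\<^sup>2) \<longlonglongrightarrow> Re z" "Im z = 0"
proof -
  from z obtain u f where mx: "\<And>n. (u n, f n) \<in> maxwell \<Omega>" and u1: "\<And>n. L2_norm \<Omega> (u n) = 1"
    and wn: "weakly_null \<Omega> u"
    and lim: "(\<lambda>n. L2_norm \<Omega> (\<lambda>x. f n x - (\<chi> i. z * u n x $ i))) \<longlonglongrightarrow> 0"
    by (auto simp: maxwell_essential_spectrum_def)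
  have uX: "u n \<in> X_N0 \<Omega>" and fH: "f n \<in> H_div0 \<Omega>"
    and eq: "maxwell_form \<Omega> (u n) (u n) = L2_inner \<Omega> (f n) (u n)" for n
    using mx[of n] by (auto simp: maxwell_def)
  note g = X_N0_form_graph[OF \<Omega> uX]
  have fL: "f n \<in> Lp 2 \<Omega>" for n using fH by (simp add: H_div0_iff[OF \<Omega>])
  define c w h where "c n = field_class \<Omega> (u n)" and "w n = field_class \<Omega> (weak_curl \<Omega> (u n))" and "h n = field_class \<Omega> (f n)" for n
  have c1: "norm (c n) = 1" for n using u1[of n] L2_norm_eq[OF \<Omega> g(1)] by (simp add: c_def)
  have Jc1: "norm (mult_i_l2 (c n)) = 1" for n by (simp add: norm_mult_i_l2 c1)
  have hc: "inner (h n) (c n) = (norm (w n))\<^sup>2" "inner (h n) (mult_i_l2 (c n)) = 0" for n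
    using eq[of n] unfolding maxwell_form_def
    by (simp_all add: L2_inner_eq[OF \<Omega> g(2) g(2)] L2_inner_eq[OF \<Omega> fL g(1)] complex_eq_iff c_def w_def h_def
        inner_mult_i_l2_self power2_norm_eq_inner)
  define q where "q n = h n - (Re z *\<^sub>R c n + Im z *\<^sub>R mult_i_l2 (c n))" for n
  have q0: "(\<lambda>n. norm (q n)) \<longlonglongrightarrow> 0"
  proof -
    have s: "(\<lambda>x. Re z *\<^sub>R u n x + Im z *\<^sub>R mult_i (u n x)) \<in> Lp 2 \<Omega>" for n
      by (intro Lp_add Lp_scaleR Lp_mult_i g \<Omega>)
    have "L2_norm \<Omega> (\<lambda>x. f n x - (\<chi> i. z * u n x $ i)) = norm (q n)" for n
      unfolding complex_scale_eq L2_norm_eq[OF \<Omega> Lp_diff[OF \<Omega> fL s]] field_class_diff[OF \<Omega> fL s]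
      by (simp add: q_def h_def c_def field_class_add[OF \<Omega>] field_class_scaleR[OF \<Omega>] field_class_mult_i[OF \<Omega>] g Lp_scaleR[OF \<Omega>] Lp_mult_i[OF \<Omega>])
    then show ?thesis using lim by simp
  qed
  have tz: "(\<lambda>n. inner (q n) (d n)) \<longlonglongrightarrow> 0" if "\<And>n. norm (d n) = 1" for d
    by (rule tendsto_0_le[OF q0, where K=1])
      (use Cauchy_Schwarz_ineq2[of "q _" "d _"] that in \<open>auto intro!: always_eventually\<close>)
  have 1: "inner (q n) (c n) = (norm (w n))\<^sup>2 - Re z" for n
    using c1[of n] by (simp add: q_def inner_diff_left inner_add_left hc inner_mult_i_l2 inner_mult_i_l2_self norm_eq_1)
  have 2: "inner (q n) (mult_i_l2 (c n)) = - Im z" for n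
    using Jc1[of n] by (simp add: q_def inner_diff_left inner_add_left hc inner_mult_i_l2_self norm_eq_1)
  have "Im z = 0" using tz[of "\<lambda>n. mult_i_l2 (c n)", OF Jc1] unfolding 2 by (simp add: LIMSEQ_const_iff)
  moreover have "(\<lambda>n. (norm (w n))\<^sup>2) \<longlonglongrightarrow> Re z"
    using tz[of c, OF c1] unfolding 1 by (rule LIM_zero_cancel)
  moreover have "(\<lambda>n. inner (c n) x) \<longlonglongrightarrow> 0" if x: "x \<in> fst ` form_graph \<Omega>" for x
  proof -
    from x obtain b where "(x, b) \<in> form_graph \<Omega>" by force
    then obtain v where v: "v \<in> X_N0 \<Omega>" "field_class \<Omega> v = x" using form_graph_X_N0[OF \<Omega>] by metis
    then have "(\<lambda>n. L2_inner \<Omega> (u n) v) \<longlonglongrightarrow> 0" using wn by (simp add: weakly_null_def X_N0_def)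
    from tendsto_Re[OF this] show ?thesis
      using X_N0_form_graph(1)[OF \<Omega> v(1)] by (simp add: L2_inner_eq[OF \<Omega> g(1)] c_def v(2))
  qed
  moreover have "(c n, w n) \<in> form_graph \<Omega>" for n using g(3) by (simp add: c_def w_def)
  ultimately show ?thesis using that c1 by blast
qed

text \<open>The abstract singular sequence is represented by fields. Its weak equation is real; the imaginary
part of the Hermitian one follows by testing with fields multiplied by the imaginary unit, which stay in the form domain.\<close>
lemma essential_spectrum_member:
  assumes \<Omega>: "open \<Omega>" and g: "\<And>n. (v n, w n) \<in> form_graph \<Omega>" and f: "\<And>n. f n \<in> fst ` form_graph \<Omega>"
    and v1: "\<And>n. norm (v n) = 1" and vn: "\<And>x. (\<lambda>n. inner (v n) x) \<longlonglongrightarrow> 0"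
    and weak: "\<And>n x z. (x, z) \<in> form_graph \<Omega> \<Longrightarrow> inner (w n) z = inner (f n) x"
    and lim: "(\<lambda>n. norm (f n - \<mu> *\<^sub>R v n)) \<longlonglongrightarrow> 0"
  shows "complex_of_real \<mu> \<in> maxwell_essential_spectrum \<Omega>"
proof -
  have "\<exists>u. u \<in> X_N0 \<Omega> \<and> field_class \<Omega> u = v n \<and> field_class \<Omega> (weak_curl \<Omega> u) = w n" for n
    using form_graph_X_N0[OF \<Omega> g] by metis
  then obtain u where u: "\<And>n. u n \<in> X_N0 \<Omega>" "\<And>n. field_class \<Omega> (u n) = v n" "\<And>n. field_class \<Omega> (weak_curl \<Omega> (u n)) = w n"
    by metis
  have "\<exists>h. h \<in> X_N0 \<Omega> \<and> field_class \<Omega> h = f n" for n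
  proof -
    obtain b where "(f n, b) \<in> form_graph \<Omega>" using f[of n] by force
    then show ?thesis using form_graph_X_N0[OF \<Omega>] by metis
  qed
  then obtain h where h: "\<And>n. h n \<in> X_N0 \<Omega>" "\<And>n. field_class \<Omega> (h n) = f n" by metis
  note uL = X_N0_form_graph[OF \<Omega> u(1)] and hL = X_N0_form_graph(1)[OF \<Omega> h(1)]
  have "(u n, h n) \<in> maxwell \<Omega>" for n
    unfolding maxwell_def
  proof (intro CollectI case_prodI conjI ballI)
    show "u n \<in> X_N0 \<Omega>" by (rule u)
    show "h n \<in> H_div0 \<Omega>" using h(1)[of n] by (simp add: X_N0_def)
    fix y assume "y \<in> X_N0 \<Omega>"
    note y = X_N0_form_graph[OF \<Omega> this]
    show "maxwell_form \<Omega> (u n) y = L2_inner \<Omega> (h n) y"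
      unfolding maxwell_form_def L2_inner_eq[OF \<Omega> uL(2) y(2)] L2_inner_eq[OF \<Omega> hL y(1)]
      using weak[OF y(3), of n] weak[OF form_graph_mult_i[OF \<Omega> y(3)], of n] by (simp add: u h)
  qed
  moreover have "L2_norm \<Omega> (u n) = 1" for n using L2_norm_eq[OF \<Omega> uL(1), of n] by (simp add: u v1)
  moreover have "weakly_null \<Omega> u" unfolding weakly_null_def
  proof
    fix y assume "y \<in> H_div0 \<Omega>"
    then have y: "y \<in> Lp 2 \<Omega>" by (simp add: H_div0_def)
    have "(\<lambda>n. complex_of_real (inner (v n) (field_class \<Omega> y)) + \<i> * complex_of_real (inner (v n) (mult_i_l2 (field_class \<Omega> y)))) \<longlonglongrightarrow> of_real 0 + \<i> * of_real 0"
      by (intro tendsto_add tendsto_mult tendsto_of_real tendsto_const vn)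
    then show "(\<lambda>n. L2_inner \<Omega> (u n) y) \<longlonglongrightarrow> 0" by (simp add: L2_inner_eq[OF \<Omega> uL(1) y] u)
  qed
  moreover have "(\<lambda>n. L2_norm \<Omega> (\<lambda>x. h n x - (\<chi> i. complex_of_real \<mu> * u n x $ i))) \<longlonglongrightarrow> 0"
  proof -
    have "L2_norm \<Omega> (\<lambda>x. h n x - (\<chi> i. complex_of_real \<mu> * u n x $ i)) = norm (f n - \<mu> *\<^sub>R v n)" for n
      unfolding complex_scale_eq
      using L2_norm_eq[OF \<Omega> Lp_diff[OF \<Omega> hL Lp_scaleR[OF \<Omega> uL(1)]], of n \<mu> n] field_class_diff[OF \<Omega> hL Lp_scaleR[OF \<Omega> uL(1)], of n \<mu> n]
      by (simp add: field_class_scaleR[OF \<Omega> uL(1)] u h)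
    then show ?thesis using lim by simp
  qed
  ultimately show ?thesis unfolding maxwell_essential_spectrum_def by blast
qed

lemma quasi_cylindrical_admissible:
  assumes "quasi_cylindrical \<Omega>" shows "\<exists>r. admissible_radius \<Omega> r"
proof -
  from assms obtain a d where d: "0 < d" and dis: "disjoint_family (\<lambda>n::nat. cube (a n) d)" and sub: "\<And>n. cube (a n) d \<subseteq> \<Omega>"
    by (auto simp: quasi_cylindrical_def)
  have b: "ball (a n + (\<chi> i. d/2)) (d/2) \<subseteq> cube (a n) d" for n
  proof
    fix y assume y: "y \<in> ball (a n + (\<chi> i. d/2)) (d/2)"
    have "\<bar>y $ i - (a n $ i + d/2)\<bar> < d/2" for i
    proof -
      have "\<bar>(y - (a n + (\<chi> i. d/2))) $ i\<bar> \<le> norm (y - (a n + (\<chi> i. d/2)))" by (rule component_le_norm_cart)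
      also have "\<dots> < d/2" using y by (simp add: dist_norm norm_minus_commute)
      finally show ?thesis by simp
    qed
    then show "y \<in> cube (a n) d" unfolding cube_def mem_box_cart by (auto simp: abs_less_iff) (smt (verit) field_sum_of_halves)+
  qed
  have "admissible_radius \<Omega> (d/2)" unfolding admissible_radius_def
  proof (intro conjI exI[of _ "\<lambda>n. a n + (\<chi> i. d/2)"] allI)
    show "disjoint_family (\<lambda>n. ball (a n + (\<chi> i. d/2)) (d/2))"
      using dis b unfolding disjoint_family_on_def by blast
    show "ball (a n + (\<chi> i. d/2)) (d/2) \<subseteq> \<Omega>" for n using b sub by blast
  qed (use d in simp)
  then show ?thesis by blast
qed

text \<open>For \<open>\<mu> > 0\<close> the hypothesis itself bounds \<open>S\<close> by \<open>sqrt (C / \<mu>)\<close>, so the supremum is a genuine one.\<close>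
lemma bound_by_supremum:
  fixes \<mu> C :: real
  assumes ne: "S \<noteq> {}" and S: "\<And>r. r \<in> S \<Longrightarrow> 0 < r \<and> \<mu> \<le> C / r\<^sup>2" and C: "0 \<le> C"
  shows "\<mu> \<le> C / (Sup S)\<^sup>2"
proof (cases "\<mu> \<le> 0")
  case True
  have "0 \<le> C / (Sup S)\<^sup>2" using C by simp
  then show ?thesis using True by linarith
next
  case False
  have le: "r \<le> sqrt (C / \<mu>)" if "r \<in> S" for r
  proof (rule real_le_rsqrt)
    have "0 < r\<^sup>2" "\<mu> \<le> C / r\<^sup>2" using S[OF that] by auto
    then have "\<mu> * r\<^sup>2 \<le> C" by (simp only: pos_le_divide_eq)
    then show "r\<^sup>2 \<le> C / \<mu>" using False by (simp add: pos_le_divide_eq mult.commute)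
  qed
  obtain r0 where r0: "r0 \<in> S" using ne by blast
  have "r0 \<le> Sup S" using le by (intro cSup_upper r0 bdd_aboveI)
  then have pos: "0 < Sup S" using S[OF r0] by linarith
  have "Sup S \<le> sqrt (C / \<mu>)" using ne le by (rule cSup_least)
  then have "(Sup S)\<^sup>2 \<le> C / \<mu>" using power_mono[OF _ less_imp_le[OF pos], of "sqrt (C / \<mu>)" 2] False C by simp
  then show ?thesis using pos False by (simp add: field_simps)
qed

theorem theorem4p2:
  "\<exists>C>0. \<forall>\<Omega> :: (real^3) set. open \<Omega> \<and> quasi_cylindrical \<Omega> \<longrightarrow>
     maxwell_essential_spectrum \<Omega> \<noteq> {} \<and>
     (\<exists>\<mu> :: real. complex_of_real \<mu> \<in> maxwell_essential_spectrum \<Omega> \<and>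
        (\<forall>z \<in> maxwell_essential_spectrum \<Omega>. Im z = 0 \<and> \<mu> \<le> Re z) \<and>
        \<mu> \<le> C / (ball_radius \<Omega>)^2)"
proof (rule exI[of _ "model_ratio + 1"], intro conjI allI impI)
  \<comment> \<open>Adding one keeps the constant positive without computing the curl of the model field.\<close>
  show "0 < model_ratio + 1" using model_ratio_nonneg by simp
  fix \<Omega> :: "(real^3) set" assume "open \<Omega> \<and> quasi_cylindrical \<Omega>"
  then have \<Omega>: "open \<Omega>" and qc: "quasi_cylindrical \<Omega>" by auto
  obtain r where r: "admissible_radius \<Omega> r" using quasi_cylindrical_admissible[OF qc] by blast
  obtain \<phi> \<omega> :: "nat \<Rightarrow> l2" where phi: "\<And>n. (\<phi> n, \<omega> n) \<in> form_graph \<Omega>"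
    "\<And>i j. inner (\<phi> i) (\<phi> j) = (if i = j then 1 else 0)" "\<And>n. (norm (\<omega> n))\<^sup>2 \<le> model_ratio / r\<^sup>2"
    using orthonormal_ball_fields[OF \<Omega> r] by blast
  obtain \<mu> and v w f :: "nat \<Rightarrow> l2" where
    low: "\<And>(\<phi> :: nat \<Rightarrow> l2) \<omega> \<Lambda>. (\<And>n. (\<phi> n, \<omega> n) \<in> form_graph \<Omega>) \<Longrightarrow> (\<And>n. norm (\<phi> n) = 1) \<Longrightarrow>
       (\<And>x. x \<in> fst ` form_graph \<Omega> \<Longrightarrow> (\<lambda>n. inner (\<phi> n) x) \<longlonglongrightarrow> 0) \<Longrightarrow>
       (\<lambda>n. (norm (\<omega> n))\<^sup>2) \<longlonglongrightarrow> \<Lambda> \<Longrightarrow> \<mu> \<le> \<Lambda>"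
    and up: "\<And>(\<phi> :: nat \<Rightarrow> l2) \<omega> \<Lambda>. (\<And>n. (\<phi> n, \<omega> n) \<in> form_graph \<Omega>) \<Longrightarrow>
       (\<And>i j. inner (\<phi> i) (\<phi> j) = (if i = j then 1 else 0)) \<Longrightarrow>
       (\<And>n. (norm (\<omega> n))\<^sup>2 \<le> \<Lambda>) \<Longrightarrow> \<mu> \<le> \<Lambda>"
    and sing: "\<And>n. (v n, w n) \<in> form_graph \<Omega>" "\<And>n. f n \<in> fst ` form_graph \<Omega>" "\<And>n. norm (v n) = 1"
    "\<And>x. (\<lambda>n. inner (v n) x) \<longlonglongrightarrow> 0"
    "\<And>n x z. (x, z) \<in> form_graph \<Omega> \<Longrightarrow> inner (w n) z = inner (f n) x"
    "(\<lambda>n. norm (f n - \<mu> *\<^sub>R v n)) \<longlonglongrightarrow> 0"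
    by (rule singular_sequence_at_infimum[OF subspace_form_graph[OF \<Omega>] closed_form_graph[OF \<Omega>] phi]) blast
  have mem: "complex_of_real \<mu> \<in> maxwell_essential_spectrum \<Omega>"
    by (rule essential_spectrum_member[OF \<Omega> sing])
  then show "maxwell_essential_spectrum \<Omega> \<noteq> {}" by blast
  have lower: "Im z = 0 \<and> \<mu> \<le> Re z" if z: "z \<in> maxwell_essential_spectrum \<Omega>" for z
    by (rule essential_spectrum_lower_bound[OF \<Omega> z]) (use low in blast)
  have upper: "\<mu> \<le> (model_ratio + 1) / s\<^sup>2" if s: "admissible_radius \<Omega> s" for s
  proof -
    have "\<mu> \<le> model_ratio / s\<^sup>2"
      by (rule orthonormal_ball_fields[OF \<Omega> s]) (rule up)
    also have "\<dots> \<le> (model_ratio + 1) / s\<^sup>2" by (rule divide_right_mono) auto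
    finally show ?thesis .
  qed
  have "\<mu> \<le> (model_ratio + 1) / (Sup {r. admissible_radius \<Omega> r})\<^sup>2"
    using r upper model_ratio_nonneg by (intro bound_by_supremum) (auto simp: admissible_radius_def)
  then have "\<mu> \<le> (model_ratio + 1) / (ball_radius \<Omega>)\<^sup>2"
    by (simp add: ball_radius_def admissible_radius_def)
  with mem lower show "\<exists>\<mu> :: real. complex_of_real \<mu> \<in> maxwell_essential_spectrum \<Omega> \<and>
        (\<forall>z \<in> maxwell_essential_spectrum \<Omega>. Im z = 0 \<and> \<mu> \<le> Re z) \<and>
        \<mu> \<le> (model_ratio + 1) / (ball_radius \<Omega>)^2" by blast
qed

end
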